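(* Let $\frac53<\gamma<3$ and $d\in\{2,3\}$. Let $(\rho,u)$ be a classical solution of the radial Euler system on $[0,T)$ ($T\le\infty$) whose initial data satisfy Assumption (A), written in Lagrangian coordinates. Fix $\bar x'>0$, let $\Omega=\{(x',t'):x'\ge x^+(t';\bar x'),\ 0\le t'<T\}$, and let $N(\bar x')$ be any constant with $$N(\bar x')>\sup_{x'\ge \bar x'}\max\{\tilde\alpha(x',0),\tilde\beta(x',0)\}\quad\text{and}\quad N(\bar x')>\max\Big\{\tfrac{8(\gamma-1)}{(3-\gamma)K_c},\tfrac{4(\gamma-1)}{(3\gamma-5)K_c}\Big\}\hat K(\bar x').$$ Then $$\sup_{(x',t')\in\Omega}\max\{\tilde\alpha(x',t'),\tilde\beta(x',t')\}<N(\bar x'),$$ and for every $(x',t')\in\Omega$, $$v^{\frac{\gamma-1}{2}}(x',t')\le v^{\frac{\gamma-1}{2}}(x',0)+\sqrt{K\gamma}\,K_\tau^{-1}N(\bar x')\,t'.$$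
   Context: Fix $K>0$, $\gamma>1$, $d\in\{2,3\}$, $A(r)=r^{d-1}$, $p=K\rho^\gamma$. Radial Euler system: $(A\rho)_t+(A\rho u)_r=0$, $(A\rho u)_t+(A\rho u^2)_r+Ap_r=0$; classical solutions are $C^1$ with $\rho\ge0$. Assumption (A): $\rho_0,u_0\in C^1([0,\infty))$; $\rho_0^{\frac{\gamma-1}{2}}(r)/r$ and $u_0(r)/r$ belong to $C^1([0,1))$; there is a constant $C_0$ with $0<\frac{2\sqrt{K\gamma}}{\gamma-1}\rho_0^{\frac{\gamma-1}{2}}(r)\le u_0(r)\le C_0$ for all $r>0$; and $\rho_0(0)=u_0(0)=0$. Lagrangian coordinates: $x'=\int_0^r A(s)\rho(s,t)ds$, $t'=t$, inverse $r(x',t')$; $v=1/(A\rho)$; $\eta=\frac{2\sqrt{K\gamma}}{\gamma-1}(A\rho)^{\frac{\gamma-1}{2}}$; $A=A(r(x',t'))$. Constants $K_\tau=\big(\frac{2\sqrt{K\gamma}}{\gamma-1}\big)^{\frac{2}{\gamma-1}}$, $K_c=\sqrt{K\gamma}\,K_\tau^{-\frac{\gamma+1}{2}}$; Lagrangian sound speed $C=K_cA^{-\frac{\gamma-1}{2}}\eta^{\frac{\gamma+1}{\gamma-1}}$. The forward characteristic from $(\bar x',0)$ is $x^+(t';\bar x')$ solving $\frac{d}{dt'}x^+=C(x^+,t')$, $x^+(0;\bar x')=\bar x'$. Gradient variables: $\alpha=u_{x'}+A^{-\frac{\gamma-1}{2}}\eta_{x'}$, $\beta=u_{x'}-A^{-\frac{\gamma-1}{2}}\eta_{x'}$,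 $\tilde\alpha=\eta^{\frac{3-\gamma}{\gamma-1}}\alpha$, $\tilde\beta=\eta^{\frac{3-\gamma}{\gamma-1}}\beta$. Finally $$\hat K(\bar x')=\frac{(\gamma-1)(3\gamma-5)(d-1)}{8}\,r(\bar x',0)^{\frac{d(1-\gamma)+\gamma-3}{2}}.$$ *)

theory Defs
  imports "HOL-Analysis.Analysis"
begin

definition C1_on :: "real set \<Rightarrow> (real \<Rightarrow> real) \<Rightarrow> bool" where
  "C1_on S f \<longleftrightarrow> (\<exists>f'. continuous_on S f' \<and>
      (\<forall>x\<in>S. (f has_real_derivative f' x) (at x within S)))"

definition C1_on2 :: "(real \<times> real) set \<Rightarrow> (real \<Rightarrow> real \<Rightarrow> real) \<Rightarrow> bool" where
  "C1_on2 S f \<longleftrightarrow> (\<exists>fr ft. continuous_on S fr \<and> continuous_on S ft \<and>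
      (\<forall>p\<in>S. ((\<lambda>(r,t). f r t) has_derivative (\<lambda>(h,k). h * fr p + k * ft p)) (at p within S)))"

definition pdr :: "(real \<Rightarrow> real \<Rightarrow> real) \<Rightarrow> real \<Rightarrow> real \<Rightarrow> real" where
  "pdr f r t = deriv (\<lambda>s. f s t) r"
definition pdt :: "(real \<Rightarrow> real \<Rightarrow> real) \<Rightarrow> real \<Rightarrow> real \<Rightarrow> real" where
  "pdt f r t = deriv (\<lambda>s. f r s) t"

definition dom_ST :: "ereal \<Rightarrow> (real \<times> real) set" where
  "dom_ST T = {(r,t). 0 \<le> r \<and> 0 \<le> t \<and> ereal t < T}"

definition classical_solution ::
  "real \<Rightarrow> real \<Rightarrow> nat \<Rightarrow> ereal \<Rightarrow> (real \<Rightarrow> real \<Rightarrow> real) \<Rightarrow> (real \<Rightarrow> real \<Rightarrow> real) \<Rightarrow> bool" where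
  "classical_solution K \<gamma> d T \<rho> u \<longleftrightarrow>
     C1_on2 (dom_ST T) \<rho> \<and> C1_on2 (dom_ST T) u \<and>
     (\<forall>(r,t)\<in>dom_ST T. 0 \<le> \<rho> r t) \<and>
     (\<forall>r t. 0 < r \<and> 0 < t \<and> ereal t < T \<longrightarrow>
        pdt (\<lambda>r t. r^(d-1) * \<rho> r t) r t + pdr (\<lambda>r t. r^(d-1) * \<rho> r t * u r t) r t = 0 \<and>
        pdt (\<lambda>r t. r^(d-1) * \<rho> r t * u r t) r t
          + pdr (\<lambda>r t. r^(d-1) * \<rho> r t * (u r t)^2) r t
          + r^(d-1) * pdr (\<lambda>r t. K * \<rho> r t powr \<gamma>) r t = 0)"

definition assumption_A :: "real \<Rightarrow> real \<Rightarrow> (real \<Rightarrow> real) \<Rightarrow> (real \<Rightarrow> real) \<Rightarrow> bool" where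
  "assumption_A K \<gamma> \<rho>0 u0 \<longleftrightarrow>
     C1_on {0..} \<rho>0 \<and> C1_on {0..} u0 \<and>
     (\<exists>g. C1_on {0..<1} g \<and> (\<forall>r\<in>{0<..<1}. g r = \<rho>0 r powr ((\<gamma>-1)/2) / r)) \<and>
     (\<exists>g. C1_on {0..<1} g \<and> (\<forall>r\<in>{0<..<1}. g r = u0 r / r)) \<and>
     (\<exists>C0. \<forall>r>0. 0 < 2 * sqrt (K*\<gamma>) / (\<gamma>-1) * \<rho>0 r powr ((\<gamma>-1)/2)
                 \<and> 2 * sqrt (K*\<gamma>) / (\<gamma>-1) * \<rho>0 r powr ((\<gamma>-1)/2) \<le> u0 r
                 \<and> u0 r \<le> C0) \<and>
     \<rho>0 0 = 0 \<and> u0 0 = 0"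

definition mass :: "nat \<Rightarrow> (real \<Rightarrow> real \<Rightarrow> real) \<Rightarrow> real \<Rightarrow> real \<Rightarrow> real" where
  "mass d \<rho> r t = integral {0..r} (\<lambda>s. s^(d-1) * \<rho> s t)"

definition LDom :: "nat \<Rightarrow> (real \<Rightarrow> real \<Rightarrow> real) \<Rightarrow> real \<Rightarrow> real set" where
  "LDom d \<rho> t = {x. \<exists>r\<ge>0. mass d \<rho> r t = x}"

definition rL :: "nat \<Rightarrow> (real \<Rightarrow> real \<Rightarrow> real) \<Rightarrow> real \<Rightarrow> real \<Rightarrow> real" where
  "rL d \<rho> x t = (THE r. 0 \<le> r \<and> mass d \<rho> r t = x)"

definition AL :: "nat \<Rightarrow> (real \<Rightarrow> real \<Rightarrow> real) \<Rightarrow> real \<Rightarrow> real \<Rightarrow> real" where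
  "AL d \<rho> x t = (rL d \<rho> x t)^(d-1)"

definition uL :: "nat \<Rightarrow> (real \<Rightarrow> real \<Rightarrow> real) \<Rightarrow> (real \<Rightarrow> real \<Rightarrow> real) \<Rightarrow> real \<Rightarrow> real \<Rightarrow> real" where
  "uL d \<rho> u x t = u (rL d \<rho> x t) t"

definition vL :: "nat \<Rightarrow> (real \<Rightarrow> real \<Rightarrow> real) \<Rightarrow> real \<Rightarrow> real \<Rightarrow> real" where
  "vL d \<rho> x t = 1 / (AL d \<rho> x t * \<rho> (rL d \<rho> x t) t)"

definition etaL :: "real \<Rightarrow> real \<Rightarrow> nat \<Rightarrow> (real \<Rightarrow> real \<Rightarrow> real) \<Rightarrow> real \<Rightarrow> real \<Rightarrow> real" where
  "etaL K \<gamma> d \<rho> x t = 2 * sqrt (K*\<gamma>) / (\<gamma>-1)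
        * (AL d \<rho> x t * \<rho> (rL d \<rho> x t) t) powr ((\<gamma>-1)/2)"

definition K_tau :: "real \<Rightarrow> real \<Rightarrow> real" where
  "K_tau K \<gamma> = (2 * sqrt (K*\<gamma>) / (\<gamma>-1)) powr (2/(\<gamma>-1))"

definition K_c :: "real \<Rightarrow> real \<Rightarrow> real" where
  "K_c K \<gamma> = sqrt (K*\<gamma>) * K_tau K \<gamma> powr (-(\<gamma>+1)/2)"

definition CL :: "real \<Rightarrow> real \<Rightarrow> nat \<Rightarrow> (real \<Rightarrow> real \<Rightarrow> real) \<Rightarrow> real \<Rightarrow> real \<Rightarrow> real" where
  "CL K \<gamma> d \<rho> x t = K_c K \<gamma> * AL d \<rho> x t powr (-(\<gamma>-1)/2)
        * etaL K \<gamma> d \<rho> x t powr ((\<gamma>+1)/(\<gamma>-1))"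

definition forward_char ::
  "real \<Rightarrow> real \<Rightarrow> nat \<Rightarrow> ereal \<Rightarrow> (real \<Rightarrow> real \<Rightarrow> real) \<Rightarrow> real \<Rightarrow> (real \<Rightarrow> real) \<Rightarrow> bool" where
  "forward_char K \<gamma> d T \<rho> xbar xp \<longleftrightarrow> xp 0 = xbar \<and>
     (\<forall>t. 0 \<le> t \<and> ereal t < T \<longrightarrow>
        (xp has_real_derivative CL K \<gamma> d \<rho> (xp t) t) (at t within {t. 0 \<le> t \<and> ereal t < T}))"

definition alphaL :: "real \<Rightarrow> real \<Rightarrow> nat \<Rightarrow> (real \<Rightarrow> real \<Rightarrow> real) \<Rightarrow> (real \<Rightarrow> real \<Rightarrow> real) \<Rightarrow> real \<Rightarrow> real \<Rightarrow> real" where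
  "alphaL K \<gamma> d \<rho> u x t = deriv (\<lambda>y. uL d \<rho> u y t) x
      + AL d \<rho> x t powr (-(\<gamma>-1)/2) * deriv (\<lambda>y. etaL K \<gamma> d \<rho> y t) x"

definition betaL :: "real \<Rightarrow> real \<Rightarrow> nat \<Rightarrow> (real \<Rightarrow> real \<Rightarrow> real) \<Rightarrow> (real \<Rightarrow> real \<Rightarrow> real) \<Rightarrow> real \<Rightarrow> real \<Rightarrow> real" where
  "betaL K \<gamma> d \<rho> u x t = deriv (\<lambda>y. uL d \<rho> u y t) x
      - AL d \<rho> x t powr (-(\<gamma>-1)/2) * deriv (\<lambda>y. etaL K \<gamma> d \<rho> y t) x"

definition alpha_t :: "real \<Rightarrow> real \<Rightarrow> nat \<Rightarrow> (real \<Rightarrow> real \<Rightarrow> real) \<Rightarrow> (real \<Rightarrow> real \<Rightarrow> real) \<Rightarrow> real \<Rightarrow> real \<Rightarrow> real" where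
  "alpha_t K \<gamma> d \<rho> u x t = etaL K \<gamma> d \<rho> x t powr ((3-\<gamma>)/(\<gamma>-1)) * alphaL K \<gamma> d \<rho> u x t"

definition beta_t :: "real \<Rightarrow> real \<Rightarrow> nat \<Rightarrow> (real \<Rightarrow> real \<Rightarrow> real) \<Rightarrow> (real \<Rightarrow> real \<Rightarrow> real) \<Rightarrow> real \<Rightarrow> real \<Rightarrow> real" where
  "beta_t K \<gamma> d \<rho> u x t = etaL K \<gamma> d \<rho> x t powr ((3-\<gamma>)/(\<gamma>-1)) * betaL K \<gamma> d \<rho> u x t"

definition K_hat :: "real \<Rightarrow> nat \<Rightarrow> (real \<Rightarrow> real \<Rightarrow> real) \<Rightarrow> real \<Rightarrow> real" where
  "K_hat \<gamma> d \<rho> xbar = (\<gamma>-1) * (3*\<gamma>-5) * (real d - 1) / 8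
       * rL d \<rho> xbar 0 powr ((real d * (1-\<gamma>) + \<gamma> - 3)/2)"

definition Omega :: "nat \<Rightarrow> ereal \<Rightarrow> (real \<Rightarrow> real \<Rightarrow> real) \<Rightarrow> (real \<Rightarrow> real) \<Rightarrow> (real \<times> real) set" where
  "Omega d T \<rho> xp = {(x,t). 0 \<le> t \<and> ereal t < T \<and> xp t \<le> x \<and> x \<in> LDom d \<rho> t}"

end

(* The argument is carried out in Eulerian coordinates. With z = 2c/(gamma-1) and the Riemann variables
   w = u + z and y = u - z, the weighted gradients are K_tau/eta times w_r + (d-1)c/r and y_r - (d-1)c/r,
   where eta = A^((gamma-1)/2) z. The region behind the forward characteristic is {mass(r,t) >= xp(t)}.
   Its left boundary moves with speed u + c, so a straight segment traced backwards in time with a speed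
   in (0, u + c) stays in it and to the left of every vertical line. This gives a maximum principle on
   bounded pieces that needs neither integral curves nor control at infinity. It yields first the
   supersonic invariant region rho > 0, u >= z (the bound w < 2 C0 + 1 keeps the forward characteristic at finite
   radius), and then r >= r(xbar,0).
   Since w and y are only C^1, the Riccati inequalities are applied to difference quotients
   (w(r+h,t) - w(r,t))/h, which solve the transport equation up to an error vanishing with h; a first
   contact with the barrier for arbitrarily small h would produce a limit point where the Riccati
   right-hand side is nonnegative, which the second condition on N excludes. The bound on the specific
   volume follows by integrating the bound on u_r along particle paths. *)

theory Submission
  imports Defs
begin

subsection \<open>Solutions and the mass function\<close>

text \<open>With e = (\<gamma>-1)/2 the range 5/3 < \<gamma> < 3 is 1/3 < e < 1, and the signs of
  3e-1 and 1-e fix the sign of the Riccati right-hand side at a contact. What remains to be required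
  there is (d-1)e \<le> \<mu> r^(b+1) with b = (d-1)e and \<mu> = N'/K_tau. The right side grows
  with r, so the condition at r(xbar,0) is enough once the region is known to stay outside that
  radius; this is where the power of r in K_hat comes from. The obstacle is a circularity. The speed
  of \<open>xp\<close> is known to be u + c only where \<rho> > 0, because \<open>rL\<close> inverts
  the mass by a \<open>THE\<close>; the backward family has positive speed only where u > c; and
  both facts are wanted on the very region bounded by \<open>xp\<close>. They are therefore
  propagated together, along with an outer radius that outruns the characteristic, so that at each
  time there are points strictly inside the region from which positivity at the boundary follows by
  a limit. N' lies strictly between the data and N: the barrier is then strict at time 0, while the
  non-strict bound at later times still gives a strict supremum.\<close>

definition time_dom :: "ereal \<Rightarrow> real set" where
  "time_dom T = {t. 0 \<le> t \<and> ereal t < T}"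

lemma dom_ST_eq: "dom_ST T = {0..} \<times> time_dom T"
  by (auto simp: dom_ST_def time_dom_def)

lemma time_dom_le: "t \<in> time_dom T \<Longrightarrow> 0 \<le> s \<Longrightarrow> s \<le> t \<Longrightarrow> s \<in> time_dom T"
  using le_less_trans[of "ereal s" "ereal t" T] by (auto simp: time_dom_def)

lemma convex_time_dom: "convex (time_dom T)"
proof -
  have "is_interval (time_dom T)"
    unfolding is_interval_1 using time_dom_le by (auto simp: time_dom_def)
  then show ?thesis by (simp add: is_interval_convex)
qed

lemma open_interior_time: "open {p::real\<times>real. 0 < fst p \<and> 0 < snd p \<and> ereal (snd p) < T}"
  by (intro open_Collect_conj open_Collect_less continuous_intros)

lemma slice_deriv:
  assumes "((\<lambda>(r,t). F r t) has_derivative (\<lambda>(h,k). h * a + k * b)) (at (r,t) within dom_ST T)"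
    "0 \<le> r" "t \<in> time_dom T"
  shows "((\<lambda>r. F r t) has_real_derivative a) (at r within {0..})"
proof -
  have "((\<lambda>s. (\<lambda>(r,t). F r t) (s,t)) has_derivative (\<lambda>h. (\<lambda>(h,k). h * a + k * b) (h,0))) (at r within {0..})"
    by (rule has_derivative_in_compose[where f="\<lambda>s. (s,t)"], (auto intro!: derivative_eq_intros)[1],
        rule has_derivative_subset[OF assms(1)]) (use assms in \<open>auto simp: dom_ST_eq\<close>)
  then show ?thesis by (simp add: has_field_derivative_def mult_commute_abs)
qed

lemma slice_deriv_t:
  assumes "((\<lambda>(r,t). F r t) has_derivative (\<lambda>(h,k). h * a + k * b)) (at (r,t) within dom_ST T)"
    "0 \<le> r" "t \<in> time_dom T"
  shows "((\<lambda>t. F r t) has_real_derivative b) (at t within time_dom T)"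
proof -
  have "((\<lambda>s. (\<lambda>(r,t). F r t) (r,s)) has_derivative (\<lambda>k. (\<lambda>(h,k). h * a + k * b) (0,k))) (at t within time_dom T)"
    by (rule has_derivative_in_compose[where f="\<lambda>s. (r,s)"], (auto intro!: derivative_eq_intros)[1],
        rule has_derivative_subset[OF assms(1)]) (use assms in \<open>auto simp: dom_ST_eq\<close>)
  then show ?thesis by (simp add: has_field_derivative_def mult_commute_abs)
qed

lemma at_within_time:
  assumes "0 < t" "t \<in> time_dom T" shows "at t within time_dom T = at t"
proof (rule at_within_interior, rule interiorI)
  show "open {s. 0 < s \<and> ereal s < T}" by (intro open_Collect_conj open_Collect_less continuous_intros)
qed (use assms in \<open>auto simp: time_dom_def\<close>)

lemma at_within_dom:
  assumes "0 < r" "0 < t" "t \<in> time_dom T"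
  shows "at (r,t) within dom_ST T = at (r,t)"
proof (rule at_within_interior, rule interiorI)
  show "(r,t) \<in> {p. 0 < fst p \<and> 0 < snd p \<and> ereal (snd p) < T}" using assms by (auto simp: time_dom_def)
qed (use open_interior_time[of T] in \<open>auto simp: dom_ST_def\<close>)

lemma at_within_pos: "0 < r \<Longrightarrow> at r within {0..} = at (r::real)"
  by (rule at_within_interior) auto

text \<open>The partial derivatives are fixed as functions so that they are available up to t = 0
  and r = 0, where the two-sided \<open>deriv\<close> is not. The momentum equation is in
  nonconservative form, which comes from a division by \<rho>; hence it is stated only where the
  density is positive.\<close>

locale radial_euler =
  fixes K \<gamma> :: real and d :: nat and T :: ereal
    and \<rho> u \<rho>r \<rho>t ur ut :: "real \<Rightarrow> real \<Rightarrow> real"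
  assumes K: "0 < K" and gam: "1 < \<gamma>" and d2: "2 \<le> d"
    and cont_partials:
      "continuous_on (dom_ST T) (\<lambda>(r,t). \<rho>r r t)" "continuous_on (dom_ST T) (\<lambda>(r,t). \<rho>t r t)"
      "continuous_on (dom_ST T) (\<lambda>(r,t). ur r t)" "continuous_on (dom_ST T) (\<lambda>(r,t). ut r t)"
    and \<rho>_deriv: "\<And>r t. 0 \<le> r \<Longrightarrow> t \<in> time_dom T \<Longrightarrow>
      ((\<lambda>(r,t). \<rho> r t) has_derivative (\<lambda>(h,k). h * \<rho>r r t + k * \<rho>t r t)) (at (r,t) within dom_ST T)"
    and u_deriv: "\<And>r t. 0 \<le> r \<Longrightarrow> t \<in> time_dom T \<Longrightarrow>
      ((\<lambda>(r,t). u r t) has_derivative (\<lambda>(h,k). h * ur r t + k * ut r t)) (at (r,t) within dom_ST T)"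
    and \<rho>_nonneg: "\<And>r t. 0 \<le> r \<Longrightarrow> t \<in> time_dom T \<Longrightarrow> 0 \<le> \<rho> r t"
    and mass_eq: "\<And>r t. 0 < r \<Longrightarrow> 0 < t \<Longrightarrow> t \<in> time_dom T \<Longrightarrow>
      \<rho>t r t + u r t * \<rho>r r t + \<rho> r t * (ur r t + real (d-1) * u r t / r) = 0"
    and mom_eq: "\<And>r t. 0 < r \<Longrightarrow> 0 < t \<Longrightarrow> t \<in> time_dom T \<Longrightarrow> 0 < \<rho> r t \<Longrightarrow>
      ut r t + u r t * ur r t + K * \<gamma> * \<rho> r t powr (\<gamma> - 2) * \<rho>r r t = 0"
begin

definition "n = real (d - 1)"
abbreviation "m \<equiv> mass d \<rho>"

lemma n_pos: "0 < n" using d2 by (simp add: n_def)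

lemmas euler_mass = mass_eq[folded n_def]

lemma cont_\<rho>u: "continuous_on (dom_ST T) (\<lambda>(r,t). \<rho> r t)" "continuous_on (dom_ST T) (\<lambda>(r,t). u r t)"
  unfolding continuous_on_eq_continuous_within
  using has_derivative_continuous[OF \<rho>_deriv] has_derivative_continuous[OF u_deriv] by (auto simp: dom_ST_eq)

lemma cont_on_comp:
  assumes "continuous_on (dom_ST T) (\<lambda>(r,t). F r t)" "continuous_on S f" "continuous_on S g"
    "\<And>x. x \<in> S \<Longrightarrow> 0 \<le> f x \<and> g x \<in> time_dom T"
  shows "continuous_on S (\<lambda>x. F (f x) (g x))"
proof -
  have "continuous_on S (\<lambda>x. (\<lambda>(r,t). F r t) (f x, g x))"
    using assms by (intro continuous_on_compose2[OF assms(1)] continuous_intros) (auto simp: dom_ST_eq)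
  then show ?thesis by simp
qed

lemma \<rho>_has_derivative:
  assumes "0 < r" "0 < t" "t \<in> time_dom T"
  shows "((\<lambda>p. \<rho> (fst p) (snd p)) has_derivative (\<lambda>q. fst q * \<rho>r r t + snd q * \<rho>t r t)) (at (r,t))"
  using \<rho>_deriv[of r t] assms by (simp add: at_within_dom split_def)

lemma u_has_derivative:
  assumes "0 < r" "0 < t" "t \<in> time_dom T"
  shows "((\<lambda>p. u (fst p) (snd p)) has_derivative (\<lambda>q. fst q * ur r t + snd q * ut r t)) (at (r,t))"
  using u_deriv[of r t] assms by (simp add: at_within_dom split_def)

lemma \<rho>_r: "0 \<le> r \<Longrightarrow> t \<in> time_dom T \<Longrightarrow> ((\<lambda>r. \<rho> r t) has_real_derivative \<rho>r r t) (at r within {0..})"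
  by (rule slice_deriv[OF \<rho>_deriv])
lemma u_r: "0 \<le> r \<Longrightarrow> t \<in> time_dom T \<Longrightarrow> ((\<lambda>r. u r t) has_real_derivative ur r t) (at r within {0..})"
  by (rule slice_deriv[OF u_deriv])
lemma \<rho>_t: "0 \<le> r \<Longrightarrow> t \<in> time_dom T \<Longrightarrow> ((\<lambda>t. \<rho> r t) has_real_derivative \<rho>t r t) (at t within time_dom T)"
  by (rule slice_deriv_t[OF \<rho>_deriv])

section \<open>The mass function: monotonicity, continuity and derivatives\<close>

lemma dens_cont: "t \<in> time_dom T \<Longrightarrow> continuous_on {0..r} (\<lambda>s. s^(d-1) * \<rho> s t)"
  by (intro continuous_intros cont_on_comp[OF cont_\<rho>u(1)]) auto

lemma mass_0 [simp]: "m 0 t = 0" by (simp add: mass_def)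

lemma mass_diff:
  assumes "t \<in> time_dom T" "0 \<le> a" "a \<le> b"
  shows "m b t - m a t = integral {a..b} (\<lambda>s. s^(d-1) * \<rho> s t)"
proof -
  have "(\<lambda>s. s^(d-1) * \<rho> s t) integrable_on {0..b}"
    using dens_cont[OF assms(1)] by (rule integrable_continuous_real)
  from Henstock_Kurzweil_Integration.integral_combine[OF assms(2,3) this] show ?thesis by (simp add: mass_def)
qed

lemma mass_mono:
  assumes "t \<in> time_dom T" "0 \<le> a" "a \<le> b"
  shows "m a t \<le> m b t"
proof -
  have "0 \<le> integral {a..b} (\<lambda>s. s^(d-1) * \<rho> s t)"
    using assms \<rho>_nonneg by (intro Henstock_Kurzweil_Integration.integral_nonneg integrable_continuous_real
        continuous_on_subset[OF dens_cont[of t b]]) auto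
  then show ?thesis using mass_diff[OF assms] by simp
qed

lemma mass_r_within:
  assumes "t \<in> time_dom T" "0 \<le> r"
  shows "((\<lambda>r. m r t) has_real_derivative r^(d-1) * \<rho> r t) (at r within {0..})"
proof -
  have "((\<lambda>x. m x t) has_real_derivative r^(d-1) * \<rho> r t) (at r within {0..r+1})"
    unfolding mass_def using assms by (intro integral_has_real_derivative dens_cont) auto
  moreover have "at r within {0..r+1} = at r within {0..}"
    by (rule at_within_nhd[of _ "{..<r+1}"]) auto
  ultimately show ?thesis by simp
qed

lemma mass_r:
  assumes "t \<in> time_dom T" "0 < r"
  shows "((\<lambda>r. m r t) has_real_derivative r^(d-1) * \<rho> r t) (at r)"
  using mass_r_within[of t r] assms at_within_pos[of r] by simp

text \<open>A nonnegative continuous density with zero integral vanishes identically, so one point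
  of positive density suffices. It may be an endpoint, which is the typical use: vacuum next to it
  need not be excluded beforehand.\<close>

lemma mass_strict:
  assumes t: "t \<in> time_dom T" and ab: "0 \<le> a" "a < b" and c: "a \<le> c" "c \<le> b" "0 < c" "0 < \<rho> c t"
  shows "m a t < m b t"
proof -
  have "integral {a..b} (\<lambda>s. s^(d-1) * \<rho> s t) \<noteq> 0"
  proof
    assume "integral {a..b} (\<lambda>s. s^(d-1) * \<rho> s t) = 0"
    then have "\<forall>x\<in>{a..b}. x^(d-1) * \<rho> x t = 0"
      using assms \<rho>_nonneg by (subst (asm) integral_eq_0_iff[OF continuous_on_subset[OF dens_cont[of t b]]]) auto
    then have "c^(d-1) * \<rho> c t = 0" using c(1,2) atLeastAtMost_iff by blast
    then show False using c by simp
  qed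
  then show ?thesis using mass_diff[of t a b] mass_mono[of t a b] assms by simp
qed

lemma mass_cont: "continuous_on (dom_ST T) (\<lambda>(r,t). m r t)"
proof -
  \<comment> \<open>Scaling to the fixed interval [0,1] turns the moving endpoint into a parameter
    of the integrand.\<close>
  have eq: "m r t = integral (cbox 0 1) (\<lambda>\<theta>. r * ((r*\<theta>)^(d-1) * \<rho> (r*\<theta>) t))" if "(r,t) \<in> dom_ST T" for r t
  proof (cases "r = 0")
    case False
    then have r: "0 < r" using that by (auto simp: dom_ST_eq)
    have im: "(\<lambda>x. x / r) ` {0..r} = {0..1}"
      using r by (simp add: image_divide_atLeastAtMost)
    show ?thesis using integral_stretch_real[of r 0 r "\<lambda>s. s^(d-1) * \<rho> s t"] r
      by (simp add: im mass_def)
  qed simp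
  have "continuous_on (dom_ST T) (\<lambda>p. integral (cbox 0 1) (\<lambda>\<theta>. fst p * ((fst p*\<theta>)^(d-1) * \<rho> (fst p*\<theta>) (snd p))))"
    by (rule integral_continuous_on_param)
      (auto intro!: continuous_intros cont_on_comp[OF cont_\<rho>u(1)] simp: split_def dom_ST_eq)
  then show ?thesis
    by (rule continuous_on_eq) (use eq in \<open>auto simp: split_def\<close>)
qed

text \<open>Conservation of mass: after differentiation under the integral, s^(d-1) \<rho>_t is
  minus the radial derivative of the flux s^(d-1) \<rho> u, so only the flux at r survives.\<close>

lemma mass_t:
  assumes t: "0 < t" "t \<in> time_dom T" and r: "0 < r"
  shows "((\<lambda>t. m r t) has_real_derivative - (r^(d-1) * \<rho> r t * u r t)) (at t)"
proof -
  have 1: "((\<lambda>t. integral (cbox 0 r) (\<lambda>s. s^(d-1) * \<rho> s t)) has_real_derivative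
      integral (cbox 0 r) (\<lambda>s. s^(d-1) * \<rho>t s t)) (at t within time_dom T)"
  proof (rule leibniz_rule_field_derivative[where f="\<lambda>t s. s^(d-1) * \<rho> s t" and fx="\<lambda>t s. s^(d-1) * \<rho>t s t"])
    show "(\<lambda>s. s^(d-1) * \<rho> s t) integrable_on cbox 0 r" if "t \<in> time_dom T" for t
      using integrable_continuous_real[OF dens_cont[OF that]] by simp
  qed (use t convex_time_dom[of T] in \<open>auto intro!: DERIV_cmult \<rho>_t
        continuous_intros cont_on_comp[OF cont_partials(2)] simp: split_def\<close>)
  let ?f' = "\<lambda>s. n * s^(d-2) * (\<rho> s t * u s t) + s^(d-1) * (\<rho>r s t * u s t + \<rho> s t * ur s t)"
  have d1: "Suc (d-2) = d - 1" using d2 by simp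
  have "((\<lambda>s. s^(d-1) * (\<rho> s t * u s t)) has_real_derivative ?f' s) (at s within {0..r})" if "s \<in> {0..r}" for s
  proof -
    have "((\<lambda>s. s^(d-1)) has_real_derivative n * s^(d-2)) (at s within {0..r})"
      using d1 unfolding n_def by (auto intro!: derivative_eq_intros simp: diff_diff_eq numeral_2_eq_2)
    moreover have "((\<lambda>s. \<rho> s t) has_real_derivative \<rho>r s t) (at s within {0..r})"
       "((\<lambda>s. u s t) has_real_derivative ur s t) (at s within {0..r})"
      using \<rho>_r[of s t] u_r[of s t] that t by (auto intro: DERIV_subset)
    ultimately show ?thesis
      by (rule DERIV_cong[OF DERIV_mult[OF _ DERIV_mult]]) (simp add: algebra_simps)
  qed
  note f' = this
  have "(?f' has_integral r^(d-1) * (\<rho> r t * u r t) - 0^(d-1) * (\<rho> 0 t * u 0 t)) {0..r}"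
    using r by (intro fundamental_theorem_of_calculus)
      (use f' in \<open>simp_all only: has_real_derivative_iff_has_vector_derivative less_imp_le\<close>)
  \<comment> \<open>The flux vanishes at the origin because d \<ge> 2.\<close>
  then have "(?f' has_integral r^(d-1) * (\<rho> r t * u r t)) {0..r}" using d2 by (simp add: zero_power del: of_nat_diff One_nat_def)
  then have "((\<lambda>s. - ?f' s) has_integral - (r^(d-1) * (\<rho> r t * u r t))) {0..r}"
    by (rule has_integral_neg)
  \<comment> \<open>The mass equation is available for s > 0 only; the origin is a null set.\<close>
  then have "((\<lambda>s. s^(d-1) * \<rho>t s t) has_integral - (r^(d-1) * (\<rho> r t * u r t))) {0..r}"
  proof (rule has_integral_spike[of "{0}", rotated 2])
    fix s assume "s \<in> {0..r} - {0}"
    then have s: "0 < s" by auto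
    have "s^(d-1) = s * s^(d-2)" using d1 by (metis power_Suc)
    moreover have "\<rho>t s t = - (u s t * \<rho>r s t + \<rho> s t * (ur s t + n * u s t / s))" using euler_mass[OF s t] by simp
    ultimately show "s^(d-1) * \<rho>t s t = - ?f' s" using s by (simp only:) (simp add: field_simps)
  qed simp
  then have "integral (cbox 0 r) (\<lambda>s. s^(d-1) * \<rho>t s t) = - (r^(d-1) * \<rho> r t * u r t)"
    by (simp add: integral_unique mult.assoc)
  then show ?thesis using 1 at_within_time[OF t] by (simp add: mass_def)
qed

text \<open>Joint differentiability from one partial derivative at the point and one that is
  continuous nearby. The continuous one is r^(d-1) \<rho>; the rule expects it in the second
  variable, hence the swap to (t,r) and back.\<close>

lemma mass_has_derivative:
  assumes t: "0 < t" "t \<in> time_dom T" and r: "0 < r"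
  shows "((\<lambda>p. m (fst p) (snd p)) has_derivative
    (\<lambda>q. fst q * (r^(d-1) * \<rho> r t) - snd q * (r^(d-1) * \<rho> r t * u r t))) (at (r,t))"
proof -
  obtain X Y where XY: "open X" "open Y" "(r,t) \<in> X \<times> Y"
    "X \<times> Y \<subseteq> {p. 0 < fst p \<and> 0 < snd p \<and> ereal (snd p) < T}"
    using open_prod_elim[OF open_interior_time[of T], of "(r,t)"] t r by (auto simp: time_dom_def)
  then obtain e where e: "e > 0" "ball r e \<subseteq> X" using openE[of X r] by auto
  have inS: "0 < r'" "0 < t'" "t' \<in> time_dom T" if "r' \<in> ball r e" "t' \<in> Y" for r' t'
  proof -
    have "(r',t') \<in> {p. 0 < fst p \<and> 0 < snd p \<and> ereal (snd p) < T}" using XY(4) e that by blast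
    then show "0 < r'" "0 < t'" "t' \<in> time_dom T" by (auto simp: time_dom_def)
  qed
  let ?B = "\<lambda>t r. blinfun_scaleR_left (r^(d-1) * \<rho> r t)"
  have "((\<lambda>(t,r). m r t) has_derivative (\<lambda>(k,h). - (r^(d-1) * \<rho> r t * u r t) * k + blinfun_apply (?B t r) h))
    (at (t,r) within Y \<times> ball r e)"
  proof (rule has_derivative_partialsI)
    show "((\<lambda>s. m r s) has_derivative (*) (- (r^(d-1) * \<rho> r t * u r t))) (at t within Y)"
      using mass_t[OF t r] unfolding has_field_derivative_def by (rule has_derivative_at_withinI)
    show "((\<lambda>y. m y x) has_derivative blinfun_apply (?B x y)) (at y within ball r e)"
      if "x \<in> Y" "y \<in> ball r e" for x y
    proof -
      have "((\<lambda>y. m y x) has_derivative (*) (y^(d-1) * \<rho> y x)) (at y within ball r e)"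
        using mass_r[OF inS(3,1)[OF that(2,1)]]
        unfolding has_field_derivative_def by (rule has_derivative_at_withinI)
      moreover have "blinfun_apply (?B x y) = (*) (y^(d-1) * \<rho> y x)"
        by (rule ext) (simp only: blinfun_scaleR_left.rep_eq real_scaleR_def mult.commute)
      ultimately show ?thesis by (simp only:)
    qed
    have "continuous_on (Y \<times> ball r e) (\<lambda>(x,y). ?B x y)"
      unfolding split_def
      by (intro bounded_linear.continuous_on[OF bounded_linear_blinfun_scaleR_left]
          continuous_intros cont_on_comp[OF cont_\<rho>u(1)]) (use inS in \<open>auto simp: less_imp_le\<close>)
    then show "continuous (at (t,r) within Y \<times> ball r e) (\<lambda>(x,y). ?B x y)"
      unfolding continuous_on_eq_continuous_within by (rule bspec) (use XY e in simp)
  qed (use e in auto)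
  moreover have "at (t,r) within Y \<times> ball r e = at (t,r)"
    by (rule at_within_open) (use XY e in \<open>auto intro: open_Times\<close>)
  ultimately have D: "((\<lambda>(t,r). m r t) has_derivative (\<lambda>(k,h). - (r^(d-1) * \<rho> r t * u r t) * k + h * (r^(d-1) * \<rho> r t))) (at (t,r))"
    by (simp)
  have "((\<lambda>p. (\<lambda>(t,r). m r t) (snd p, fst p)) has_derivative
     (\<lambda>q. (\<lambda>(k,h). - (r^(d-1) * \<rho> r t * u r t) * k + h * (r^(d-1) * \<rho> r t)) (snd q, fst q))) (at (r,t))"
    by (rule has_derivative_compose[where f="\<lambda>p. (snd p, fst p)"], (auto intro!: derivative_eq_intros)[1])
      (use D in simp)
  then show ?thesis by (simp add: algebra_simps)
qed

text \<open>Positivity at the single radius r gives uniqueness among all radii, so \<open>rL\<close>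
  is meaningful at \<open>m r t\<close> even if vacuum occurs elsewhere.\<close>

lemma mass_inj:
  assumes "t \<in> time_dom T" "0 < r" "0 < \<rho> r t" "0 \<le> r'" "m r' t = m r t"
  shows "r' = r"
proof (rule ccontr)
  assume "r' \<noteq> r"
  then show False using mass_strict[of t r r' r] mass_strict[of t r' r r] assms by (cases "r < r'") auto
qed

lemma rL_mass:
  assumes "t \<in> time_dom T" "0 < r" "0 < \<rho> r t"
  shows "rL d \<rho> (m r t) t = r"
  unfolding rL_def using assms mass_inj[OF assms] by (intro the_equality) auto

end

subsection \<open>Riemann variables and the maximum principle\<close>

lemma deriv_along_line:
  fixes f :: "real \<times> real \<Rightarrow> real"
  assumes "(f has_derivative (\<lambda>q. fst q * a + snd q * b)) (at (r,t))"
  shows "((\<lambda>h. f (r + h*l, t + h)) has_real_derivative b + l*a) (at 0)"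
proof -
  have "((\<lambda>h. f (r + h*l, t + h)) has_derivative (\<lambda>h. fst (h*l,h) * a + snd (h*l,h) * b)) (at 0)"
    by (rule has_derivative_compose[where f="\<lambda>h. (r + h*l, t + h)"], (auto intro!: derivative_eq_intros)[1])
      (use assms in simp)
  moreover have "(\<lambda>h. fst (h*l,h) * a + snd (h*l,h) * b) = (*) (b + l*a)"
    by (rule ext) (simp add: algebra_simps)
  ultimately show ?thesis
    by (simp only: has_field_derivative_def)
qed

lemma compact_first_time:
  fixes Z :: "(real \<times> real) set"
  assumes "compact Z" "Z \<noteq> {}"
  obtains r t where "(r,t) \<in> Z" "\<And>r' t'. (r',t') \<in> Z \<Longrightarrow> t \<le> t'"
  using continuous_attains_inf[OF assms continuous_on_snd[OF continuous_on_id]] by (metis prod.collapse snd_conv)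

context radial_euler
begin

definition "e = (\<gamma> - 1) / 2"
definition "b = n * e"
definition "kap = 2 * sqrt (K*\<gamma>) / (\<gamma>-1)"
definition z :: "real \<Rightarrow> real \<Rightarrow> real" where "z r t = kap * \<rho> r t powr e"
definition c :: "real \<Rightarrow> real \<Rightarrow> real" where "c r t = e * z r t"
text \<open>The chain rule for z, written through \<open>\<rho>r\<close> so that continuity comes
  from that of the partial derivatives; it is used as a derivative of z where \<rho> > 0.\<close>

definition zr :: "real \<Rightarrow> real \<Rightarrow> real" where "zr r t = c r t * \<rho>r r t / \<rho> r t"
definition zt :: "real \<Rightarrow> real \<Rightarrow> real" where "zt r t = c r t * \<rho>t r t / \<rho> r t"

lemma e_pos: "0 < e" and kap_pos: "0 < kap"
  using gam K by (auto simp: e_def kap_def)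

lemma z_pos: "0 < \<rho> r t \<Longrightarrow> 0 < z r t" and c_pos: "0 < \<rho> r t \<Longrightarrow> 0 < c r t"
  using e_pos kap_pos by (auto simp: z_def c_def)

lemma z_cont: "continuous_on (dom_ST T) (\<lambda>(r,t). z r t)"
  using cont_\<rho>u(1) e_pos \<rho>_nonneg unfolding z_def split_def
  by (intro continuous_intros continuous_on_powr') (auto simp: dom_ST_eq)

lemma powr_e_deriv:
  assumes "0 < x" shows "((\<lambda>x. kap * x powr e) has_real_derivative e * (kap * x powr e) / x) (at x)"
proof -
  have "((\<lambda>x. kap * x powr e) has_real_derivative kap * (e * x powr (e - 1))) (at x)"
    using assms by (auto intro!: derivative_eq_intros)
  then show ?thesis using assms by (simp add: powr_diff field_simps)
qed

lemma z_has_derivative: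
  assumes "0 < r" "0 < t" "t \<in> time_dom T" "0 < \<rho> r t"
  shows "((\<lambda>p. z (fst p) (snd p)) has_derivative (\<lambda>q. fst q * zr r t + snd q * zt r t)) (at (r,t))"
proof -
  have "((\<lambda>p. kap * \<rho> (fst p) (snd p) powr e) has_derivative
     (\<lambda>q. (e * (kap * \<rho> r t powr e) / \<rho> r t) * (fst q * \<rho>r r t + snd q * \<rho>t r t))) (at (r,t))"
    by (rule has_derivative_compose[OF \<rho>_has_derivative[OF assms(1-3)]])
      (use powr_e_deriv[OF assms(4)] in \<open>simp only: has_field_derivative_def fst_conv snd_conv\<close>)
  then show ?thesis by (simp add: z_def zr_def zt_def c_def algebra_simps add_divide_distrib)
qed

lemma z_r:
  assumes "0 < r" "t \<in> time_dom T" "0 < \<rho> r t"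
  shows "((\<lambda>r. z r t) has_real_derivative zr r t) (at r)"
proof -
  have "((\<lambda>r. \<rho> r t) has_real_derivative \<rho>r r t) (at r)"
    using \<rho>_r[of r t] at_within_pos[of r] assms by simp
  from DERIV_chain2[where f="\<lambda>x. kap * x powr e" and g="\<lambda>r. \<rho> r t", OF powr_e_deriv[OF assms(3)] this]
  show ?thesis by (simp add: z_def zr_def c_def)
qed

lemma euler_z:
  assumes "0 < r" "0 < t" "t \<in> time_dom T" "0 < \<rho> r t"
  shows "zt r t + u r t * zr r t + c r t * (ur r t + n * u r t / r) = 0"
proof -
  have "zt r t + u r t * zr r t + c r t * (ur r t + n * u r t / r)
     = c r t / \<rho> r t * (\<rho>t r t + u r t * \<rho>r r t + \<rho> r t * (ur r t + n * u r t / r))"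
    unfolding zt_def zr_def using assms(4) by (simp add: field_simps)
  then show ?thesis using euler_mass[OF assms(1-3)] by simp
qed

lemma c_squared: "0 < \<rho> r t \<Longrightarrow> (c r t)\<^sup>2 = K * \<gamma> * \<rho> r t powr (\<gamma> - 1)"
proof -
  assume "0 < \<rho> r t"
  have "c r t = sqrt (K*\<gamma>) * \<rho> r t powr e" using gam by (simp add: c_def z_def e_def kap_def)
  moreover have "(\<rho> r t powr e)\<^sup>2 = \<rho> r t powr (\<gamma> - 1)"
    by (simp add: e_def power2_eq_square powr_add[symmetric])
  ultimately show ?thesis using K gam by (simp add: power_mult_distrib)
qed

lemma euler_u:
  assumes "0 < r" "0 < t" "t \<in> time_dom T" "0 < \<rho> r t"
  shows "ut r t + u r t * ur r t + c r t * zr r t = 0"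
proof -
  have "c r t * zr r t = (c r t)\<^sup>2 * \<rho>r r t / \<rho> r t" by (simp add: zr_def power2_eq_square)
  also have "\<dots> = K * \<gamma> * (\<rho> r t powr (\<gamma> - 1) / \<rho> r t) * \<rho>r r t" using c_squared assms by simp
  also have "\<rho> r t powr (\<gamma> - 1) / \<rho> r t = \<rho> r t powr (\<gamma> - 2)"
    using powr_diff[of "\<rho> r t" "\<gamma> - 1" 1] assms by (simp add: diff_diff_eq)
  finally show ?thesis using mom_eq[OF assms] by simp
qed

text \<open>Both families at once: the u-equation plus s times the z-equation. Since s^2 = 1, the
  term c z_r is (s c)(s z_r), and the two equations combine into transport with speed u + s c. The
  spherical geometry is the only source.\<close>

lemma riemann_eq:
  assumes "0 < r" "0 < t" "t \<in> time_dom T" "0 < \<rho> r t" and s: "s * s = (1::real)"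
  shows "(ut r t + s * zt r t) + (u r t + s * c r t) * (ur r t + s * zr r t) = - s * n * c r t * u r t / r"
proof -
  have "(ut r t + s * zt r t) + (u r t + s * c r t) * (ur r t + s * zr r t)
    = (ut r t + u r t * ur r t + (s * s) * (c r t * zr r t)) + s * (zt r t + u r t * zr r t + c r t * ur r t)"
    by (simp add: algebra_simps)
  also have "zt r t + u r t * zr r t + c r t * ur r t = - c r t * n * u r t / r"
    using euler_z[OF assms(1-4)] by (simp add: algebra_simps)
  also have "ut r t + u r t * ur r t + (s * s) * (c r t * zr r t) = 0"
    using euler_u[OF assms(1-4)] s by simp
  finally show ?thesis by simp
qed

text \<open>The Lagrangian speed is a mass flux: moving with speed c relative to the fluid sweeps
  mass at the rate A \<rho> c. Hence the curve on which the mass equals \<open>xp\<close> has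
  Eulerian speed u + c. The powers of \<open>kap\<close> and A in the definitions cancel.\<close>

lemma CL_eq:
  assumes "t \<in> time_dom T" "0 < r" "0 < \<rho> r t"
  shows "CL K \<gamma> d \<rho> (m r t) t = r^(d-1) * \<rho> r t * c r t"
proof -
  define A where "A = r^(d-1)"
  have A: "0 < A" using assms by (simp add: A_def)
  have g: "\<gamma> - 1 \<noteq> 0" using gam by simp
  have "etaL K \<gamma> d \<rho> (m r t) t powr ((\<gamma>+1)/(\<gamma>-1)) = kap powr ((\<gamma>+1)/(\<gamma>-1)) * (A * \<rho> r t) powr ((\<gamma>+1)/2)"
  proof -
    have "etaL K \<gamma> d \<rho> (m r t) t = kap * (A * \<rho> r t) powr e"
      by (simp only: etaL_def AL_def rL_mass[OF assms] A_def kap_def e_def)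
    moreover have "e * ((\<gamma>+1)/(\<gamma>-1)) = (\<gamma>+1)/2" 
    proof -
      have "x / 2 * (y / x) = y / 2" if "x \<noteq> 0" for x y :: real using that by simp
      from this[OF g] show ?thesis unfolding e_def .
    qed
    moreover have "(kap * (A * \<rho> r t) powr e) powr ((\<gamma>+1)/(\<gamma>-1)) =
        kap powr ((\<gamma>+1)/(\<gamma>-1)) * (A * \<rho> r t) powr (e * ((\<gamma>+1)/(\<gamma>-1)))"
      using kap_pos by (simp only: powr_mult powr_powr less_imp_le powr_ge_zero)
    ultimately show ?thesis by (simp only:)
  qed
  note eta = this
  have "2/(\<gamma>-1) * (-(\<gamma>+1)/2) = -((\<gamma>+1)/(\<gamma>-1))" using g by (simp add: field_simps)
  then have Kc: "K_c K \<gamma> = sqrt (K*\<gamma>) * kap powr (-((\<gamma>+1)/(\<gamma>-1)))"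
    by (simp add: K_c_def K_tau_def kap_def[symmetric] powr_powr)
  have "(A * \<rho> r t) powr ((\<gamma>+1)/2) = A powr (e + 1) * \<rho> r t powr (e + 1)"
    using A assms by (simp add: powr_mult e_def add_divide_distrib diff_divide_distrib add.commute)
  then have Ar: "(A * \<rho> r t) powr ((\<gamma>+1)/2) = A powr e * A * (\<rho> r t * \<rho> r t powr e)"
    using A assms by (simp add: powr_add)
  have c: "c r t = sqrt (K*\<gamma>) * \<rho> r t powr e" using gam by (simp add: c_def z_def e_def kap_def)
  have e': "-(\<gamma>-1)/2 = -e" unfolding e_def by (simp only: minus_divide_left)
  have "CL K \<gamma> d \<rho> (m r t) t = K_c K \<gamma> * A powr (-(\<gamma>-1)/2) * etaL K \<gamma> d \<rho> (m r t) t powr ((\<gamma>+1)/(\<gamma>-1))"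
    by (simp only: CL_def AL_def rL_mass[OF assms] A_def)
  also have "\<dots> = (kap powr (-((\<gamma>+1)/(\<gamma>-1))) * kap powr ((\<gamma>+1)/(\<gamma>-1))) * (A powr (-e) * A powr e) * (A * \<rho> r t * c r t)"
    unfolding eta Kc Ar c e' by (simp only: mult_ac)
  also have "kap powr (-((\<gamma>+1)/(\<gamma>-1))) * kap powr ((\<gamma>+1)/(\<gamma>-1)) = 1"
    using kap_pos by (simp only: powr_add[symmetric]) simp
  also have "A powr (-e) * A powr e = 1" using A by (simp add: powr_add[symmetric])
  finally show ?thesis by (simp add: A_def)
qed

text \<open>This holds at every x, also where \<open>rL\<close> has no meaningful value, so
  \<open>xp\<close> is monotone before anything is known about the density.\<close>

lemma CL_nonneg: "0 \<le> CL K \<gamma> d \<rho> x t"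
  using K gam by (simp add: CL_def K_c_def)

end

locale radial_euler_char = radial_euler +
  fixes xbar rbar C0 :: real and xp :: "real \<Rightarrow> real"
  assumes gam53: "5/3 < \<gamma>" and gam3: "\<gamma> < 3" and T0: "0 < T"
    and rbar: "0 < rbar" and xbar: "m rbar 0 = xbar"
    and xp0: "xp 0 = xbar"
    and xp_deriv: "\<And>t. t \<in> time_dom T \<Longrightarrow> (xp has_real_derivative CL K \<gamma> d \<rho> (xp t) t) (at t within time_dom T)"
    and ini_pos: "\<And>r. 0 < r \<Longrightarrow> 0 < \<rho> r 0"
    and ini_super: "\<And>r. 0 < r \<Longrightarrow> z r 0 \<le> u r 0"
    and ini_bound: "\<And>r. 0 < r \<Longrightarrow> u r 0 \<le> C0"
begin

lemma zero_time: "0 \<in> time_dom T" using T0 by (simp add: time_dom_def zero_ereal_def[symmetric])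

lemma e_less1: "e < 1" using gam3 by (simp add: e_def)

lemma xbar_pos: "0 < xbar"
  using mass_strict[OF zero_time, of 0 rbar rbar] rbar ini_pos[of rbar] xbar by simp

lemma xp_cont: "continuous_on (time_dom T) xp"
  by (rule DERIV_continuous_on) (rule xp_deriv)

lemma xp_mono:
  assumes "0 \<le> s" "s \<le> t" "t \<in> time_dom T"
  shows "xp s \<le> xp t"
proof (cases "s = t")
  case False
  have "\<exists>x\<in>{s<..<t}. xp t - xp s = CL K \<gamma> d \<rho> (xp x) x * (t - s)"
  proof (rule mvt_simple)
    fix x assume "s \<le> x" "x \<le> t"
    then have "(xp has_real_derivative CL K \<gamma> d \<rho> (xp x) x) (at x within {s..t})"
      using assms time_dom_le[OF assms(3)] by (intro DERIV_subset[OF xp_deriv] subsetI) auto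
    then show "(xp has_derivative (*) (CL K \<gamma> d \<rho> (xp x) x)) (at x within {s..t})"
      by (simp add: has_field_derivative_def)
  qed (use assms False in simp)
  then obtain x where "xp t - xp s = CL K \<gamma> d \<rho> (xp x) x * (t - s)" by blast
  also have "\<dots> \<ge> 0" using CL_nonneg assms by (intro mult_nonneg_nonneg) auto
  finally show ?thesis by simp
qed simp

section \<open>The region bounded by the forward characteristic, and first contacts in it\<close>

definition reg :: "(real \<times> real) set" where
  "reg = {(r,t). 0 \<le> r \<and> t \<in> time_dom T \<and> xp t \<le> m r t}"

lemma regD:
  assumes "(r,t) \<in> reg" shows "0 < r" "t \<in> time_dom T" "xp t \<le> m r t" "0 \<le> t"
proof -
  show "t \<in> time_dom T" "xp t \<le> m r t" using assms by (auto simp: reg_def)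
  then show "0 \<le> t" by (simp add: time_dom_def)
  then have "xbar \<le> xp t" using xp_mono[of 0 t] xp0 \<open>t \<in> time_dom T\<close> by simp
  then have "r \<noteq> 0" using xbar_pos \<open>xp t \<le> m r t\<close> by auto
  then show "0 < r" using assms by (auto simp: reg_def)
qed

lemma xbar_le_mass:
  assumes "(r,t) \<in> reg" shows "xbar \<le> m r t"
  using regD[OF assms] xp_mono[of 0 t] xp0 by simp

lemma reg_up:
  assumes "(r,t) \<in> reg" "r \<le> r'" shows "(r',t) \<in> reg"
  using mass_mono[of t r r'] regD[OF assms(1)] assms(2) by (simp add: reg_def)

text \<open>The region is where the excess m - xp is nonnegative; the sign of this rate decides on
  which side of the boundary a segment of speed l runs.\<close>

lemma excess_deriv:
  assumes "0 < r" "0 < t" "t \<in> time_dom T"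
  shows "((\<lambda>h. m (r + h*l) (t + h) - xp (t + h)) has_real_derivative
      (l - u r t) * (r^(d-1) * \<rho> r t) - CL K \<gamma> d \<rho> (xp t) t) (at 0)"
proof -
  have D1: "((\<lambda>h. m (r + h*l) (t+h)) has_real_derivative
      - (r^(d-1) * \<rho> r t * u r t) + l * (r^(d-1) * \<rho> r t)) (at 0)"
    using deriv_along_line[where f="\<lambda>p. m (fst p) (snd p)" and a="r^(d-1) * \<rho> r t"
        and b="- (r^(d-1) * \<rho> r t * u r t)" and r=r and t=t and l=l] mass_has_derivative[OF assms(2,3,1)]
    by (simp only: fst_conv snd_conv diff_conv_add_uminus minus_mult_right)
  have "(xp has_real_derivative CL K \<gamma> d \<rho> (xp t) t) (at (0 + t))"
    using xp_deriv[OF assms(3)] at_within_time[OF assms(2,3)] by simp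
  then have D2: "((\<lambda>h. xp (t + h)) has_real_derivative CL K \<gamma> d \<rho> (xp t) t) (at 0)"
    by (simp only: DERIV_shift add.commute[of t])
  show ?thesis by (rule DERIV_cong[OF DERIV_diff[OF D1 D2]]) (simp add: algebra_simps)
qed

lemma reg_back:
  assumes reg: "(r,t) \<in> reg" and t: "0 < t" and pos: "0 < \<rho> r t" and l: "l < u r t + c r t"
  obtains \<delta> where "0 < \<delta>" "\<And>h. 0 < h \<Longrightarrow> h < \<delta> \<Longrightarrow> (r - h * l, t - h) \<in> reg"
proof -
  note r = regD[OF reg]
  define G where "G h = m (r + h*l) (t + h) - xp (t + h)" for h
  have G': "(G has_real_derivative (l - u r t) * (r^(d-1) * \<rho> r t) - CL K \<gamma> d \<rho> (xp t) t) (at 0)"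
    unfolding G_def by (rule excess_deriv[OF r(1) t r(2)])
  have "\<exists>\<delta>>0. \<forall>h. 0 < h \<and> h < \<delta> \<longrightarrow> 0 \<le> G (-h)"
  \<comment> \<open>Interior points stay inside by continuity. On the boundary \<open>CL\<close> can
    be evaluated, and l < u + c makes the excess, which is 0 now, positive just before.\<close>
  proof (cases "xp t < m r t")
    case True
    have "G \<midarrow>0\<rightarrow> G 0" using G' DERIV_isCont isCont_def by blast
    moreover have "0 < G 0" using True by (simp add: G_def)
    ultimately have "eventually (\<lambda>h. 0 < G h) (at 0)" by (rule order_tendstoD)
    then obtain \<delta> where \<delta>: "\<delta> > 0" "\<And>h. h \<noteq> 0 \<Longrightarrow> dist h 0 < \<delta> \<Longrightarrow> 0 < G h"
      unfolding eventually_at by blast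
    show ?thesis
    proof (intro exI[of _ \<delta>] conjI allI impI)
      fix h assume "0 < h \<and> h < \<delta>"
      then show "0 \<le> G (-h)" using \<delta>(2)[of "-h"] by simp
    qed (rule \<delta>)
  next
    case False
    then have eq: "xp t = m r t" using r by simp
    have "0 < (u r t + c r t - l) * (r^(d-1) * \<rho> r t)" using l r(1) pos by simp
    moreover have "(l - u r t) * (r^(d-1) * \<rho> r t) - CL K \<gamma> d \<rho> (xp t) t = - ((u r t + c r t - l) * (r^(d-1) * \<rho> r t))"
      unfolding eq CL_eq[OF r(2,1) pos] by (simp add: algebra_simps)
    ultimately have neg: "(l - u r t) * (r^(d-1) * \<rho> r t) - CL K \<gamma> d \<rho> (xp t) t < 0" by linarith
    obtain \<delta> where \<delta>: "\<delta> > 0" "\<forall>h>0. h < \<delta> \<longrightarrow> G 0 < G (0 - h)"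
      using DERIV_neg_dec_left[OF G' neg] by (elim exE conjE)
    have "G 0 = 0" by (simp add: G_def eq)
    show ?thesis
    proof (intro exI[of _ \<delta>] conjI allI impI)
      fix h assume "0 < h \<and> h < \<delta>"
      then show "0 \<le> G (-h)" using \<delta>(2)[rule_format, of h] \<open>G 0 = 0\<close> by simp
    qed (rule \<delta>)
  qed
  then obtain \<delta> where \<delta>: "\<delta> > 0" "\<And>h. 0 < h \<Longrightarrow> h < \<delta> \<Longrightarrow> 0 \<le> G (-h)" by blast
  \<comment> \<open>The two further bounds keep the time and the radius nonnegative along the
    segment; adding 1 to |l| avoids a zero denominator.\<close>
  define \<delta>' where "\<delta>' = min \<delta> (min t (r / (\<bar>l\<bar> + 1)))"
  have "0 < \<delta>'" using \<delta> t r by (simp add: \<delta>'_def)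
  moreover have "(r - h * l, t - h) \<in> reg" if h: "0 < h" "h < \<delta>'" for h
  proof -
    have "h * (\<bar>l\<bar> + 1) < r" using h by (simp add: \<delta>'_def pos_less_divide_eq)
    moreover have "h * l \<le> h * (\<bar>l\<bar> + 1)" using h by (intro mult_left_mono) auto
    ultimately have "0 \<le> r - h * l" by simp
    moreover have "t - h \<in> time_dom T" using h r by (intro time_dom_le[OF r(2)]) (auto simp: \<delta>'_def)
    ultimately show ?thesis using \<delta>(2)[of h] h by (simp add: reg_def G_def \<delta>'_def)
  qed
  ultimately show ?thesis by (rule that)
qed

text \<open>The maximum principle. The characteristic speeds are at most $u+c$, the speed of the left
  boundary, so straight segments traced backwards in time with a smaller speed stay in the region
  and, if that speed is positive, to the left of any vertical line; speed $u+c$ is a limit case.\<close>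
lemma first_touch:
  fixes f :: "real \<times> real \<Rightarrow> real"
  assumes reg: "(r,t) \<in> reg" and t: "0 < t" and pos: "0 < \<rho> r t"
    and f: "(f has_derivative (\<lambda>q. fst q * fr + snd q * ft)) (at (r,t))"
    and f0: "0 \<le> f (r,t)"
    and before: "\<And>r' t'. (r',t') \<in> reg \<Longrightarrow> r' \<le> r \<Longrightarrow> t' < t \<Longrightarrow> f (r',t') < 0"
    and l: "0 < l" "l \<le> u r t + c r t"
  shows "0 \<le> ft + l * fr"
proof (rule ccontr)
  assume neg: "\<not> ?thesis"
  \<comment> \<open>The rate is affine in the speed, so it stays negative for a slightly smaller
    one, to which the strict hypothesis of \<open>reg_back\<close> applies.\<close>
  obtain l' where l': "0 < l'" "l' < l" "ft + l' * fr < 0"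
  proof -
    have "((\<lambda>l'. ft + l' * fr) \<longlongrightarrow> ft + l * fr) (at_left l)" by (intro tendsto_intros)
    then have "eventually (\<lambda>l'. ft + l' * fr < 0) (at_left l)" using neg by (intro order_tendstoD) auto
    moreover have "eventually (\<lambda>l'. 0 < l' \<and> l' < l) (at_left l)"
      using l eventually_at_left_real[of 0 l] by (auto elim: eventually_mono)
    ultimately have "eventually (\<lambda>l'. (ft + l' * fr < 0) \<and> 0 < l' \<and> l' < l) (at_left l)"
      by (rule eventually_conj)
    then have "\<exists>l'. (ft + l' * fr < 0) \<and> 0 < l' \<and> l' < l"
      by (rule eventually_happens'[OF trivial_limit_at_left_real])
    then show ?thesis using that by auto
  qed
  have "l' < u r t + c r t" using l l' by simp
  from reg_back[OF reg t pos this]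
  obtain \<delta> where \<delta>: "0 < \<delta>" "\<And>h. 0 < h \<Longrightarrow> h < \<delta> \<Longrightarrow> (r - h * l', t - h) \<in> reg"
    by metis
  obtain \<delta>2 where \<delta>2: "0 < \<delta>2" "\<forall>h>0. h < \<delta>2 \<longrightarrow> f (r + 0 * l', t + 0) < f (r + (0 - h) * l', t + (0 - h))"
    using DERIV_neg_dec_left[OF deriv_along_line[OF f] l'(3)] by (elim exE conjE)
  define h where "h = min \<delta> \<delta>2 / 2"
  have h: "0 < h" "h < \<delta>" "h < \<delta>2" using \<delta> \<delta>2 by (auto simp: h_def)
  have "f (r - h * l', t - h) < 0" using \<delta>(2)[OF h(1,2)] h l' by (intro before) auto
  then show False using \<delta>2(2)[rule_format, OF h(1,3)] f0 by simp
qed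

text \<open>At a first contact of one barrier, this supplies the non-strict bound for the other
  barrier at the same point. The limit is taken along the particle direction, whose speed u is
  positive and below u + c.\<close>

lemma before_limit:
  fixes f :: "real \<times> real \<Rightarrow> real"
  assumes reg: "(r,t) \<in> reg" and t: "0 < t" and pos: "0 < \<rho> r t" and u: "0 < u r t"
    and f: "isCont f (r,t)"
    and before: "\<And>r' t'. (r',t') \<in> reg \<Longrightarrow> r' \<le> r \<Longrightarrow> t' < t \<Longrightarrow> f (r',t') < 0"
  shows "f (r,t) \<le> 0"
proof -
  obtain \<delta> where \<delta>: "0 < \<delta>" "\<And>h. 0 < h \<Longrightarrow> h < \<delta> \<Longrightarrow> (r - h * u r t, t - h) \<in> reg"
    by (rule reg_back[OF reg t pos, of "u r t"]) (use c_pos[OF pos] in auto)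
  have "((\<lambda>h. (r - h * u r t, t - h)) \<longlongrightarrow> (r - 0 * u r t, t - 0)) (at_right 0)"
    by (intro tendsto_intros)
  then have lim: "((\<lambda>h. f (r - h * u r t, t - h)) \<longlongrightarrow> f (r,t)) (at_right 0)"
    using isCont_tendsto_compose[OF f] by simp
  have "f (r - h * u r t, t - h) \<le> 0" if "0 < h" "h < \<delta>" for h
    using before[OF \<delta>(2)[OF that]] that u by (simp add: less_imp_le)
  then have "eventually (\<lambda>h. f (r - h * u r t, t - h) \<le> 0) (at_right 0)"
    unfolding eventually_at_right_field using \<delta>(1) by blast
  then show ?thesis by (rule tendsto_upperbound[OF lim]) simp
qed

end

subsection \<open>The supersonic invariant region\<close>

lemma left_limit_ge:
  fixes H :: "real \<Rightarrow> real"
  assumes "continuous_on {a..b} H" "a < b" "\<And>s. a < s \<Longrightarrow> s < b \<Longrightarrow> 0 \<le> H s"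
  shows "0 \<le> H b"
proof -
  have "(H \<longlongrightarrow> H b) (at_left b)" by (rule continuous_on_Icc_at_leftD[OF assms(1,2)])
  moreover have "eventually (\<lambda>s. 0 \<le> H s) (at_left b)"
    unfolding eventually_at_left_field using assms(2,3) by blast
  ultimately show ?thesis by (rule tendsto_lowerbound) simp
qed

lemma right_limit_ge:
  fixes H :: "real \<Rightarrow> real"
  assumes "continuous_on {a..b} H" "a < b" "\<And>s. a < s \<Longrightarrow> s < b \<Longrightarrow> 0 \<le> H s"
  shows "0 \<le> H a"
proof -
  have "(H \<longlongrightarrow> H a) (at_right a)" by (rule continuous_on_Icc_at_rightD[OF assms(1,2)])
  moreover have "eventually (\<lambda>s. 0 \<le> H s) (at_right a)"
    unfolding eventually_at_right_field using assms(2,3) by blast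
  ultimately show ?thesis by (rule tendsto_lowerbound) simp
qed

lemma compact_Collect_le:
  fixes f g :: "'a::t2_space \<Rightarrow> real"
  assumes "compact S" "continuous_on S f" "continuous_on S g"
  shows "compact {p\<in>S. f p \<le> g p}"
proof -
  have "compact (S \<inter> {p\<in>S. f p \<le> g p})"
    by (intro compact_Int_closed continuous_on_closed_Collect_le compact_imp_closed assms)
  moreover have "S \<inter> {p\<in>S. f p \<le> g p} = {p\<in>S. f p \<le> g p}" by blast
  ultimately show ?thesis by simp
qed

context radial_euler_char
begin

definition box :: "real \<Rightarrow> real \<Rightarrow> (real \<times> real) set" where
  "box R t1 = {0..R} \<times> {0..t1}"

lemma compact_box: "compact (box R t1)"
  by (simp add: box_def compact_Times)

lemma box_cont:
  assumes "continuous_on (dom_ST T) (\<lambda>(r,t). F r t)" "t1 \<in> time_dom T"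
  shows "continuous_on (box R t1) (\<lambda>p. F (fst p) (snd p))"
  by (rule cont_on_comp[OF assms(1)]) (use time_dom_le[OF assms(2)] in \<open>auto simp: box_def intro!: continuous_intros\<close>)

lemma box_cont_xp: "t1 \<in> time_dom T \<Longrightarrow> continuous_on (box R t1) (\<lambda>p. xp (snd p))"
  by (rule continuous_on_compose2[OF xp_cont]) (auto simp: box_def intro!: continuous_intros elim: time_dom_le)

lemma box_bounded:
  assumes "continuous_on (dom_ST T) (\<lambda>(r,t). F r t)" "t1 \<in> time_dom T"
  obtains B :: real where "0 < B" "\<And>r t. 0 \<le> r \<Longrightarrow> r \<le> R \<Longrightarrow> 0 \<le> t \<Longrightarrow> t \<le> t1 \<Longrightarrow> \<bar>F r t\<bar> \<le> B"
proof -
  have "bounded ((\<lambda>p. F (fst p) (snd p)) ` box R t1)"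
    by (intro compact_imp_bounded compact_continuous_image box_cont assms compact_box)
  then obtain B where B: "0 < B" "\<And>p. p \<in> box R t1 \<Longrightarrow> norm (F (fst p) (snd p)) \<le> B"
    unfolding bounded_pos by blast
  show ?thesis by (rule that[OF B(1)]) (use B(2) in \<open>force simp: box_def\<close>)
qed

lemma reg_compact:
  assumes "t1 \<in> time_dom T"
  shows "compact (reg \<inter> box R t1)"
proof -
  have "reg \<inter> box R t1 = {p\<in>box R t1. xp (snd p) \<le> m (fst p) (snd p)}"
    using time_dom_le[OF assms] by (auto simp: reg_def box_def)
  then show ?thesis
    using compact_Collect_le[OF compact_box box_cont_xp[OF assms] box_cont[OF mass_cont assms]] by simp
qed

text \<open>Points of the region enclose mass at least xbar > 0, and bounded density cannot hold
  that in a tiny ball. This crude bound controls 1/r before the sign of u is known; the sharp bound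
  rbar needs that sign.\<close>

lemma reg_r_lower:
  assumes t1: "t1 \<in> time_dom T" and R: "0 < R"
  obtains rin where "0 < rin" "\<And>r t. (r,t) \<in> reg \<Longrightarrow> r \<le> R \<Longrightarrow> t \<le> t1 \<Longrightarrow> rin \<le> r"
proof -
  obtain B where B: "0 < B" "\<And>r t. 0 \<le> r \<Longrightarrow> r \<le> R \<Longrightarrow> 0 \<le> t \<Longrightarrow> t \<le> t1 \<Longrightarrow> \<bar>\<rho> r t\<bar> \<le> B"
    using box_bounded[OF cont_\<rho>u(1) t1] by metis
  have pos: "0 < R^(d-1) * B" using R B by simp
  have "xbar / (R^(d-1) * B) \<le> r" if reg: "(r,t) \<in> reg" and r: "r \<le> R" "t \<le> t1" for r t
  proof -
    note rr = regD[OF reg]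
    have "m r t = integral {0..r} (\<lambda>s. s^(d-1) * \<rho> s t)" by (simp add: mass_def)
    also have "\<dots> \<le> integral {0..r} (\<lambda>s. R^(d-1) * B)"
    proof (rule integral_le)
      show "(\<lambda>s. s^(d-1) * \<rho> s t) integrable_on {0..r}"
        by (rule integrable_continuous_real[OF dens_cont[OF rr(2)]])
      fix s assume s: "s \<in> {0..r}"
      then show "s^(d-1) * \<rho> s t \<le> R^(d-1) * B"
        using B(2)[of s t] \<rho>_nonneg[of s t] rr r by (intro mult_mono power_mono) auto
    qed auto
    also have "\<dots> = r * (R^(d-1) * B)" using rr by simp
    finally have "xbar \<le> r * (R^(d-1) * B)" using xbar_le_mass[OF reg] by simp
    then show ?thesis using pos by (simp add: pos_divide_le_eq)
  qed
  then show ?thesis using that[of "xbar / (R^(d-1) * B)"] pos xbar_pos by simp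
qed

lemma reg_at_0: "(r,0) \<in> reg \<longleftrightarrow> rbar \<le> r"
proof
  assume reg: "(r,0) \<in> reg"
  show "rbar \<le> r"
  proof (rule ccontr)
    assume "\<not> rbar \<le> r"
    then have "m r 0 < m rbar 0"
      using regD[OF reg] ini_pos rbar by (intro mass_strict[OF zero_time, where c=rbar]) auto
    then show False using regD[OF reg] xbar xp0 by simp
  qed
next
  assume "rbar \<le> r"
  then show "(r,0) \<in> reg" using mass_mono[OF zero_time, of rbar r] rbar xbar xp0 zero_time by (simp add: reg_def)
qed

lemma C0_pos: "0 < C0"
  using ini_super[OF rbar] ini_bound[OF rbar] z_pos[OF ini_pos[OF rbar]] by simp


text \<open>Four strict inequalities are propagated together because each contact argument uses the
  others: \<rho> > 0 makes z differentiable and identifies the boundary speed, u - z > -\<epsilon>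
  makes u - c positive, u + z < W lets the radius \<open>ro\<close> outrun the characteristic, and
  \<open>ro\<close> keeps the characteristic inside the box. The slack \<epsilon> is there because
  initially only z \<le> u is given.\<close>

lemma invariant_region:
  assumes t1: "t1 \<in> time_dom T" and R: "rbar + 1 + (2*C0+1) * t1 < R"
  obtains \<epsilon>0 where "0 < \<epsilon>0"
    "\<And>\<epsilon> r t. 0 < \<epsilon> \<Longrightarrow> \<epsilon> < \<epsilon>0 \<Longrightarrow> (r,t) \<in> reg \<Longrightarrow> r \<le> R \<Longrightarrow> t \<le> t1 \<Longrightarrow> 0 < \<rho> r t \<and> -\<epsilon> < u r t - z r t"
proof -
  \<comment> \<open>Initially u + z \<le> 2u \<le> 2 C0; the added 1 makes the bound strict. W also
    serves as the speed of \<open>ro\<close>.\<close>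
  define W where "W = 2*C0 + 1"
  define ro where "ro t = rbar + 1 + W * t" for t
  have W: "0 < W" using C0_pos by (simp add: W_def)
  have t10: "0 \<le> t1" using t1 by (simp add: time_dom_def)
  have ro: "rbar < ro t" "ro t < R" if "0 \<le> t" "t \<le> t1" for t
  proof -
    have "W * t \<le> W * t1" "0 \<le> W * t" using that W by (auto intro: mult_left_mono)
    then show "rbar < ro t" "ro t < R" using R by (auto simp: ro_def W_def)
  qed
  have R0: "rbar < R" using ro[of 0] t10 by simp
  obtain U1 where U1: "0 < U1" "\<And>r t. 0 \<le> r \<Longrightarrow> r \<le> R \<Longrightarrow> 0 \<le> t \<Longrightarrow> t \<le> t1 \<Longrightarrow> \<bar>u r t\<bar> \<le> U1"
    using box_bounded[OF cont_\<rho>u(2) t1] by metis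
  obtain U2 where U2: "0 < U2" "\<And>r t. 0 \<le> r \<Longrightarrow> r \<le> R \<Longrightarrow> 0 \<le> t \<Longrightarrow> t \<le> t1 \<Longrightarrow> \<bar>ur r t\<bar> \<le> U2"
    using box_bounded[OF cont_partials(3) t1] by metis
  obtain rin where rin: "0 < rin" "\<And>r t. (r,t) \<in> reg \<Longrightarrow> r \<le> R \<Longrightarrow> t \<le> t1 \<Longrightarrow> rin \<le> r"
    using reg_r_lower[OF t1, of R] R0 rbar by (metis less_trans)
  \<comment> \<open>The density decays along particle paths at the rate u_r + n u/r. L exceeds this
    on the box by at least 1, so an exponential barrier with rate L cannot be touched.\<close>
  define L where "L = U2 + n * U1 / rin + 1"
  have "\<exists>x\<in>{rbar..R}. \<forall>y\<in>{rbar..R}. \<rho> x 0 \<le> \<rho> y 0"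
    using R0 rbar zero_time by (intro continuous_attains_inf cont_on_comp[OF cont_\<rho>u(1)] continuous_intros) auto
  then obtain x where x: "x \<in> {rbar..R}" "\<And>y. y \<in> {rbar..R} \<Longrightarrow> \<rho> x 0 \<le> \<rho> y 0" by blast
  \<comment> \<open>Half the minimum of the initial density on [rbar, R], so that the barrier starts
    strictly below the density.\<close>
  define m0 where "m0 = \<rho> x 0 / 2"
  have m0: "0 < m0" "\<And>y. y \<in> {rbar..R} \<Longrightarrow> m0 < \<rho> y 0"
  proof -
    show pos: "0 < m0" using ini_pos[of x] x rbar by (simp add: m0_def)
    show "m0 < \<rho> y 0" if "y \<in> {rbar..R}" for y using x(2)[OF that] pos by (simp add: m0_def)
  qed
  define m1 where "m1 = m0 * exp (- L * t1)"
  have m1: "0 < m1" using m0 by (simp add: m1_def)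
  have L: "0 < L" using U1 U2 rin n_pos by (simp add: L_def add_pos_nonneg)
  have m1_le: "m1 \<le> m0 * exp (- L * t)" if "t \<le> t1" for t
    using m0 L that by (simp add: m1_def)
  \<comment> \<open>Since u - c = (u - z) + (1 - e) z, a slack below (1 - e) z keeps u - c positive;
    m1 is the smallest value of the density barrier up to t1.\<close>
  define \<epsilon>0 where "\<epsilon>0 = (1 - e) * (kap * m1 powr e)"
  have \<epsilon>0: "0 < \<epsilon>0" using e_less1 kap_pos m1 by (simp add: \<epsilon>0_def)
  have \<epsilon>0_le: "\<epsilon>0 \<le> (1 - e) * z r t" if "m1 \<le> \<rho> r t" for r t
    using that m1 e_less1 kap_pos e_pos unfolding \<epsilon>0_def z_def by (intro mult_left_mono powr_mono2) auto
  have "0 < \<rho> r t \<and> -\<epsilon> < u r t - z r t"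
    if \<epsilon>: "0 < \<epsilon>" "\<epsilon> < \<epsilon>0" and reg: "(r,t) \<in> reg" "r \<le> R" "t \<le> t1" for \<epsilon> r t
  proof -
    \<comment> \<open>\<open>Q\<close> holds strictly before the first failure; \<open>Qc\<close> is
      its closure, which passes to the time of failure by limits.\<close>
    define Q where "Q r t \<longleftrightarrow> m0 * exp (- L * t) < \<rho> r t \<and> -\<epsilon> < u r t - z r t \<and> u r t + z r t < W" for r t
    define Qc where "Qc r t \<longleftrightarrow> m0 * exp (- L * t) \<le> \<rho> r t \<and> -\<epsilon> \<le> u r t - z r t \<and> u r t + z r t \<le> W" for r t
    define G where "G = reg \<inter> box R t1"
    \<comment> \<open>The first set says that the characteristic has caught up with
      \<open>ro\<close>; its condition involves the time only. The other three are the failures of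
      the parts of \<open>Q\<close> in the region.\<close>
    define Bad where "Bad = {p\<in>box R t1. m (ro (snd p)) (snd p) \<le> xp (snd p)}
      \<union> ({p\<in>G. \<rho> (fst p) (snd p) \<le> m0 * exp (- L * snd p)}
      \<union> ({p\<in>G. u (fst p) (snd p) - z (fst p) (snd p) \<le> -\<epsilon>}
      \<union> {p\<in>G. W \<le> u (fst p) (snd p) + z (fst p) (snd p)}))"
    have Gsub: "G \<subseteq> box R t1" by (simp add: G_def)
    have compG: "compact G" unfolding G_def by (rule reg_compact[OF t1])
    note contG = box_cont[OF _ t1, THEN continuous_on_subset, OF _ Gsub]
    have "compact Bad" unfolding Bad_def
    proof (intro compact_Un)
      have "continuous_on (box R t1) (\<lambda>p. m (ro (snd p)) (snd p))"
        unfolding ro_def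
      proof (rule cont_on_comp[OF mass_cont])
        fix p assume "p \<in> box R t1"
        then show "0 \<le> rbar + 1 + W * snd p \<and> snd p \<in> time_dom T"
          using rbar W time_dom_le[OF t1, of "snd p"] by (auto simp: box_def)
      qed (intro continuous_intros)+
      then show "compact {p\<in>box R t1. m (ro (snd p)) (snd p) \<le> xp (snd p)}"
        by (intro compact_Collect_le compact_box box_cont_xp t1)
    qed (intro compact_Collect_le compG continuous_intros contG[OF cont_\<rho>u(1)] contG[OF cont_\<rho>u(2)] contG[OF z_cont])+
    have "Bad = {}"
    proof (rule ccontr)
      assume "Bad \<noteq> {}"
      from compact_first_time[OF \<open>compact Bad\<close> this]
      obtain rs ts where bad: "(rs,ts) \<in> Bad" and first: "\<And>r' t'. (r',t') \<in> Bad \<Longrightarrow> ts \<le> t'" by metis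
      have rs: "0 \<le> rs" "rs \<le> R" "0 \<le> ts" "ts \<le> t1" using bad by (auto simp: Bad_def box_def G_def)
      note ts_dom = time_dom_le[OF t1 rs(3,4)]
      \<comment> \<open>Radius 0 is a convenient witness, as the condition on \<open>ro\<close> does
        not depend on the radius.\<close>
      have before_ro: "xp t < m (ro t) t" if "0 \<le> t" "t < ts" for t
        using first[of 0 t] that rs rbar R0 by (force simp: Bad_def box_def)
      have before_Q: "Q r t" if "(r,t) \<in> reg" "r \<le> R" "t < ts" for r t
      proof -
        have "(r,t) \<in> G" using that regD[OF that(1)] rs by (auto simp: G_def box_def)
        moreover have "(r,t) \<notin> Bad" using first[of r t] that(3) by auto
        ultimately show ?thesis by (simp add: Q_def Bad_def not_le)
      qed
      have ts_pos: "0 < ts"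
      proof (rule ccontr)
        assume "\<not> 0 < ts"
        then have ts0: "ts = 0" using rs by simp
        have "m rbar 0 < m (ro 0) 0"
          using rbar ini_pos ro(1)[of 0] t10 by (intro mass_strict[OF zero_time, where c=rbar]) auto
        then have "(rs,0) \<in> G" and or: "\<rho> rs 0 \<le> m0 \<or> u rs 0 - z rs 0 \<le> -\<epsilon> \<or> W \<le> u rs 0 + z rs 0"
          using bad xbar xp0 by (auto simp: Bad_def ts0)
        then have rr: "rbar \<le> rs" using reg_at_0 by (auto simp: G_def)
        have "m0 < \<rho> rs 0" using m0(2)[of rs] rr rs by simp
        moreover have "0 \<le> u rs 0 - z rs 0" using ini_super[of rs] rr rbar by simp
        moreover have "u rs 0 + z rs 0 \<le> 2 * C0" using ini_super[of rs] ini_bound[of rs] rr rbar by simp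
        ultimately show False using or \<epsilon> by (auto simp: W_def)
      qed
      have cont_t: "continuous_on {0..ts} (\<lambda>s. F r s)"
        if "continuous_on (dom_ST T) (\<lambda>(r,t). F r t)" "0 \<le> r" for F :: "real \<Rightarrow> real \<Rightarrow> real" and r
        using that(2) time_dom_le[OF ts_dom] by (intro cont_on_comp[OF that(1)] continuous_intros) auto
      have cont_r: "continuous_on {a..R} (\<lambda>r. F r ts)"
        if "continuous_on (dom_ST T) (\<lambda>(r,t). F r t)" "0 \<le> a" for F :: "real \<Rightarrow> real \<Rightarrow> real" and a
        using that(2) ts_dom by (intro cont_on_comp[OF that(1)] continuous_intros) auto
      have Qc_left: "Qc r ts" if r: "0 \<le> r" and a: "0 \<le> a" "a < ts" and Q: "\<And>s. a < s \<Longrightarrow> s < ts \<Longrightarrow> Q r s" for r a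
      proof -
        note ct = cont_t[OF _ r, THEN continuous_on_subset, of _ "{a..ts}"]
        have sub: "{a..ts} \<subseteq> {0..ts}" using a by auto
        have "0 \<le> \<rho> r ts - m0 * exp (- L * ts)"
          by (rule left_limit_ge[OF _ a(2), where H="\<lambda>s. \<rho> r s - m0 * exp (- L * s)"])
            (use Q in \<open>auto simp: Q_def less_imp_le intro!: continuous_intros ct[OF cont_\<rho>u(1) sub]\<close>)
        moreover have "0 \<le> u r ts - z r ts + \<epsilon>"
          by (rule left_limit_ge[OF _ a(2), where H="\<lambda>s. u r s - z r s + \<epsilon>"])
            (use Q in \<open>force simp: Q_def intro!: continuous_intros ct[OF cont_\<rho>u(2) sub] ct[OF z_cont sub]\<close>)+
        moreover have "0 \<le> W - (u r ts + z r ts)"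
          by (rule left_limit_ge[OF _ a(2), where H="\<lambda>s. W - (u r s + z r s)"])
            (use Q in \<open>auto simp: Q_def less_imp_le intro!: continuous_intros ct[OF cont_\<rho>u(2) sub] ct[OF z_cont sub]\<close>)
        ultimately show ?thesis by (simp add: Qc_def)
      qed
      have Qc_right: "Qc r ts" if r: "0 \<le> r" "r < R" and Q: "\<And>x. r < x \<Longrightarrow> x < R \<Longrightarrow> Qc x ts" for r
      proof -
        note ct = cont_r[OF _ r(1)]
        have "0 \<le> \<rho> r ts - m0 * exp (- L * ts)"
          by (rule right_limit_ge[OF _ r(2), where H="\<lambda>x. \<rho> x ts - m0 * exp (- L * ts)"])
            (use Q in \<open>auto simp: Qc_def intro!: continuous_intros ct[OF cont_\<rho>u(1)]\<close>)
        moreover have "0 \<le> u r ts - z r ts + \<epsilon>"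
          by (rule right_limit_ge[OF _ r(2), where H="\<lambda>x. u x ts - z x ts + \<epsilon>"])
            (use Q in \<open>force simp: Qc_def intro!: continuous_intros ct[OF cont_\<rho>u(2)] ct[OF z_cont]\<close>)+
        moreover have "0 \<le> W - (u r ts + z r ts)"
          by (rule right_limit_ge[OF _ r(2), where H="\<lambda>x. W - (u x ts + z x ts)"])
            (use Q in \<open>auto simp: Qc_def intro!: continuous_intros ct[OF cont_\<rho>u(2)] ct[OF z_cont]\<close>)
        ultimately show ?thesis by (simp add: Qc_def)
      qed
      \<comment> \<open>A point strictly inside at time ts was inside at the same radius shortly
        before, where \<open>Q\<close> is known.\<close>
      have Qc_interior: "Qc r ts" if r: "0 \<le> r" "r \<le> R" and mr: "xp ts < m r ts" for r
      proof -
        have "continuous_on {0..ts} (\<lambda>s. m r s - xp s)"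
          using time_dom_le[OF ts_dom]
          by (intro continuous_intros cont_t[OF mass_cont r(1)] continuous_on_subset[OF xp_cont]) auto
        then have "((\<lambda>s. m r s - xp s) \<longlongrightarrow> m r ts - xp ts) (at_left ts)"
          by (rule continuous_on_Icc_at_leftD[OF _ ts_pos])
        then have "eventually (\<lambda>s. 0 < m r s - xp s) (at_left ts)"
          using mr by (intro order_tendstoD) auto
        then obtain b where b: "b < ts" "\<And>s. b < s \<Longrightarrow> s < ts \<Longrightarrow> 0 < m r s - xp s"
          unfolding eventually_at_left_field by blast
        show ?thesis
        proof (rule Qc_left[OF r(1), of "max 0 b"])
          fix s assume s: "max 0 b < s" "s < ts"
          then have "(r,s) \<in> reg" using b(2)[of s] r time_dom_le[OF ts_dom, of s] by (simp add: reg_def)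
          then show "Q r s" using before_Q s r by simp
        qed (use ts_pos b in auto)
      qed
      have Qc_pos: "0 < \<rho> r ts" if "Qc r ts" for r
        using that m0(1) by (simp add: Qc_def) (meson exp_gt_zero less_le_trans mult_pos_pos)
      \<comment> \<open>If the characteristic sits at \<open>ro ts\<close>, that radius was in the
        region at all earlier times, so \<open>Qc\<close> holds there and W > u + c. Then the excess
        along \<open>ro\<close> is increasing, hence negative shortly before ts, contrary to
        \<open>before_ro\<close>.\<close>
      have ro_ts: "xp ts < m (ro ts) ts"
      proof (rule ccontr)
        assume "\<not> ?thesis"
        moreover have "0 \<le> m (ro ts) ts - xp ts"
        proof (rule left_limit_ge[OF _ ts_pos, where H="\<lambda>s. m (ro s) s - xp s"])
          show "continuous_on {0..ts} (\<lambda>s. m (ro s) s - xp s)"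
          proof (intro continuous_intros)
            show "continuous_on {0..ts} (\<lambda>s. m (ro s) s)" unfolding ro_def
            proof (rule cont_on_comp[OF mass_cont])
              fix s assume "s \<in> {0..ts}"
              then show "0 \<le> rbar + 1 + W * s \<and> s \<in> time_dom T"
                using rbar W time_dom_le[OF ts_dom, of s] by auto
            qed (intro continuous_intros)+
            show "continuous_on {0..ts} xp"
              using time_dom_le[OF ts_dom] by (intro continuous_on_subset[OF xp_cont]) auto
          qed
        qed (use before_ro in \<open>auto simp: less_imp_le\<close>)
        ultimately have eq: "m (ro ts) ts = xp ts" by simp
        have ro0: "0 < ro ts" "ro ts \<le> R" using ro[OF rs(3,4)] rbar by auto
        have Qro: "Qc (ro ts) ts"
        proof (rule Qc_left[of _ 0])
          fix s assume s: "0 < s" "s < ts"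
          have sd: "s \<in> time_dom T" using time_dom_le[OF ts_dom, of s] s by simp
          have "ro s \<le> ro ts" "0 \<le> ro s" using s W rbar by (auto simp: ro_def)
          then have "m (ro s) s \<le> m (ro ts) s" by (intro mass_mono[OF sd]) auto
          then have "(ro ts, s) \<in> reg" using before_ro[of s] s ro0 sd by (simp add: reg_def)
          then show "Q (ro ts) s" using before_Q s ro0 by simp
        qed (use ro0 ts_pos in auto)
        note pos = Qc_pos[OF Qro]
        have "u (ro ts) ts + c (ro ts) ts < W"
        proof -
          have "c (ro ts) ts < z (ro ts) ts" using z_pos[OF pos] e_less1 by (simp add: c_def)
          then show ?thesis using Qro by (simp add: Qc_def)
        qed
        then have "0 < (W - u (ro ts) ts - c (ro ts) ts) * (ro ts ^ (d-1) * \<rho> (ro ts) ts)"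
          using pos ro0 by (intro mult_pos_pos) auto
        also have "\<dots> = (W - u (ro ts) ts) * (ro ts ^ (d-1) * \<rho> (ro ts) ts) - CL K \<gamma> d \<rho> (xp ts) ts"
          unfolding eq[symmetric] CL_eq[OF ts_dom ro0(1) pos] by (simp add: algebra_simps)
        finally have dpos: "0 < \<dots>" .
        obtain \<delta> where \<delta>: "0 < \<delta>" "\<forall>h>0. h < \<delta> \<longrightarrow> m (ro ts + (0-h)*W) (ts + (0-h)) - xp (ts + (0-h)) < m (ro ts + 0*W) (ts + 0) - xp (ts + 0)"
          using DERIV_pos_inc_left[OF excess_deriv[OF ro0(1) ts_pos ts_dom, of W] dpos] by (elim exE conjE)
        define h where "h = min \<delta> ts / 2"
        have h: "0 < h" "h < \<delta>" "h < ts" using \<delta> ts_pos by (auto simp: h_def)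
        have "ro ts + (0-h)*W = ro (ts - h)" by (simp add: ro_def algebra_simps)
        then show False using \<delta>(2)[rule_format, OF h(1,2)] before_ro[of "ts - h"] h eq by simp
      qed
      \<comment> \<open>Boundary points need not have been in the region earlier, so
        \<open>Qc\<close> comes from larger radii instead. At r2, the last radius carrying mass at
        most xp, it is a limit of interior points. Density is then positive at r2, which rules out a
        vacuum interval between r and r2 and forces r = r2.\<close>
      have Qc_reg: "Qc r ts" if "(r,ts) \<in> reg" "r \<le> R" for r
      proof (cases "xp ts < m r ts")
        case True
        then show ?thesis using Qc_interior[of r] regD[OF that(1)] that by simp
      next
        case False
        note rr = regD[OF that(1)]
        have mr: "m r ts = xp ts" using False rr by simp
        have "continuous_on {r..R} (\<lambda>x. m x ts)" using cont_r[OF mass_cont, of r] rr by simp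
        then have "compact {x\<in>{r..R}. m x ts \<le> xp ts}"
          by (intro compact_Collect_le compact_Icc continuous_on_const)
        moreover have "r \<in> {x\<in>{r..R}. m x ts \<le> xp ts}" using mr that by simp
        ultimately obtain r2 where r2: "r \<le> r2" "r2 \<le> R" "m r2 ts \<le> xp ts"
          "\<And>x. r \<le> x \<Longrightarrow> x \<le> R \<Longrightarrow> m x ts \<le> xp ts \<Longrightarrow> x \<le> r2"
          using continuous_attains_sup[of "{x\<in>{r..R}. m x ts \<le> xp ts}" "\<lambda>x. x"] by (auto intro: continuous_intros)
        have "r2 < ro ts"
        proof (rule ccontr)
          assume "\<not> r2 < ro ts"
          then have "m (ro ts) ts \<le> m r2 ts" using ro[OF rs(3,4)] rbar by (intro mass_mono[OF ts_dom]) auto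
          then show False using ro_ts r2 by simp
        qed
        then have "r2 < R" using ro[OF rs(3,4)] by simp
        have "Qc r2 ts"
        proof (rule Qc_right[OF _ \<open>r2 < R\<close>])
          fix x assume x: "r2 < x" "x < R"
          then have "xp ts < m x ts" using r2(4)[of x] r2(1) by force
          then show "Qc x ts" using Qc_interior[of x] x r2 rr by simp
        qed (use rr r2 in auto)
        moreover have "r = r2"
        proof (rule ccontr)
          assume "r \<noteq> r2"
          then have "m r ts < m r2 ts"
            using r2 rr Qc_pos[OF \<open>Qc r2 ts\<close>] by (intro mass_strict[OF ts_dom, where c=r2]) auto
          then show False using mr r2 by simp
        qed
        ultimately show ?thesis by simp
      qed
      have reg: "(rs,ts) \<in> reg" and fail: "\<rho> rs ts \<le> m0 * exp (- L * ts) \<or> u rs ts - z rs ts \<le> -\<epsilon> \<or> W \<le> u rs ts + z rs ts"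
        using bad ro_ts by (auto simp: Bad_def G_def)
      note rr = regD[OF reg] and Qc = Qc_reg[OF reg rs(2)]
      note pos = Qc_pos[OF Qc]
      note ddom = rr(1) ts_pos ts_dom
      have zy: "\<epsilon> < (1 - e) * z rs ts"
        using \<epsilon>0_le[of rs ts] m1_le[OF rs(4)] Qc \<epsilon> by (simp add: Qc_def)
      then have uc: "0 < u rs ts - c rs ts" using Qc by (simp add: Qc_def c_def algebra_simps)
      have c: "0 < c rs ts" by (rule c_pos[OF pos])
      have nuc: "0 < n * c rs ts * u rs ts / rs" using n_pos c uc rr(1) by simp
      note du = u_has_derivative[OF ddom] and d\<rho> = \<rho>_has_derivative[OF ddom] and dz = z_has_derivative[OF ddom pos]
      from fail show False
      proof (elim disjE)
        \<comment> \<open>Contact of the density barrier, tested with the particle speed u.\<close>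
        assume f: "\<rho> rs ts \<le> m0 * exp (- L * ts)"
        have "((\<lambda>p. m0 * exp (- L * snd p)) has_derivative (\<lambda>q. snd q * (- L * m0 * exp (- L * ts)))) (at (rs,ts))"
          by (auto intro!: derivative_eq_intros)
        from has_derivative_diff[OF this d\<rho>]
        have "((\<lambda>p. m0 * exp (- L * snd p) - \<rho> (fst p) (snd p)) has_derivative
           (\<lambda>q. fst q * (- \<rho>r rs ts) + snd q * (- L * m0 * exp (- L * ts) - \<rho>t rs ts))) (at (rs,ts))"
          by (rule has_derivative_eq_rhs) (rule ext, simp add: algebra_simps)
        then have "0 \<le> - L * m0 * exp (- L * ts) - \<rho>t rs ts + u rs ts * (- \<rho>r rs ts)"
          by (rule first_touch[OF reg ts_pos pos])
            (use f before_Q rs uc c in \<open>auto simp: Q_def\<close>)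
        moreover have "m0 * exp (- L * ts) = \<rho> rs ts" using f Qc by (simp add: Qc_def)
        ultimately have "0 \<le> \<rho> rs ts * (ur rs ts + n * u rs ts / rs - L)"
          using euler_mass[OF ddom] by (simp add: algebra_simps)
        then have "L \<le> ur rs ts + n * u rs ts / rs" using pos by (simp add: zero_le_mult_iff)
        moreover have "ur rs ts \<le> U2" using U2(2)[of rs ts] rs by simp
        moreover have "n * u rs ts / rs \<le> n * U1 / rin"
          using U1(1) U1(2)[of rs ts] rs rin(1) rin(2)[OF reg rs(2,4)] n_pos by (intro frac_le mult_left_mono) auto
        ultimately show False by (simp add: L_def)
      next
        \<comment> \<open>Contact for u - z, tested with speed u - c: its source n c u/r is positive
          and pushes it upwards.\<close>
        assume f: "u rs ts - z rs ts \<le> -\<epsilon>"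
        from has_derivative_diff[OF dz du]
        have "((\<lambda>p. z (fst p) (snd p) - u (fst p) (snd p)) has_derivative
           (\<lambda>q. fst q * (zr rs ts - ur rs ts) + snd q * (zt rs ts - ut rs ts))) (at (rs,ts))"
          by (rule has_derivative_eq_rhs) (simp add: algebra_simps)
        from has_derivative_diff[OF this has_derivative_const[of \<epsilon>]]
        have "((\<lambda>p. z (fst p) (snd p) - u (fst p) (snd p) - \<epsilon>) has_derivative
           (\<lambda>q. fst q * (zr rs ts - ur rs ts) + snd q * (zt rs ts - ut rs ts))) (at (rs,ts))"
          by simp
        then have "0 \<le> (zt rs ts - ut rs ts) + (u rs ts - c rs ts) * (zr rs ts - ur rs ts)"
          by (rule first_touch[OF reg ts_pos pos])
            (use f before_Q rs uc c in \<open>force simp: Q_def\<close>)+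
        moreover have "(ut rs ts - zt rs ts) + (u rs ts - c rs ts) * (ur rs ts - zr rs ts) = n * c rs ts * u rs ts / rs"
          using riemann_eq[OF ddom pos, of "-1"] by simp
        ultimately show False using nuc by (simp add: algebra_simps)
      next
        \<comment> \<open>Contact for u + z, tested with the limiting speed u + c: here the source
          is negative.\<close>
        assume f: "W \<le> u rs ts + z rs ts"
        from has_derivative_diff[OF has_derivative_add[OF du dz] has_derivative_const[of W]]
        have "((\<lambda>p. u (fst p) (snd p) + z (fst p) (snd p) - W) has_derivative
           (\<lambda>q. fst q * (ur rs ts + zr rs ts) + snd q * (ut rs ts + zt rs ts))) (at (rs,ts))"
          by (rule has_derivative_eq_rhs) (simp add: algebra_simps)
        then have "0 \<le> (ut rs ts + zt rs ts) + (u rs ts + c rs ts) * (ur rs ts + zr rs ts)"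
          by (rule first_touch[OF reg ts_pos pos])
            (use f before_Q rs uc c in \<open>force simp: Q_def\<close>)+
        moreover have "(ut rs ts + zt rs ts) + (u rs ts + c rs ts) * (ur rs ts + zr rs ts) = - (n * c rs ts * u rs ts / rs)"
          using riemann_eq[OF ddom pos, of 1] by simp
        ultimately show False using nuc by simp
      qed
    qed
    moreover have "(r,t) \<in> G" using reg regD[OF reg(1)] by (auto simp: G_def box_def)
    ultimately have "m0 * exp (- L * t) < \<rho> r t" "-\<epsilon> < u r t - z r t"
      unfolding Bad_def by (auto simp: not_le set_eq_iff)
    moreover have "0 < m0 * exp (- L * t)" using m0 by simp
    ultimately show ?thesis by linarith
  qed
  then show ?thesis using that[OF \<epsilon>0] by blast
qed

text \<open>The threshold \<epsilon>0 depends on the box only, so \<epsilon> can be sent to 0 at a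
  fixed point.\<close>

lemma reg_supersonic:
  assumes "(r,t) \<in> reg"
  shows "0 < \<rho> r t" "z r t \<le> u r t"
proof -
  note rr = regD[OF assms]
  define R where "R = max r (rbar + 1 + (2*C0+1) * t) + 1"
  obtain \<epsilon>0 where \<epsilon>0: "0 < \<epsilon>0"
    "\<And>\<epsilon>. 0 < \<epsilon> \<Longrightarrow> \<epsilon> < \<epsilon>0 \<Longrightarrow> 0 < \<rho> r t \<and> -\<epsilon> < u r t - z r t"
  proof (rule invariant_region[OF rr(2), of R])
    fix \<epsilon>0
    assume "0 < \<epsilon>0" and H: "\<And>\<epsilon> r' t'. 0 < \<epsilon> \<Longrightarrow> \<epsilon> < \<epsilon>0 \<Longrightarrow> (r',t') \<in> reg \<Longrightarrow> r' \<le> R \<Longrightarrow> t' \<le> t \<Longrightarrow>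
      0 < \<rho> r' t' \<and> -\<epsilon> < u r' t' - z r' t'"
    then show ?thesis using that[of \<epsilon>0] H[OF _ _ assms] by (auto simp: R_def)
  qed (auto simp: R_def)
  show "0 < \<rho> r t" using \<epsilon>0(2)[of "\<epsilon>0/2"] \<epsilon>0(1) by simp
  show "z r t \<le> u r t"
  proof (rule ccontr)
    assume "\<not> ?thesis"
    moreover define \<epsilon> where "\<epsilon> = min (\<epsilon>0/2) (z r t - u r t)"
    ultimately have "0 < \<epsilon>" "\<epsilon> < \<epsilon>0" "\<epsilon> \<le> z r t - u r t" using \<epsilon>0(1) by auto
    then show False using \<epsilon>0(2)[of \<epsilon>] by simp
  qed
qed

lemma reg_u_pos: "(r,t) \<in> reg \<Longrightarrow> 0 < u r t"
  using reg_supersonic[of r t] z_pos[of r t] by simp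

lemma reg_c_pos: "(r,t) \<in> reg \<Longrightarrow> 0 < c r t"
  using reg_supersonic[of r t] c_pos[of r t] by simp

lemma reg_c_less: "(r,t) \<in> reg \<Longrightarrow> c r t < u r t"
  using reg_supersonic[of r t] mult_strict_right_mono[OF e_less1 z_pos[of r t]] by (simp add: c_def)

text \<open>The fluid moves outwards: a first contact of the region with a vertical line inside
  radius rbar, tested with the speed u > 0, would require -u \<ge> 0.\<close>

lemma reg_rbar:
  assumes "(r,t) \<in> reg"
  shows "rbar \<le> r"
proof (rule ccontr)
  assume "\<not> rbar \<le> r"
  note rr = regD[OF assms]
  define Z where "Z = {p\<in>reg \<inter> box rbar t. fst p \<le> r}"
  have "compact Z" unfolding Z_def
    by (intro compact_Collect_le reg_compact rr continuous_intros)
  moreover have "(r,t) \<in> Z" using assms rr \<open>\<not> rbar \<le> r\<close> by (simp add: Z_def box_def)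
  ultimately obtain r1 t1 where Z: "(r1,t1) \<in> Z" and first: "\<And>r' t'. (r',t') \<in> Z \<Longrightarrow> t1 \<le> t'"
    using compact_first_time[of Z] by (metis empty_iff)
  have reg1: "(r1,t1) \<in> reg" and r1: "r1 \<le> r" "t1 \<le> t" using Z by (auto simp: Z_def box_def)
  note rr1 = regD[OF reg1]
  show False
  proof (cases "t1 = 0")
    case True
    then show False using reg1 r1 reg_at_0 \<open>\<not> rbar \<le> r\<close> by auto
  next
    case False
    then have t1: "0 < t1" using rr1 by simp
    have "((\<lambda>p. r - fst p) has_derivative (\<lambda>q. fst q * (-1) + snd q * 0)) (at (r1,t1))"
      by (auto intro!: derivative_eq_intros)
    then have "0 \<le> 0 + u r1 t1 * (-1)"
    proof (rule first_touch[OF reg1 t1 reg_supersonic(1)[OF reg1]])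
      fix r' t' assume a: "(r',t') \<in> reg" "r' \<le> r1" "t' < t1"
      then have "(r',t') \<notin> Z" using first[of r' t'] by auto
      then show "r - fst (r',t') < 0" using a r1 regD[OF a(1)] \<open>\<not> rbar \<le> r\<close> by (auto simp: Z_def box_def)
    qed (use r1 reg_u_pos[OF reg1] reg_c_pos[OF reg1] in auto)
    then show False using reg_u_pos[OF reg1] by simp
  qed
qed

end

subsection \<open>Riccati inequalities for difference quotients\<close>

text \<open>With $Q = u_r + s z_r + s n e x z$ (at contact $Q = Mz$), $\sigma = u_r - s z_r - s n e x z$ and $x = 1/r$,
  the left-hand side is the rate of change of $Q - Mz$ along the characteristic of speed $u + s e z$.
  Its only indefinite part is a multiple of $(3 s e z - u)(Q - \sigma)$.\<close>
lemma riccati_negative: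
  fixes n e x M z u \<sigma> s ur zr :: real
  assumes s: "s = 1 \<or> s = -1" and pos: "0 < n" "1/3 < e" "e < 1" "0 < x" "0 < M" "0 < z"
    and u: "z \<le> u" and M: "n * e * x \<le> M"
    and Q: "ur + s * zr = (M - s * n * e * x) * z" and \<sigma>: "ur - s * zr \<le> (M + s * n * e * x) * z"
  shows "- s * n * (e * zr * u * x + (e * z) * ur * x - (e * z) * u * x\<^sup>2) - (ur + s * e * zr) * (ur + s * zr)
     - ((M - s * n * e * x) * (s * (e * z) * zr - (e * z) * (ur + n * u * x))
        + (u + s * (e * z)) * z * (M * (n * e) * x + s * n * e * x\<^sup>2)) < 0" (is "?E < 0")
proof -
  define Q where "Q = M * z"
  \<comment> \<open>\<delta> is the room left in the bound for the other family. At contact ur + s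
    zr does not contain \<delta>, so the expression becomes affine in \<delta>, with coefficient
    minus the bracket treated below.\<close>
  define \<delta> where "\<delta> = (M + s * n * e * x) * z - (ur - s * zr)"
  have \<delta>: "0 \<le> \<delta>" using \<sigma> by (simp add: \<delta>_def)
  have s2: "s * s = 1" using s by auto
  have ur: "ur = M * z - \<delta> / 2"
    using Q by (simp add: \<delta>_def field_simps)
  have "s * zr = \<delta> / 2 - s * n * e * x * z"
    using Q ur by (simp add: algebra_simps)
  then have zr: "zr = s * \<delta> / 2 - n * e * x * z" using s by auto
  have E: "?E = - (1 - e) * Q\<^sup>2 - \<delta> * ((3*e-1)/2 * Q - n * e * x / 2 * (3 * s * (e * z) - u)) - n * (e*z)\<^sup>2 * x\<^sup>2 * (1 + 2 * n * e)"
    using s by (elim disjE) (simp_all add: ur zr Q_def power2_eq_square algebra_simps add_divide_distrib diff_divide_distrib)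
  have "0 < (1 - e) * Q\<^sup>2" using pos by (simp add: Q_def)
  moreover have "0 \<le> n * (e*z)\<^sup>2 * x\<^sup>2 * (1 + 2 * n * e)" using pos by simp
  \<comment> \<open>Here u \<ge> z is decisive: 3 s e z - u is at most (3e-1) z, and n e x \<le> M
    absorbs it into the first term because 3e > 1.\<close>
  moreover have "0 \<le> (3*e-1)/2 * Q - n * e * x / 2 * (3 * s * (e * z) - u)"
  proof -
    have nex: "0 < n * e * x" using pos by simp
    have "3 * s * (e * z) - u \<le> (3*e-1) * z"
    proof -
      have "s * (e * z) \<le> e * z" using s pos by auto
      then show ?thesis using u by (simp add: algebra_simps)
    qed
    then have "n * e * x * (3 * s * (e * z) - u) \<le> n * e * x * ((3*e-1) * z)"
      using nex by (intro mult_left_mono) auto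
    also have "\<dots> \<le> M * ((3*e-1) * z)" using M pos by (intro mult_right_mono) auto
    finally have "0 \<le> (M * ((3*e-1) * z) - n * e * x * (3 * s * (e * z) - u)) / 2" by simp
    also have "\<dots> = (3*e-1)/2 * Q - n * e * x / 2 * (3 * s * (e * z) - u)"
      by (simp add: Q_def diff_divide_distrib)
    finally show ?thesis .
  qed
  note mult_nonneg_nonneg[OF \<delta> this]
  ultimately show ?thesis unfolding E by linarith
qed

lemma small_counterexamples:
  assumes "\<not> (\<exists>\<delta>0>0. \<forall>\<delta>::real. 0 < \<delta> \<longrightarrow> \<delta> < \<delta>0 \<longrightarrow> P \<delta>)"
  shows "\<exists>D. \<forall>k::nat. 0 < D k \<and> D k < 1 / (real k + 1) \<and> \<not> P (D k)"
proof -
  have "\<forall>k::nat. \<exists>\<delta>. 0 < \<delta> \<and> \<delta> < 1 / (real k + 1) \<and> \<not> P \<delta>"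
  proof
    fix k :: nat
    have "0 < 1 / (real k + 1)" by simp
    then show "\<exists>\<delta>. 0 < \<delta> \<and> \<delta> < 1 / (real k + 1) \<and> \<not> P \<delta>" using assms by blast
  qed
  from choice[OF this] show ?thesis .
qed

context radial_euler_char
begin

text \<open>The barrier: with \<mu> = N'/K_tau, the inequality Wr s \<le> g \<mu> s * z is the bound
  N' for the weighted \<alpha> when s = 1 and for the weighted \<beta> when s = -1. The second term
  removes the geometric part s n c/r.\<close>

definition g :: "real \<Rightarrow> real \<Rightarrow> real \<Rightarrow> real" where "g \<mu> s r = \<mu> * r powr b - s * n * e / r"
definition g' :: "real \<Rightarrow> real \<Rightarrow> real \<Rightarrow> real" where "g' \<mu> s r = \<mu> * r powr b * b / r + s * n * e / r\<^sup>2"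
definition W :: "real \<Rightarrow> real \<Rightarrow> real \<Rightarrow> real" where "W s r t = u r t + s * z r t"
definition Wr :: "real \<Rightarrow> real \<Rightarrow> real \<Rightarrow> real" where "Wr s r t = ur r t + s * zr r t"
definition Wt :: "real \<Rightarrow> real \<Rightarrow> real \<Rightarrow> real" where "Wt s r t = ut r t + s * zt r t"
definition lam :: "real \<Rightarrow> real \<Rightarrow> real \<Rightarrow> real" where "lam s r t = u r t + s * c r t"
definition lamr :: "real \<Rightarrow> real \<Rightarrow> real \<Rightarrow> real" where "lamr s r t = ur r t + s * e * zr r t"
definition S :: "real \<Rightarrow> real \<Rightarrow> real \<Rightarrow> real" where "S s r t = - s * n * c r t * u r t / r"
definition Sr :: "real \<Rightarrow> real \<Rightarrow> real \<Rightarrow> real" where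
  "Sr s r t = - s * n * (e * zr r t * u r t / r + c r t * ur r t / r - c r t * u r t / r\<^sup>2)"
text \<open>The rate of g z along the characteristic of speed \<open>lam s\<close>, with z_t
  eliminated by the mass equation.\<close>

definition H :: "real \<Rightarrow> real \<Rightarrow> real \<Rightarrow> real \<Rightarrow> real" where
  "H \<mu> s r t = g \<mu> s r * (s * c r t * zr r t - c r t * (ur r t + n * u r t / r)) + lam s r t * z r t * g' \<mu> s r"

lemma e_third: "1/3 < e" using gam53 by (simp add: e_def)

text \<open>The expression is the formal rate of Wr - g z: differentiating the transport equation of
  W gives Sr - lamr Wr. The condition on \<mu> is monotone in r, so it passes from rbar to every
  radius of the region.\<close>

lemma contact_rate_negative:
  assumes s: "s = 1 \<or> s = -1" and \<mu>: "0 < \<mu>" "n * e \<le> \<mu> * rbar powr (b + 1)"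
    and reg: "(r,t) \<in> reg" and eq: "Wr s r t = g \<mu> s r * z r t" and le: "Wr (-s) r t \<le> g \<mu> (-s) r * z r t"
  shows "Sr s r t - lamr s r t * Wr s r t - H \<mu> s r t < 0"
proof -
  note r = regD(1)[OF reg]
  define M where "M = \<mu> * r powr b"
  have "\<mu> * rbar powr (b+1) \<le> \<mu> * r powr (b+1)"
    using reg_rbar[OF reg] rbar \<mu> n_pos e_pos by (intro mult_left_mono powr_mono2) (auto simp: b_def)
  also have "\<dots> = M * r" using r by (simp add: M_def powr_add)
  finally have nM: "n * e * (1/r) \<le> M" using \<mu> r by (simp add: pos_divide_le_eq)
  have zpos: "0 < z r t" by (rule z_pos[OF reg_supersonic(1)[OF reg]])
  have "- s * n * (e * zr r t * u r t * (1/r) + (e * z r t) * ur r t * (1/r) - (e * z r t) * u r t * (1/r)\<^sup>2)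
     - (ur r t + s * e * zr r t) * (ur r t + s * zr r t)
     - ((M - s * n * e * (1/r)) * (s * (e * z r t) * zr r t - (e * z r t) * (ur r t + n * u r t * (1/r)))
        + (u r t + s * (e * z r t)) * z r t * (M * (n * e) * (1/r) + s * n * e * (1/r)\<^sup>2)) < 0"
    by (rule riccati_negative[OF s n_pos e_third e_less1 _ _ zpos reg_supersonic(2)[OF reg] nM])
      (use r \<mu> eq le in \<open>auto simp: M_def Wr_def g_def\<close>)
  then show ?thesis
    by (simp add: Sr_def lamr_def Wr_def H_def lam_def g_def g'_def M_def c_def b_def power_divide)
qed

lemma reg_cont:
  assumes "continuous_on (dom_ST T) (\<lambda>(r,t). F r t)"
  shows "continuous_on reg (\<lambda>p. F (fst p) (snd p))"
  by (rule cont_on_comp[OF assms]) (auto simp: reg_def intro!: continuous_intros)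

lemma reg_cont_zr: "continuous_on reg (\<lambda>p. zr (fst p) (snd p))"
  unfolding zr_def c_def
  by (intro continuous_intros reg_cont z_cont cont_partials cont_\<rho>u) (use reg_supersonic in force)

lemma reg_tendsto:
  assumes "continuous_on reg (\<lambda>p. F (fst p) (snd p))" "X \<longlonglongrightarrow> r" "Y \<longlonglongrightarrow> t" "(r,t) \<in> reg" "\<And>k. (X k, Y k) \<in> reg"
  shows "(\<lambda>k. F (X k) (Y k)) \<longlonglongrightarrow> F r t"
  using continuous_on_tendsto_compose[OF assms(1) tendsto_Pair[OF assms(2,3)] assms(4)] assms(5) by simp

lemma W_deriv: "(r,t) \<in> reg \<Longrightarrow> ((\<lambda>r. W s r t) has_real_derivative Wr s r t) (at r)"
  unfolding W_def Wr_def
  using u_r[of r t] z_r[of r t] at_within_pos[of r] reg_supersonic(1)[of r t] regD[of r t]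
  by (intro DERIV_add DERIV_cmult) auto

lemma lam_deriv: "(r,t) \<in> reg \<Longrightarrow> ((\<lambda>r. lam s r t) has_real_derivative lamr s r t) (at r)"
  using W_deriv[of r t "s * e"] by (simp add: W_def Wr_def lam_def lamr_def c_def mult.assoc)

lemma S_deriv:
  assumes "(r,t) \<in> reg" shows "((\<lambda>r. S s r t) has_real_derivative Sr s r t) (at r)"
proof -
  have u: "((\<lambda>r. u r t) has_real_derivative ur r t) (at r)"
    and z: "((\<lambda>r. z r t) has_real_derivative zr r t) (at r)" and r: "0 < r"
    using u_r[of r t] z_r[of r t] at_within_pos[of r] reg_supersonic(1)[OF assms] regD[OF assms] by auto
  show ?thesis unfolding S_def Sr_def c_def
    by (rule DERIV_cong[OF DERIV_divide[OF DERIV_mult[OF DERIV_cmult[OF DERIV_cmult[OF z]] u] DERIV_ident]])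
      (use r in \<open>simp_all add: field_simps power2_eq_square\<close>)
qed

section \<open>Mean values and limits of difference quotients in the region\<close>

lemma reg_mvt:
  assumes reg: "(r,t) \<in> reg" and \<delta>: "0 < \<delta>"
    and D: "\<And>x. (x,t) \<in> reg \<Longrightarrow> ((\<lambda>r. F r t) has_real_derivative F' x t) (at x)"
  shows "\<exists>\<xi>. r < \<xi> \<and> \<xi> < r + \<delta> \<and> (\<xi>,t) \<in> reg \<and> F (r+\<delta>) t - F r t = \<delta> * F' \<xi> t"
proof -
  obtain \<xi> where "r < \<xi>" "\<xi> < r + \<delta>" "F (r+\<delta>) t - F r t = (r + \<delta> - r) * F' \<xi> t"
    using MVT2[of r "r+\<delta>" "\<lambda>r. F r t" "\<lambda>x. F' x t"] D reg_up[OF reg] \<delta> by auto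
  then show ?thesis using reg_up[OF reg, of \<xi>] by auto
qed

lemma reg_mvt_seq:
  assumes reg: "\<And>k. (X k, Y k) \<in> reg" and \<delta>: "\<And>k. 0 < D k"
    and D: "\<And>x t. (x,t) \<in> reg \<Longrightarrow> ((\<lambda>r. F r t) has_real_derivative F' x t) (at x)"
  shows "\<exists>\<xi>. \<forall>k::nat. X k < \<xi> k \<and> \<xi> k < X k + D k \<and> (\<xi> k, Y k) \<in> reg \<and>
    F (X k + D k) (Y k) - F (X k) (Y k) = D k * F' (\<xi> k) (Y k)"
proof -
  have "\<forall>k. \<exists>\<xi>. X k < \<xi> \<and> \<xi> < X k + D k \<and> (\<xi>, Y k) \<in> reg \<and> F (X k + D k) (Y k) - F (X k) (Y k) = D k * F' \<xi> (Y k)"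
    by (intro allI reg_mvt reg \<delta> D)
  from choice[OF this] show ?thesis .
qed

lemma reg_subseq:
  assumes t1: "t1 \<in> time_dom T" and P: "\<And>k. (X k, Y k) \<in> reg \<inter> box R t1"
  shows "\<exists>r t \<phi>. (r,t) \<in> reg \<and> strict_mono (\<phi> :: nat \<Rightarrow> nat) \<and> (\<lambda>k. X (\<phi> k)) \<longlonglongrightarrow> r \<and> (\<lambda>k. Y (\<phi> k)) \<longlonglongrightarrow> t"
proof -
  have "seq_compact (reg \<inter> box R t1)"
    by (rule compact_imp_seq_compact[OF reg_compact[OF t1]])
  from this[unfolded seq_compact_def, THEN spec, of "\<lambda>k. (X k, Y k)"]
  obtain l \<phi> where l: "l \<in> reg \<inter> box R t1" "strict_mono (\<phi> :: nat \<Rightarrow> nat)" "((\<lambda>k. (X k, Y k)) \<circ> \<phi>) \<longlonglongrightarrow> l"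
    using P by blast
  show ?thesis
  proof (intro exI conjI)
    show "(fst l, snd l) \<in> reg" using l(1) by simp
    show "(\<lambda>k. X (\<phi> k)) \<longlonglongrightarrow> fst l" using tendsto_fst[OF l(3)] by (simp add: o_def)
    show "(\<lambda>k. Y (\<phi> k)) \<longlonglongrightarrow> snd l" using tendsto_snd[OF l(3)] by (simp add: o_def)
  qed (rule l)
qed

lemma squeeze_seq:
  fixes X D \<xi> :: "nat \<Rightarrow> real"
  assumes "X \<longlonglongrightarrow> r" "D \<longlonglongrightarrow> 0" "\<And>k. X k \<le> \<xi> k" "\<And>k. \<xi> k \<le> X k + D k"
  shows "\<xi> \<longlonglongrightarrow> r"
  by (rule tendsto_sandwich[of X _ _ "\<lambda>k. X k + D k"])
    (use assms tendsto_add[OF assms(1,2)] in auto)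

lemma small_seq:
  fixes D :: "nat \<Rightarrow> real"
  assumes "\<And>k. 0 < D k" "\<And>k. D k < 1 / (real k + 1)" "strict_mono (\<phi> :: nat \<Rightarrow> nat)"
  shows "(\<lambda>k. D (\<phi> k)) \<longlonglongrightarrow> 0"
proof -
  have "(\<lambda>k. 1 / (real k + 1)) \<longlonglongrightarrow> 0"
    using LIMSEQ_inverse_real_of_nat by (simp add: inverse_eq_divide add.commute)
  then have "D \<longlonglongrightarrow> 0"
    by (rule tendsto_sandwich[OF _ _ tendsto_const, rotated 2]) (use assms(1,2) in \<open>auto intro!: always_eventually less_imp_le\<close>)
  then show ?thesis using LIMSEQ_subseq_LIMSEQ[OF _ assms(3)] by (simp add: o_def)
qed

lemma reg_cont_g: "continuous_on reg (\<lambda>p. g \<mu> s (fst p))" "continuous_on reg (\<lambda>p. g' \<mu> s (fst p))"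
  unfolding g_def g'_def using regD(1) by (intro continuous_intros; force)+

text \<open>A strict pointwise bound on the derivative becomes a bound on difference quotients,
  uniform on [rbar, R]. Counterexamples with steps tending to 0 would accumulate at a radius
  violating the pointwise bound.\<close>

lemma initial_difference:
  assumes init: "\<And>r. rbar \<le> r \<Longrightarrow> Wr s r 0 < g \<mu> s r * z r 0"
  shows "\<exists>\<delta>0>0. \<forall>\<delta>. 0 < \<delta> \<longrightarrow> \<delta> < \<delta>0 \<longrightarrow> (\<forall>r. rbar \<le> r \<longrightarrow> r \<le> R \<longrightarrow> W s (r+\<delta>) 0 - W s r 0 < \<delta> * (g \<mu> s r * z r 0))"
proof (rule ccontr)
  assume neg: "\<not> ?thesis"
  from small_counterexamples[OF this]
  obtain D where "\<forall>k. 0 < D k \<and> D k < 1 / (real k + 1) \<and>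
    \<not> (\<forall>r. rbar \<le> r \<longrightarrow> r \<le> R \<longrightarrow> W s (r+D k) 0 - W s r 0 < D k * (g \<mu> s r * z r 0))" by (elim exE)
  note D = this[rule_format, THEN conjunct1] this[rule_format, THEN conjunct2, THEN conjunct1]
    this[THEN spec, THEN conjunct2, THEN conjunct2]
  have "\<forall>k. \<exists>x. rbar \<le> x \<and> x \<le> R \<and> D k * (g \<mu> s x * z x 0) \<le> W s (x + D k) 0 - W s x 0"
    using D(3) by (simp only: not_all not_imp not_less) blast
  then obtain X where "\<And>k. rbar \<le> X k" "\<And>k. X k \<le> R"
    "\<And>k. D k * (g \<mu> s (X k) * z (X k) 0) \<le> W s (X k + D k) 0 - W s (X k) 0" by metis
  note DX = D(1,2) this
  have reg: "(X k, 0) \<in> reg" for k using DX(3) reg_at_0 by simp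
  have "(X k, 0) \<in> reg \<inter> box R 0" for k using reg[of k] regD[OF reg[of k]] DX(4)[of k] by (simp add: box_def)
  from reg_subseq[where X=X and Y="\<lambda>k. 0", OF zero_time this]
  obtain r t \<phi> where l: "(r,t) \<in> reg" "strict_mono (\<phi> :: nat \<Rightarrow> nat)" "(\<lambda>k. X (\<phi> k)) \<longlonglongrightarrow> r" "(\<lambda>k. 0::real) \<longlonglongrightarrow> t"
    by blast
  have t: "t = 0" using LIMSEQ_unique[OF l(4) tendsto_const] by simp
  have "\<exists>\<xi>. X k < \<xi> \<and> \<xi> < X k + D k \<and> (\<xi>,0) \<in> reg \<and> g \<mu> s (X k) * z (X k) 0 \<le> Wr s \<xi> 0" for k
    using reg_mvt[where F="W s" and F'="Wr s", OF reg[of k] DX(1)[of k] W_deriv] DX(5)[of k] DX(1)[of k] by auto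
  then obtain \<xi> where \<xi>: "\<And>k. X k < \<xi> k" "\<And>k. \<xi> k < X k + D k" "\<And>k. (\<xi> k, 0) \<in> reg"
    "\<And>k. g \<mu> s (X k) * z (X k) 0 \<le> Wr s (\<xi> k) 0" by metis
  \<comment> \<open>The mean value points are trapped between X and X + D, so they have the same
    limit.\<close>
  have \<xi>lim: "(\<lambda>k. \<xi> (\<phi> k)) \<longlonglongrightarrow> r"
    by (rule squeeze_seq[OF l(3) small_seq[OF DX(1,2) l(2)]]) (use \<xi> in \<open>auto intro: less_imp_le\<close>)
  have cW: "continuous_on reg (\<lambda>p. Wr s (fst p) (snd p))"
    unfolding Wr_def by (intro continuous_intros reg_cont cont_partials reg_cont_zr)
  have cg: "continuous_on reg (\<lambda>p. g \<mu> s (fst p) * z (fst p) (snd p))"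
    by (intro continuous_intros reg_cont z_cont reg_cont_g)
  have l1: "(\<lambda>k. Wr s (\<xi> (\<phi> k)) 0) \<longlonglongrightarrow> Wr s r t"
    by (rule reg_tendsto[where F="Wr s", OF cW \<xi>lim l(4) l(1)]) (use \<xi> in auto)
  have l2: "(\<lambda>k. g \<mu> s (X (\<phi> k)) * z (X (\<phi> k)) 0) \<longlonglongrightarrow> g \<mu> s r * z r t"
    by (rule reg_tendsto[where F="\<lambda>r t. g \<mu> s r * z r t", OF cg l(3) l(4) l(1)]) (use reg in auto)
  have "g \<mu> s r * z r t \<le> Wr s r t"
    by (rule LIMSEQ_le[OF l2 l1]) (use \<xi>(4) in auto)
  then show False using init[of r] reg_rbar[OF l(1)] t by simp
qed

text \<open>The last expression is \<delta> times a discrete version of the contact rate. If it were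
  nonnegative for arbitrarily small steps, mean values and compactness would give a limit point with
  exact contact and nonnegative rate, against \<open>contact_rate_negative\<close>.\<close>

lemma no_interior_touch:
  assumes s: "s = 1 \<or> s = -1" and \<mu>: "0 < \<mu>" "n * e \<le> \<mu> * rbar powr (b + 1)" and t1: "t1 \<in> time_dom T"
  shows "\<exists>\<delta>0>0. \<forall>\<delta>. 0 < \<delta> \<longrightarrow> \<delta> < \<delta>0 \<longrightarrow> (\<forall>r t. (r,t) \<in> reg \<inter> box R t1 \<longrightarrow>
    W s (r+\<delta>) t - W s r t = \<delta> * (g \<mu> s r * z r t) \<longrightarrow>
    W (-s) (r+\<delta>) t - W (-s) r t \<le> \<delta> * (g \<mu> (-s) r * z r t) \<longrightarrow>
    S s (r+\<delta>) t - S s r t - (lam s (r+\<delta>) t - lam s r t) * Wr s (r+\<delta>) t - \<delta> * H \<mu> s r t < 0)"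
    (is "\<exists>\<delta>0>0. \<forall>\<delta>. 0 < \<delta> \<longrightarrow> \<delta> < \<delta>0 \<longrightarrow> (\<forall>r t. ?P \<delta> r t)")
proof (rule ccontr)
  assume neg: "\<not> ?thesis"
  from small_counterexamples[OF this]
  obtain D where "\<forall>k. 0 < D k \<and> D k < 1 / (real k + 1) \<and> \<not> (\<forall>r t. ?P (D k) r t)" by (elim exE)
  note D = this[rule_format, THEN conjunct1] this[rule_format, THEN conjunct2, THEN conjunct1]
    this[THEN spec, THEN conjunct2, THEN conjunct2]
  have "\<forall>k. \<exists>p. \<not> ?P (D k) (fst p) (snd p)"
  proof
    fix k
    obtain r t where "\<not> ?P (D k) r t" using D(3)[of k] by blast
    then show "\<exists>p. \<not> ?P (D k) (fst p) (snd p)" by (intro exI[of _ "(r,t)"]) (simp only: fst_conv snd_conv not_False_eq_True)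
  qed
  from choice[OF this] obtain p where p: "\<And>k. \<not> ?P (D k) (fst (p k)) (snd (p k))" by blast
  define X where "X k = fst (p k)" for k
  define Y where "Y k = snd (p k)" for k
  have DX: "\<And>k. 0 < D k" "\<And>k. D k < 1 / (real k + 1)" "\<And>k. \<not> ?P (D k) (X k) (Y k)"
    unfolding X_def Y_def by (rule D(1) D(2) p)+
  have box: "(X k, Y k) \<in> reg \<inter> box R t1" for k using DX(3)[of k] by blast
  have reg: "(X k, Y k) \<in> reg" for k using box by blast
  have P1: "W s (X k + D k) (Y k) - W s (X k) (Y k) = D k * (g \<mu> s (X k) * z (X k) (Y k))" for k using DX(3)[of k] by blast
  have P2: "W (-s) (X k + D k) (Y k) - W (-s) (X k) (Y k) \<le> D k * (g \<mu> (-s) (X k) * z (X k) (Y k))" for k using DX(3)[of k] by blast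
  have P3: "0 \<le> S s (X k + D k) (Y k) - S s (X k) (Y k) - (lam s (X k + D k) (Y k) - lam s (X k) (Y k)) * Wr s (X k + D k) (Y k)
      - D k * H \<mu> s (X k) (Y k)" for k using DX(3)[of k] by (simp only: not_imp not_less)
  from reg_subseq[where X=X and Y=Y, OF t1 box]
  obtain r t \<phi> where l: "(r,t) \<in> reg" "strict_mono (\<phi> :: nat \<Rightarrow> nat)" "(\<lambda>k. X (\<phi> k)) \<longlonglongrightarrow> r" "(\<lambda>k. Y (\<phi> k)) \<longlonglongrightarrow> t"
    by blast
  note Dlim = small_seq[OF DX(1,2) l(2)]
  have "\<exists>\<xi>. \<forall>k. X k < \<xi> k \<and> \<xi> k < X k + D k \<and> (\<xi> k, Y k) \<in> reg \<and>
      W s (X k + D k) (Y k) - W s (X k) (Y k) = D k * Wr s (\<xi> k) (Y k)"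
    by (rule reg_mvt_seq[where F="W s"]) (rule reg DX(1) W_deriv, assumption?)+
  then obtain \<xi>1 where \<xi>1': "\<forall>k. X k < \<xi>1 k \<and> \<xi>1 k < X k + D k \<and> (\<xi>1 k, Y k) \<in> reg \<and>
      W s (X k + D k) (Y k) - W s (X k) (Y k) = D k * Wr s (\<xi>1 k) (Y k)" by (elim exE)
  note \<xi>1 = \<xi>1'[rule_format, THEN conjunct1] \<xi>1'[rule_format, THEN conjunct2, THEN conjunct1]
    \<xi>1'[rule_format, THEN conjunct2, THEN conjunct2, THEN conjunct1] \<xi>1'[rule_format, THEN conjunct2, THEN conjunct2, THEN conjunct2]
  have "\<exists>\<xi>. \<forall>k. X k < \<xi> k \<and> \<xi> k < X k + D k \<and> (\<xi> k, Y k) \<in> reg \<and>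
      W (-s) (X k + D k) (Y k) - W (-s) (X k) (Y k) = D k * Wr (-s) (\<xi> k) (Y k)"
    by (rule reg_mvt_seq[where F="W (-s)"]) (rule reg DX(1) W_deriv, assumption?)+
  then obtain \<xi>2 where \<xi>2': "\<forall>k. X k < \<xi>2 k \<and> \<xi>2 k < X k + D k \<and> (\<xi>2 k, Y k) \<in> reg \<and>
      W (-s) (X k + D k) (Y k) - W (-s) (X k) (Y k) = D k * Wr (-s) (\<xi>2 k) (Y k)" by (elim exE)
  note \<xi>2 = \<xi>2'[rule_format, THEN conjunct1] \<xi>2'[rule_format, THEN conjunct2, THEN conjunct1]
    \<xi>2'[rule_format, THEN conjunct2, THEN conjunct2, THEN conjunct1] \<xi>2'[rule_format, THEN conjunct2, THEN conjunct2, THEN conjunct2]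
  have "\<exists>\<xi>. \<forall>k. X k < \<xi> k \<and> \<xi> k < X k + D k \<and> (\<xi> k, Y k) \<in> reg \<and>
      S s (X k + D k) (Y k) - S s (X k) (Y k) = D k * Sr s (\<xi> k) (Y k)"
    by (rule reg_mvt_seq[where F="S s"]) (rule reg DX(1) S_deriv, assumption?)+
  then obtain \<xi>3 where \<xi>3': "\<forall>k. X k < \<xi>3 k \<and> \<xi>3 k < X k + D k \<and> (\<xi>3 k, Y k) \<in> reg \<and>
      S s (X k + D k) (Y k) - S s (X k) (Y k) = D k * Sr s (\<xi>3 k) (Y k)" by (elim exE)
  note \<xi>3 = \<xi>3'[rule_format, THEN conjunct1] \<xi>3'[rule_format, THEN conjunct2, THEN conjunct1]
    \<xi>3'[rule_format, THEN conjunct2, THEN conjunct2, THEN conjunct1] \<xi>3'[rule_format, THEN conjunct2, THEN conjunct2, THEN conjunct2]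
  have "\<exists>\<xi>. \<forall>k. X k < \<xi> k \<and> \<xi> k < X k + D k \<and> (\<xi> k, Y k) \<in> reg \<and>
      lam s (X k + D k) (Y k) - lam s (X k) (Y k) = D k * lamr s (\<xi> k) (Y k)"
    by (rule reg_mvt_seq[where F="lam s"]) (rule reg DX(1) lam_deriv, assumption?)+
  then obtain \<xi>4 where \<xi>4': "\<forall>k. X k < \<xi>4 k \<and> \<xi>4 k < X k + D k \<and> (\<xi>4 k, Y k) \<in> reg \<and>
      lam s (X k + D k) (Y k) - lam s (X k) (Y k) = D k * lamr s (\<xi>4 k) (Y k)" by (elim exE)
  note \<xi>4 = \<xi>4'[rule_format, THEN conjunct1] \<xi>4'[rule_format, THEN conjunct2, THEN conjunct1]
    \<xi>4'[rule_format, THEN conjunct2, THEN conjunct2, THEN conjunct1] \<xi>4'[rule_format, THEN conjunct2, THEN conjunct2, THEN conjunct2]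
  have lim1: "(\<lambda>k. \<xi>1 (\<phi> k)) \<longlonglongrightarrow> r" by (rule squeeze_seq[OF l(3) Dlim]) (use \<xi>1 in \<open>auto intro: less_imp_le\<close>)
  have lim2: "(\<lambda>k. \<xi>2 (\<phi> k)) \<longlonglongrightarrow> r" by (rule squeeze_seq[OF l(3) Dlim]) (use \<xi>2 in \<open>auto intro: less_imp_le\<close>)
  have lim3: "(\<lambda>k. \<xi>3 (\<phi> k)) \<longlonglongrightarrow> r" by (rule squeeze_seq[OF l(3) Dlim]) (use \<xi>3 in \<open>auto intro: less_imp_le\<close>)
  have lim4: "(\<lambda>k. \<xi>4 (\<phi> k)) \<longlonglongrightarrow> r" by (rule squeeze_seq[OF l(3) Dlim]) (use \<xi>4 in \<open>auto intro: less_imp_le\<close>)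
  have lim5: "(\<lambda>k. X (\<phi> k) + D (\<phi> k)) \<longlonglongrightarrow> r"
    by (rule squeeze_seq[OF l(3) Dlim]) (use DX(1) in \<open>auto intro: less_imp_le\<close>)
  have reg5: "(X k + D k, Y k) \<in> reg" for k using reg_up[OF reg[of k], of "X k + D k"] DX(1)[of k] by simp
  note ci = continuous_intros reg_cont[OF z_cont] reg_cont[OF cont_\<rho>u(2)] reg_cont[OF cont_partials(3)] reg_cont_zr reg_cont_g
  have cW: "continuous_on reg (\<lambda>p. Wr s (fst p) (snd p))" for s unfolding Wr_def by (intro ci)
  have cg: "continuous_on reg (\<lambda>p. g \<mu> s (fst p) * z (fst p) (snd p))" for s by (intro ci)
  have cS: "continuous_on reg (\<lambda>p. Sr s (fst p) (snd p))"
    unfolding Sr_def c_def using regD(1) by (intro ci; force)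
  have cl: "continuous_on reg (\<lambda>p. lamr s (fst p) (snd p))" unfolding lamr_def by (intro ci)
  have cH: "continuous_on reg (\<lambda>p. H \<mu> s (fst p) (snd p))"
    unfolding H_def lam_def c_def using regD(1) by (intro ci; force)
  have L1: "(\<lambda>k. Wr s (\<xi>1 (\<phi> k)) (Y (\<phi> k))) \<longlonglongrightarrow> Wr s r t"
    by (rule reg_tendsto[where F="Wr s", OF cW lim1 l(4) l(1)]) (use \<xi>1 in auto)
  have Lg: "(\<lambda>k. g \<mu> s (X (\<phi> k)) * z (X (\<phi> k)) (Y (\<phi> k))) \<longlonglongrightarrow> g \<mu> s r * z r t" for s
    by (rule reg_tendsto[where F="\<lambda>r t. g \<mu> s r * z r t", OF cg l(3) l(4) l(1)]) (use reg in auto)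
  have "Wr s (\<xi>1 k) (Y k) = g \<mu> s (X k) * z (X k) (Y k)" for k
    using P1[of k] \<xi>1(4)[of k] DX(1)[of k] by simp
  \<comment> \<open>In the limit the discrete contact becomes exact contact of Wr s, and the next
    limit gives the bound for the other family: the two hypotheses on gradients in the Riccati
    inequality.\<close>
  then have eq: "Wr s r t = g \<mu> s r * z r t" using LIMSEQ_unique[OF L1] Lg[of s] by simp
  have "(\<lambda>k. Wr (-s) (\<xi>2 (\<phi> k)) (Y (\<phi> k))) \<longlonglongrightarrow> Wr (-s) r t"
    by (rule reg_tendsto[where F="Wr (-s)", OF cW lim2 l(4) l(1)]) (use \<xi>2 in auto)
  moreover have "Wr (-s) (\<xi>2 k) (Y k) \<le> g \<mu> (-s) (X k) * z (X k) (Y k)" for k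
    using P2[of k] \<xi>2(4)[of k] DX(1)[of k] by simp
  ultimately have le: "Wr (-s) r t \<le> g \<mu> (-s) r * z r t" using LIMSEQ_le[OF _ Lg[of "-s"]] by blast
  have "(\<lambda>k. Sr s (\<xi>3 (\<phi> k)) (Y (\<phi> k))) \<longlonglongrightarrow> Sr s r t"
    by (rule reg_tendsto[where F="Sr s", OF cS lim3 l(4) l(1)]) (use \<xi>3 in auto)
  moreover have "(\<lambda>k. lamr s (\<xi>4 (\<phi> k)) (Y (\<phi> k))) \<longlonglongrightarrow> lamr s r t"
    by (rule reg_tendsto[where F="lamr s", OF cl lim4 l(4) l(1)]) (use \<xi>4 in auto)
  moreover have "(\<lambda>k. Wr s (X (\<phi> k) + D (\<phi> k)) (Y (\<phi> k))) \<longlonglongrightarrow> Wr s r t"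
    by (rule reg_tendsto[where F="Wr s", OF cW lim5 l(4) l(1)]) (use reg5 in auto)
  moreover have "(\<lambda>k. H \<mu> s (X (\<phi> k)) (Y (\<phi> k))) \<longlonglongrightarrow> H \<mu> s r t"
    by (rule reg_tendsto[where F="H \<mu> s", OF cH l(3) l(4) l(1)]) (use reg in auto)
  ultimately have "(\<lambda>k. Sr s (\<xi>3 (\<phi> k)) (Y (\<phi> k)) - lamr s (\<xi>4 (\<phi> k)) (Y (\<phi> k)) * Wr s (X (\<phi> k) + D (\<phi> k)) (Y (\<phi> k))
      - H \<mu> s (X (\<phi> k)) (Y (\<phi> k))) \<longlonglongrightarrow> Sr s r t - lamr s r t * Wr s r t - H \<mu> s r t"
    by (intro tendsto_intros)
  \<comment> \<open>Dividing by the step leaves derivatives at nearby points, so the limit can be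
    taken term by term.\<close>
  moreover have "0 \<le> Sr s (\<xi>3 k) (Y k) - lamr s (\<xi>4 k) (Y k) * Wr s (X k + D k) (Y k) - H \<mu> s (X k) (Y k)" for k
  proof -
    have "0 \<le> D k * (Sr s (\<xi>3 k) (Y k) - lamr s (\<xi>4 k) (Y k) * Wr s (X k + D k) (Y k) - H \<mu> s (X k) (Y k))"
      using P3[of k] unfolding \<xi>3(4) \<xi>4(4) by (simp add: algebra_simps)
    then show ?thesis using DX(1)[of k] by (simp add: zero_le_mult_iff)
  qed
  ultimately have "0 \<le> Sr s r t - lamr s r t * Wr s r t - H \<mu> s r t"
    by (intro LIMSEQ_le_const) auto
  then show False using contact_rate_negative[OF s \<mu> l(1) eq le] by simp
qed

lemma W_has_derivative:
  assumes "(r,t) \<in> reg" "0 < t"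
  shows "((\<lambda>p. W s (fst p) (snd p)) has_derivative (\<lambda>q. fst q * Wr s r t + snd q * Wt s r t)) (at (r,t))"
proof -
  note D = regD(1)[OF assms(1)] assms(2) regD(2)[OF assms(1)]
  from has_derivative_add[OF u_has_derivative[OF D] has_derivative_mult_right[OF z_has_derivative[OF D reg_supersonic(1)[OF assms(1)]], of s]]
  show ?thesis unfolding W_def by (rule has_derivative_eq_rhs) (rule ext, simp add: Wr_def Wt_def algebra_simps)
qed

lemma g_has_derivative:
  assumes "0 < r"
  shows "((\<lambda>p. g \<mu> s (fst p)) has_derivative (\<lambda>q. fst q * g' \<mu> s r)) (at (r,t))"
proof -
  have "((\<lambda>r. g \<mu> s r) has_real_derivative \<mu> * (b * r powr (b - 1)) + s * n * e / r\<^sup>2) (at r)"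
    unfolding g_def using assms by (auto intro!: derivative_eq_intros simp: power2_eq_square)
  moreover have "\<mu> * (b * r powr (b - 1)) + s * n * e / r\<^sup>2 = g' \<mu> s r"
    using assms by (simp add: g'_def powr_diff)
  ultimately have "((\<lambda>r. g \<mu> s r) has_derivative (*) (g' \<mu> s r)) (at (fst (r,t)))"
    by (simp add: has_field_derivative_def)
  from has_derivative_compose[OF has_derivative_fst[OF has_derivative_ident] this]
  show ?thesis by (simp add: mult.commute)
qed

text \<open>Steklov averaging: $F/\delta$ is $W_r - gz$ with the derivative replaced by a difference quotient,
  hence differentiable although $W$ is only $C^1$.\<close>
definition F :: "real \<Rightarrow> real \<Rightarrow> real \<Rightarrow> real \<times> real \<Rightarrow> real" where
  "F \<mu> \<delta> s p = W s (fst p + \<delta>) (snd p) - W s (fst p) (snd p) - \<delta> * (g \<mu> s (fst p) * z (fst p) (snd p))"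

lemma F_has_derivative:
  assumes reg: "(r,t) \<in> reg" and t: "0 < t" and \<delta>: "0 < \<delta>"
  shows "(F \<mu> \<delta> s has_derivative (\<lambda>q.
     fst q * (Wr s (r+\<delta>) t - Wr s r t - \<delta> * (g' \<mu> s r * z r t + g \<mu> s r * zr r t))
   + snd q * (Wt s (r+\<delta>) t - Wt s r t - \<delta> * (g \<mu> s r * zt r t)))) (at (r,t))"
proof -
  note D = regD(1)[OF reg] t regD(2)[OF reg]
  have reg': "(r+\<delta>,t) \<in> reg" using reg_up[OF reg, of "r+\<delta>"] \<delta> by simp
  have shift: "((\<lambda>p. W s (fst (fst p + \<delta>, snd p)) (snd (fst p + \<delta>, snd p))) has_derivative
     (\<lambda>q. fst (fst q, snd q) * Wr s (r+\<delta>) t + snd (fst q, snd q) * Wt s (r+\<delta>) t)) (at (r,t))"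
    by (rule has_derivative_compose[where f="\<lambda>p. (fst p + \<delta>, snd p)" and g="\<lambda>p. W s (fst p) (snd p)"],
        (auto intro!: derivative_eq_intros)[1]) (use W_has_derivative[OF reg' t, of s] in simp)
  have gz: "((\<lambda>p. g \<mu> s (fst p) * z (fst p) (snd p)) has_derivative
     (\<lambda>q. g \<mu> s (fst (r,t)) * (fst q * zr r t + snd q * zt r t) + (fst q * g' \<mu> s r) * z (fst (r,t)) (snd (r,t)))) (at (r,t))"
    by (rule has_derivative_mult[OF g_has_derivative[OF D(1)] z_has_derivative[OF D reg_supersonic(1)[OF reg]]])
  from has_derivative_diff[OF has_derivative_diff[OF shift W_has_derivative[OF reg t, of s]] has_derivative_mult_right[OF gz, of \<delta>]]
  show ?thesis unfolding F_def fst_conv snd_conv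
    by (rule has_derivative_eq_rhs) (rule ext, simp add: algebra_simps)
qed

lemma box_reg_cont_F:
  assumes "t1 \<in> time_dom T" "0 < \<delta>"
  shows "continuous_on (reg \<inter> box R t1) (F \<mu> \<delta> s)"
proof -
  have W: "continuous_on (dom_ST T) (\<lambda>(r,t). W s r t)"
    using continuous_on_add[OF cont_\<rho>u(2) continuous_on_mult_left[OF z_cont, of s]] by (simp add: W_def split_def)
  have "continuous_on reg (\<lambda>p. W s (fst p + \<delta>) (snd p))"
    by (rule cont_on_comp[OF W]) (use assms in \<open>auto simp: reg_def intro!: continuous_intros\<close>)
  then have "continuous_on reg (F \<mu> \<delta> s)"
    unfolding F_def by (intro continuous_intros reg_cont[OF W] reg_cont[OF z_cont] reg_cont_g)
  then show ?thesis by (rule continuous_on_subset) simp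
qed

text \<open>Both families are watched at once, as the contact rate of one uses the bound of the
  other at the same point. The box may be cut off at r1 because both speeds u + c and u - c are
  positive, so nothing enters from the right.\<close>

lemma gradient_bound:
  assumes \<mu>: "0 < \<mu>" "n * e \<le> \<mu> * rbar powr (b + 1)"
    and init: "\<And>s r. s = 1 \<or> s = -1 \<Longrightarrow> rbar \<le> r \<Longrightarrow> Wr s r 0 < g \<mu> s r * z r 0"
    and reg1: "(r1,t1) \<in> reg" and s1: "s1 = 1 \<or> s1 = -1"
  shows "Wr s1 r1 t1 \<le> g \<mu> s1 r1 * z r1 t1"
proof -
  note rr1 = regD[OF reg1]
  obtain \<delta>i1 where \<delta>i1: "0 < \<delta>i1" "\<And>\<delta> r. 0 < \<delta> \<Longrightarrow> \<delta> < \<delta>i1 \<Longrightarrow> rbar \<le> r \<Longrightarrow> r \<le> r1 \<Longrightarrow> W 1 (r+\<delta>) 0 - W 1 r 0 < \<delta> * (g \<mu> 1 r * z r 0)"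
    using initial_difference[of 1 \<mu> r1] init by auto
  obtain \<delta>i2 where \<delta>i2: "0 < \<delta>i2" "\<And>\<delta> r. 0 < \<delta> \<Longrightarrow> \<delta> < \<delta>i2 \<Longrightarrow> rbar \<le> r \<Longrightarrow> r \<le> r1 \<Longrightarrow> W (-1) (r+\<delta>) 0 - W (-1) r 0 < \<delta> * (g \<mu> (-1) r * z r 0)"
    using initial_difference[of "-1" \<mu> r1] init by auto
  from no_interior_touch[OF disjI1[OF refl] \<mu> rr1(2), of r1]
  obtain \<delta>t1 where \<delta>t1: "0 < \<delta>t1" "\<forall>\<delta>. 0 < \<delta> \<longrightarrow> \<delta> < \<delta>t1 \<longrightarrow> (\<forall>r t. (r,t) \<in> reg \<inter> box r1 t1 \<longrightarrow>
    W 1 (r+\<delta>) t - W 1 r t = \<delta> * (g \<mu> 1 r * z r t) \<longrightarrow>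
    W (-1) (r+\<delta>) t - W (-1) r t \<le> \<delta> * (g \<mu> (-1) r * z r t) \<longrightarrow>
    S 1 (r+\<delta>) t - S 1 r t - (lam 1 (r+\<delta>) t - lam 1 r t) * Wr 1 (r+\<delta>) t - \<delta> * H \<mu> 1 r t < 0)"
    by (elim exE conjE)
  from no_interior_touch[OF disjI2[OF refl] \<mu> rr1(2), of r1]
  obtain \<delta>t2 where \<delta>t2: "0 < \<delta>t2" "\<forall>\<delta>. 0 < \<delta> \<longrightarrow> \<delta> < \<delta>t2 \<longrightarrow> (\<forall>r t. (r,t) \<in> reg \<inter> box r1 t1 \<longrightarrow>
    W (-1) (r+\<delta>) t - W (-1) r t = \<delta> * (g \<mu> (-1) r * z r t) \<longrightarrow>
    W (-(-1)) (r+\<delta>) t - W (-(-1)) r t \<le> \<delta> * (g \<mu> (-(-1)) r * z r t) \<longrightarrow>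
    S (-1) (r+\<delta>) t - S (-1) r t - (lam (-1) (r+\<delta>) t - lam (-1) r t) * Wr (-1) (r+\<delta>) t - \<delta> * H \<mu> (-1) r t < 0)"
    by (elim exE conjE)
  define \<delta>0 where "\<delta>0 = min (min \<delta>i1 \<delta>i2) (min \<delta>t1 \<delta>t2)"
  have \<delta>0: "0 < \<delta>0" using \<delta>i1 \<delta>i2 \<delta>t1 \<delta>t2 by (simp add: \<delta>0_def)
  have key: "F \<mu> \<delta> s1 (r1,t1) < 0" if \<delta>: "0 < \<delta>" "\<delta> < \<delta>0" for \<delta>
  proof -
    define Bad where "Bad = {p\<in>reg \<inter> box r1 t1. 0 \<le> F \<mu> \<delta> 1 p} \<union> {p\<in>reg \<inter> box r1 t1. 0 \<le> F \<mu> \<delta> (-1) p}"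
    have "compact Bad" unfolding Bad_def
      by (intro compact_Un compact_Collect_le reg_compact box_reg_cont_F continuous_on_const rr1 \<delta>)
    have "Bad = {}"
    proof (rule ccontr)
      assume "Bad \<noteq> {}"
      then obtain r t where bad: "(r,t) \<in> Bad" and first: "\<And>r' t'. (r',t') \<in> Bad \<Longrightarrow> t \<le> t'"
        using compact_first_time[OF \<open>compact Bad\<close>] by metis
      have reg: "(r,t) \<in> reg" and bx: "(r,t) \<in> reg \<inter> box r1 t1" and rt: "r \<le> r1" "t \<le> t1"
        using bad by (auto simp: Bad_def box_def)
      obtain s where s: "s = 1 \<or> s = -1" and Fs: "0 \<le> F \<mu> \<delta> s (r,t)" using bad by (auto simp: Bad_def)
      show False
      proof (cases "t = 0")
        case True
        then have "rbar \<le> r" using reg reg_at_0 by simp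
        then show False using \<delta>i1(2)[of \<delta> r] \<delta>i2(2)[of \<delta> r] \<delta> s Fs rt True by (auto simp: F_def \<delta>0_def)
      next
        case False
        then have t: "0 < t" using regD[OF reg] by simp
        have before: "F \<mu> \<delta> s' (r',t') < 0" if "s' = 1 \<or> s' = -1" "(r',t') \<in> reg" "r' \<le> r" "t' < t" for s' r' t'
        proof (rule ccontr)
          assume "\<not> ?thesis"
          then have "(r',t') \<in> Bad" using that rt regD[OF that(2)] by (auto simp: Bad_def box_def)
          then show False using first that(4) by fastforce
        qed
        note pos = reg_supersonic(1)[OF reg]
        \<comment> \<open>This gives F = 0 for the family in contact and F \<le> 0 for the other
          one, as \<open>no_interior_touch\<close> demands.\<close>
        have le: "F \<mu> \<delta> s' (r,t) \<le> 0" if "s' = 1 \<or> s' = -1" for s'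
          by (rule before_limit[OF reg t pos reg_u_pos[OF reg] has_derivative_continuous[OF F_has_derivative[OF reg t \<delta>(1)]]])
            (use before that in auto)
        have lam: "0 < lam s r t" "lam s r t \<le> u r t + c r t"
          using s reg_c_pos[OF reg] reg_c_less[OF reg] by (auto simp: lam_def)
        have "0 \<le> (Wt s (r+\<delta>) t - Wt s r t - \<delta> * (g \<mu> s r * zt r t))
          + lam s r t * (Wr s (r+\<delta>) t - Wr s r t - \<delta> * (g' \<mu> s r * z r t + g \<mu> s r * zr r t))"
          by (rule first_touch[OF reg t pos F_has_derivative[OF reg t \<delta>(1)] Fs _ lam]) (use before s in auto)
        \<comment> \<open>Subtract the transport equations at r + \<delta> and r; the difference of
          lam * Wr splits into (lam difference) * Wr at r + \<delta> plus lam at r times the Wr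
          difference, and the latter cancels.\<close>
        also have "\<dots> = S s (r+\<delta>) t - S s r t - (lam s (r+\<delta>) t - lam s r t) * Wr s (r+\<delta>) t - \<delta> * H \<mu> s r t"
        proof -
          have s2: "s * s = 1" using s by auto
          have reg': "(r+\<delta>,t) \<in> reg" using reg_up[OF reg, of "r+\<delta>"] \<delta> by simp
          have R: "Wt s x t = S s x t - lam s x t * Wr s x t" if "(x,t) \<in> reg" for x
            using riemann_eq[OF regD(1)[OF that] t regD(2)[OF that] reg_supersonic(1)[OF that] s2]
            by (simp add: Wt_def S_def lam_def Wr_def)
          have "zt r t = - (u r t * zr r t + c r t * (ur r t + n * u r t / r))"
            using euler_z[OF regD(1)[OF reg] t regD(2)[OF reg] pos] by simp
          note zt = this
          show ?thesis unfolding R[OF reg] R[OF reg'] H_def zt lam_def by (simp add: algebra_simps)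
        qed
        finally have ge: "0 \<le> \<dots>" .
        have F0: "F \<mu> \<delta> s (r,t) = 0" using le[OF s] Fs by simp
        have Fm: "F \<mu> \<delta> (-s) (r,t) \<le> 0" using le[of "-s"] s by auto
        have \<delta>t: "\<delta> < \<delta>t1" "\<delta> < \<delta>t2" using \<delta> by (auto simp: \<delta>0_def)
        from s show False
        proof (elim disjE)
          assume s: "s = 1"
          show False
            using \<delta>t1(2)[rule_format, OF \<delta>(1) \<delta>t(1) bx] F0 Fm ge unfolding s by (simp add: F_def)
        next
          assume s: "s = -1"
          show False
            using \<delta>t2(2)[rule_format, OF \<delta>(1) \<delta>t(2) bx] F0 Fm ge unfolding s by (simp add: F_def)
        qed
      qed
    qed
    moreover have "(r1,t1) \<in> reg \<inter> box r1 t1" using reg1 rr1 by (simp add: box_def)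
    ultimately show ?thesis using s1 unfolding Bad_def by (auto simp: not_le)
  qed
  \<comment> \<open>The bound on quotients holds for all small steps, so it survives in the
    derivative, though only non-strictly.\<close>
  have "((\<lambda>h. (W s1 (r1+h) t1 - W s1 r1 t1) / h) \<longlongrightarrow> Wr s1 r1 t1) (at_right 0)"
    using W_deriv[OF reg1, of s1] unfolding DERIV_def by (rule tendsto_within_subset) simp
  moreover have "eventually (\<lambda>h. (W s1 (r1+h) t1 - W s1 r1 t1) / h \<le> g \<mu> s1 r1 * z r1 t1) (at_right 0)"
    unfolding eventually_at_right_field
  proof (intro exI[of _ \<delta>0] conjI allI impI \<delta>0)
    fix h assume "0 < h" "h < \<delta>0"
    then show "(W s1 (r1+h) t1 - W s1 r1 t1) / h \<le> g \<mu> s1 r1 * z r1 t1"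
      using key[of h] by (simp add: F_def pos_divide_le_eq mult.commute)
  qed
  ultimately show ?thesis by (rule tendsto_upperbound) simp
qed

end

subsection \<open>Lagrangian gradient variables and particle paths\<close>

lemma power_deriv:
  assumes "0 < r" shows "((\<lambda>r::real. r^k) has_real_derivative real k * r^k / r) (at r)"
proof (cases k)
  case (Suc j)
  then show ?thesis using DERIV_pow[of k r UNIV] assms by simp
qed simp

context radial_euler
begin

lemma open_pos_density_slice:
  assumes "t \<in> time_dom T" shows "open {r. 0 < r \<and> 0 < \<rho> r t}"
proof -
  have "open ({0<..} \<inter> (\<lambda>r. \<rho> r t) -` {0<..})"
    by (rule continuous_open_preimage)
      (use assms in \<open>auto intro!: cont_on_comp[OF cont_\<rho>u(1)] continuous_intros\<close>)
  moreover have "{0<..} \<inter> (\<lambda>r. \<rho> r t) -` {0<..} = {r. 0 < r \<and> 0 < \<rho> r t}" by auto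
  ultimately show ?thesis by simp
qed

lemma open_pos_density:
  "open {p. 0 < fst p \<and> 0 < snd p \<and> ereal (snd p) < T \<and> 0 < \<rho> (fst p) (snd p)}" (is "open ?S")
proof -
  let ?D = "{p::real\<times>real. 0 < fst p \<and> 0 < snd p \<and> ereal (snd p) < T}"
  have "open (?D \<inter> (\<lambda>p. \<rho> (fst p) (snd p)) -` {0<..})"
    by (rule continuous_open_preimage[OF _ open_interior_time])
      (auto intro!: cont_on_comp[OF cont_\<rho>u(1)] continuous_intros simp: time_dom_def)
  moreover have "?D \<inter> (\<lambda>p. \<rho> (fst p) (snd p)) -` {0<..} = ?S" by auto
  ultimately show ?thesis by simp
qed

lemma rL_deriv:
  assumes "t \<in> time_dom T" "0 < r" "0 < \<rho> r t"
  shows "((\<lambda>x. rL d \<rho> x t) has_real_derivative 1 / (r^(d-1) * \<rho> r t)) (at (m r t))"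
proof -
  let ?A = "r^(d-1) * \<rho> r t"
  have A: "0 < ?A" using assms by simp
  have "((\<lambda>x. rL d \<rho> x t) has_derivative (*) (1 / ?A)) (at (m r t))"
  proof (rule has_derivative_inverse_strong[where f="\<lambda>r. m r t" and x=r, OF open_pos_density_slice[OF assms(1)]])
    show "r \<in> {r. 0 < r \<and> 0 < \<rho> r t}" using assms by simp
    show "continuous_on {r. 0 < r \<and> 0 < \<rho> r t} (\<lambda>r. m r t)"
      using assms(1) by (intro cont_on_comp[OF mass_cont] continuous_intros) auto
    show "((\<lambda>r. m r t) has_derivative (*) ?A) (at r)"
      using mass_r[OF assms(1,2)] by (simp only: has_field_derivative_def)
    show "rL d \<rho> (m x t) t = x" if "x \<in> {r. 0 < r \<and> 0 < \<rho> r t}" for x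
      using rL_mass[OF assms(1)] that by simp
    have "(*) a \<circ> (*) (1 / a) = id" if "0 < a" for a :: real using that by (auto simp: fun_eq_iff)
    from this[OF A] show "(*) ?A \<circ> (*) (1 / ?A) = id" .
  qed
  then show ?thesis by (simp only: has_field_derivative_def)
qed

text \<open>The inverse function theorem for (r,t) \<mapsto> (m,t) on the open set of positive
  density. As m_t = -u m_r, a level curve of the mass moves with speed u: these are the particle
  paths.\<close>

lemma rL_deriv_time:
  assumes "0 < t" "t \<in> time_dom T" "0 < r" "0 < \<rho> r t"
  shows "((\<lambda>s. rL d \<rho> (m r t) s) has_real_derivative u r t) (at t)"
proof -
  let ?S = "{p. 0 < fst p \<and> 0 < snd p \<and> ereal (snd p) < T \<and> 0 < \<rho> (fst p) (snd p)}"
  let ?A = "r^(d-1) * \<rho> r t"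
  let ?f = "\<lambda>p. (m (fst p) (snd p), snd p)"
  let ?f' = "\<lambda>q. (fst q * ?A - snd q * (?A * u r t), snd q)"
  let ?h = "\<lambda>q. (rL d \<rho> (fst q) (snd q), snd q)"
  let ?h' = "\<lambda>q. (fst q / ?A + snd q * u r t, snd q)"
  have A: "0 < ?A" using assms by simp
  have "(?h has_derivative ?h') (at (?f (r,t)))"
  proof (rule has_derivative_inverse_strong[where f="?f" and x="(r,t)", OF open_pos_density])
    show "(r,t) \<in> ?S" using assms by (simp add: time_dom_def)
    show "continuous_on ?S ?f"
      by (intro continuous_intros cont_on_comp[OF mass_cont]) (auto simp: time_dom_def)
    show "(?f has_derivative ?f') (at (r,t))"
      by (rule has_derivative_Pair[OF mass_has_derivative[OF assms(1-3)] has_derivative_snd[OF has_derivative_ident]])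
    show "?h (?f p) = p" if "p \<in> ?S" for p
      using rL_mass[of "snd p" "fst p"] that by (simp add: time_dom_def)
    have "(\<lambda>q. (fst q * a - snd q * (a * w), snd q)) \<circ> (\<lambda>q. (fst q / a + snd q * w, snd q)) = id"
      if "0 < a" for a w :: real using that by (auto simp: fun_eq_iff field_simps)
    from this[OF A] show "?f' \<circ> ?h' = id" .
  qed
  then have "((\<lambda>q. rL d \<rho> (fst q) (snd q)) has_derivative (\<lambda>q. fst q / ?A + snd q * u r t)) (at (m r t, t))"
    using has_derivative_fst by fastforce
  then have "((\<lambda>q. rL d \<rho> (fst q) (snd q)) has_derivative (\<lambda>q. fst q * (1 / ?A) + snd q * u r t)) (at (m r t, t))"
    by simp
  from deriv_along_line[OF this, of 0]
  have "((\<lambda>h. rL d \<rho> (m r t) (h + t)) has_real_derivative u r t) (at 0)"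
    by (simp add: add.commute)
  then show ?thesis using DERIV_shift[of "\<lambda>s. rL d \<rho> (m r t) s" "u r t" 0 t] by simp
qed

section \<open>The Lagrangian constants and gradient variables in Eulerian form\<close>

lemma K_tau_eq: "K_tau K \<gamma> = kap powr (1/e)"
  using gam by (simp add: K_tau_def kap_def e_def)

lemma K_tau_pos: "0 < K_tau K \<gamma>"
  using kap_pos by (simp add: K_tau_eq)

text \<open>K_tau is \<open>kap\<close> to the power 1/e, and the exponent -(\<gamma>+1)/2 = -(e+1)
  turns this into -1 - 1/e; the extra 1/kap cancels against sqrt(K \<gamma>) = e kap.\<close>

lemma K_c_eq: "K_c K \<gamma> = e / K_tau K \<gamma>"
proof -
  have "-(\<gamma>+1)/2 = - (e + 1)" by (simp add: e_def field_simps)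
  moreover have "1/e * - (e + 1) = - 1 + - (1/e)" using e_pos by (simp add: field_simps)
  ultimately have eq: "1/e * (-(\<gamma>+1)/2) = - 1 + - (1/e)" by (simp only:)
  have "K_tau K \<gamma> powr (-(\<gamma>+1)/2) = kap powr (1/e * (-(\<gamma>+1)/2))"
    by (simp only: K_tau_eq powr_powr)
  also have "\<dots> = kap powr (- 1) * kap powr (- (1/e))" unfolding eq by (rule powr_add)
  also have "\<dots> = 1 / (kap * K_tau K \<gamma>)" using kap_pos by (simp add: K_tau_eq powr_minus_divide)
  finally have "K_tau K \<gamma> powr (-(\<gamma>+1)/2) = 1 / (kap * K_tau K \<gamma>)" .
  moreover have "sqrt (K*\<gamma>) = e * kap" using gam by (simp add: e_def kap_def)
  ultimately show ?thesis using kap_pos by (simp only: K_c_def) simp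
qed

lemma eta_eq:
  assumes "0 < r" "0 \<le> \<rho> r t"
  shows "kap * (r^(d-1) * \<rho> r t) powr e = r powr b * z r t"
proof -
  have "(r^(d-1)) powr e = r powr b"
    using assms by (simp add: powr_realpow[symmetric] powr_powr b_def n_def)
  then show ?thesis using assms by (simp add: powr_mult z_def)
qed

text \<open>A derivative in x' is a derivative in r divided by A \<rho>, and the weight equals K_tau
  A \<rho> / eta, so A \<rho> cancels. The term n c/r arises from differentiating the factor r^b in
  eta = r^b z.\<close>

lemma gradient_variables:
  assumes t: "t \<in> time_dom T" and r: "0 < r" and pos: "0 < \<rho> r t"
  shows "alpha_t K \<gamma> d \<rho> u (m r t) t = K_tau K \<gamma> / (r powr b * z r t) * (ur r t + zr r t + n * c r t / r)"
    and "beta_t K \<gamma> d \<rho> u (m r t) t = K_tau K \<gamma> / (r powr b * z r t) * (ur r t - zr r t - n * c r t / r)"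
proof -
  let ?X = "r^(d-1) * \<rho> r t"
  have X: "0 < ?X" using r pos by simp
  note rL = rL_mass[OF t r pos]
  have drL: "((\<lambda>x. rL d \<rho> x t) has_real_derivative 1 / ?X) (at (m r t))" by (rule rL_deriv[OF t r pos])
  have du: "((\<lambda>r. u r t) has_real_derivative ur r t) (at (rL d \<rho> (m r t) t))"
    using u_r[of r t] at_within_pos[OF r] r t by (simp add: rL)
  have uL: "deriv (\<lambda>y. uL d \<rho> u y t) (m r t) = ur r t / ?X"
    unfolding uL_def by (rule DERIV_imp_deriv, rule DERIV_cong[OF DERIV_chain2[OF du drL]]) simp
  have d\<rho>: "((\<lambda>r. \<rho> r t) has_real_derivative \<rho>r r t) (at r)"
    using \<rho>_r[of r t] at_within_pos[OF r] r t by simp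
  have dr: "((\<lambda>r. r^(d-1)) has_real_derivative n * r^(d-1) / r) (at r)"
    unfolding n_def by (rule power_deriv[OF r])
  have "((\<lambda>r. kap * (r^(d-1) * \<rho> r t) powr e) has_real_derivative
      e * (kap * ?X powr e) / ?X * (n * r^(d-1) / r * \<rho> r t + \<rho>r r t * r^(d-1))) (at r)"
    by (rule DERIV_chain2[where f="\<lambda>x. kap * x powr e", OF powr_e_deriv[OF X] DERIV_mult[OF dr d\<rho>]])
  moreover have "e * (kap * ?X powr e) / ?X * (n * r^(d-1) / r * \<rho> r t + \<rho>r r t * r^(d-1))
      = r powr b * (n * c r t / r + zr r t)"
    unfolding eta_eq[OF r less_imp_le[OF pos]] c_def zr_def using r pos by (simp add: field_simps)
  ultimately have deta: "((\<lambda>r. kap * (r^(d-1) * \<rho> r t) powr e) has_real_derivative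
      r powr b * (n * c r t / r + zr r t)) (at (rL d \<rho> (m r t) t))" by (simp add: rL)
  have etaL: "etaL K \<gamma> d \<rho> y t = kap * ((rL d \<rho> y t)^(d-1) * \<rho> (rL d \<rho> y t) t) powr e" for y
    by (simp add: etaL_def AL_def kap_def e_def)
  have eL: "deriv (\<lambda>y. etaL K \<gamma> d \<rho> y t) (m r t) = r powr b * (n * c r t / r + zr r t) / ?X"
    unfolding etaL by (rule DERIV_imp_deriv, rule DERIV_cong[OF DERIV_chain2[OF deta drL]]) simp
  \<comment> \<open>The factor in front of the eta derivative is r^(-b) and undoes the r^b of
    eta.\<close>
  have a: "AL d \<rho> (m r t) t powr (-(\<gamma>-1)/2) * (r powr b * y) = y" for y
  proof -
    have "-(\<gamma>-1)/2 = - e" by (simp add: e_def minus_divide_left)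
    moreover have "n * - e = - b" by (simp add: b_def)
    ultimately have "AL d \<rho> (m r t) t powr (-(\<gamma>-1)/2) = r powr (- b)"
      using r by (simp only: AL_def rL powr_realpow[symmetric] powr_powr n_def[symmetric])
    then show ?thesis using r by (simp add: powr_minus_divide)
  qed
  have a': "AL d \<rho> (m r t) t powr (-(\<gamma>-1)/2) * (r powr b * y / ?X) = y / ?X" for y
    using a[of "y / ?X"] by (simp only: times_divide_eq_right)
  have alphaL: "alphaL K \<gamma> d \<rho> u (m r t) t = (ur r t + zr r t + n * c r t / r) / ?X"
    unfolding alphaL_def uL eL a' by (simp add: add_divide_distrib)
  have betaL: "betaL K \<gamma> d \<rho> u (m r t) t = (ur r t - zr r t - n * c r t / r) / ?X"
    unfolding betaL_def uL eL a' by (simp add: add_divide_distrib diff_divide_distrib)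
  let ?eta = "kap * ?X powr e"
  have eta: "0 < ?eta"
    by (rule mult_pos_pos[OF kap_pos]) (use less_imp_neq[OF X] in \<open>simp only: powr_gt_zero not_False_eq_True eq_commute\<close>)
  have "(3-\<gamma>)/(\<gamma>-1) = 1/e - 1" using gam by (simp add: e_def field_simps)
  then have "etaL K \<gamma> d \<rho> (m r t) t powr ((3-\<gamma>)/(\<gamma>-1)) = ?eta powr (1/e) / ?eta"
    using eta by (simp only: etaL rL powr_diff powr_one less_imp_le)
  also have "?eta powr (1/e) = K_tau K \<gamma> * ?X"
    using X kap_pos e_pos by (simp add: powr_mult[of kap] powr_powr K_tau_eq)
  also have "?eta = r powr b * z r t" by (rule eta_eq[OF r less_imp_le[OF pos]])
  finally have m: "etaL K \<gamma> d \<rho> (m r t) t powr ((3-\<gamma>)/(\<gamma>-1)) = K_tau K \<gamma> * ?X / (r powr b * z r t)" .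
  have cancel: "a * x / w * (y / x) = a / w * y" if "0 < x" for a w x y :: real using that by simp
  show "alpha_t K \<gamma> d \<rho> u (m r t) t = K_tau K \<gamma> / (r powr b * z r t) * (ur r t + zr r t + n * c r t / r)"
    unfolding alpha_t_def m alphaL by (rule cancel[OF X])
  show "beta_t K \<gamma> d \<rho> u (m r t) t = K_tau K \<gamma> / (r powr b * z r t) * (ur r t - zr r t - n * c r t / r)"
    unfolding beta_t_def m betaL by (rule cancel[OF X])
qed

end

section \<open>Particle paths, the specific volume and the final bounds\<close>

context radial_euler_char
begin

text \<open>A particle of the region has been in it since time 0: its mass label is fixed while
  \<open>xp\<close> increases. What needs proof is that the label is attained at time s, by the
  intermediate value theorem on [0, r1].\<close>

lemma particle_path:
  assumes reg: "(r1,t1) \<in> reg" and s: "0 \<le> s" "s \<le> t1"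
  obtains r where "(r,s) \<in> reg" "m r s = m r1 t1"
proof -
  note rr1 = regD[OF reg]
  have dom: "s \<in> time_dom T" if "0 \<le> s" "s \<le> t1" for s by (rule time_dom_le[OF rr1(2) that])
  have xps: "xp s \<le> m r1 t1" if "0 \<le> s" "s \<le> t1" for s
    using xp_mono[OF that rr1(2)] rr1(3) by simp
  \<comment> \<open>At a fixed radius mass is lost while u > 0, but that sign is known only in the
    region. The earliest time s0 at which the inequality holds puts (r1, s0) in the region; there
    the mass is strictly decreasing in time, so the inequality holds still earlier.\<close>
  have ge: "m r1 t1 \<le> m r1 s"
  proof (rule ccontr)
    assume neg: "\<not> ?thesis"
    have "continuous_on {s..t1} (\<lambda>s. m r1 s)"
      using s rr1 dom by (intro cont_on_comp[OF mass_cont] continuous_intros) auto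
    then have "compact {x\<in>{s..t1}. m r1 t1 \<le> m r1 x}"
      by (intro compact_Collect_le compact_Icc continuous_on_const)
    moreover have "t1 \<in> {x\<in>{s..t1}. m r1 t1 \<le> m r1 x}" using s by simp
    ultimately obtain s0 where s0: "s0 \<in> {x\<in>{s..t1}. m r1 t1 \<le> m r1 x}"
      "\<And>x. x \<in> {x\<in>{s..t1}. m r1 t1 \<le> m r1 x} \<Longrightarrow> s0 \<le> x"
      using continuous_attains_inf[of "{x\<in>{s..t1}. m r1 t1 \<le> m r1 x}" "\<lambda>x. x"] by (auto intro: continuous_intros)
    have "s0 \<noteq> s" using s0(1) neg by auto
    then have s0': "s < s0" "s0 \<le> t1" "m r1 t1 \<le> m r1 s0" using s0(1) by auto
    have reg0: "(r1,s0) \<in> reg" using xps[of s0] dom[of s0] s0' s rr1 by (simp add: reg_def)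
    have "0 < r1^(d-1) * \<rho> r1 s0 * u r1 s0"
      using rr1 reg_supersonic(1)[OF reg0] reg_u_pos[OF reg0] by simp
    then have "- (r1^(d-1) * \<rho> r1 s0 * u r1 s0) < 0" by simp
    from DERIV_neg_dec_left[OF mass_t[of s0 r1] this]
    obtain \<delta> where \<delta>: "0 < \<delta>" "\<forall>h>0. h < \<delta> \<longrightarrow> m r1 s0 < m r1 (s0 - h)"
      using s s0' dom[of s0] rr1 by auto
    define h where "h = min \<delta> (s0 - s) / 2"
    have h: "0 < h" "h < \<delta>" "h < s0 - s" using \<delta> s0' by (auto simp: h_def)
    then have "s0 - h \<in> {x\<in>{s..t1}. m r1 t1 \<le> m r1 x}"
      using \<delta>(2)[rule_format, OF h(1,2)] s0' by simp
    then show False using s0(2) h(1) by fastforce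
  qed
  have "continuous_on {0..r1} (\<lambda>r. m r s)"
    using dom[OF s] by (intro cont_on_comp[OF mass_cont] continuous_intros) auto
  moreover have "m 0 s \<le> m r1 t1" using xbar_le_mass[OF reg] xbar_pos by simp
  ultimately obtain r where "0 \<le> r" "r \<le> r1" "m r s = m r1 t1"
    using IVT'[of "\<lambda>r. m r s" 0 "m r1 t1" r1] ge rr1 by auto
  then show ?thesis using that[of r] xps[OF s] dom[OF s] by (simp add: reg_def)
qed

text \<open>Along a particle path the specific volume V = 1/X satisfies V' = V u_r. For its power e
  the bound on u_r, which is proportional to r^b z = kap X^e, cancels exactly and leaves a constant
  growth rate.\<close>

lemma specific_volume_bound:
  assumes reg: "(r1,t1) \<in> reg" and L: "0 \<le> L"
    and ur: "\<And>r t. (r,t) \<in> reg \<Longrightarrow> ur r t \<le> L * (r powr b * z r t)"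
  shows "vL d \<rho> (m r1 t1) t1 powr e \<le> vL d \<rho> (m r1 t1) 0 powr e + e * kap * L * t1"
proof (cases "t1 = 0")
  case False
  define x where "x = m r1 t1"
  define R where "R s = rL d \<rho> x s" for s
  define X where "X s = (R s)^(d-1) * \<rho> (R s) s" for s
  note rr1 = regD[OF reg]
  have t1: "0 < t1" using False rr1 by simp
  have dom: "s \<in> time_dom T" if "0 \<le> s" "s \<le> t1" for s by (rule time_dom_le[OF rr1(2) that])
  have R: "(R s, s) \<in> reg" "m (R s) s = x" if s: "0 \<le> s" "s \<le> t1" for s
  proof -
    obtain r where r: "(r,s) \<in> reg" "m r s = x" using particle_path[OF reg s] by (auto simp: x_def)
    have "R s = r" using rL_mass[OF dom[OF s] regD(1)[OF r(1)] reg_supersonic(1)[OF r(1)]] r(2) by (simp add: R_def)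
    then show "(R s, s) \<in> reg" "m (R s) s = x" using r by auto
  qed
  have X: "0 < X s" if "0 \<le> s" "s \<le> t1" for s
    using regD(1)[OF R(1)[OF that]] reg_supersonic(1)[OF R(1)[OF that]] by (simp add: X_def)
  have dR: "(R has_real_derivative u (R s) s) (at s)" if "0 < s" "s \<le> t1" for s
    using rL_deriv_time[of s "R s"] R[of s] dom[of s] regD(1)[OF R(1)[of s]] reg_supersonic(1)[OF R(1)[of s]] that
    unfolding R_def by simp
  \<comment> \<open>The derivative of the path is available for s > 0 only. Continuity at 0 is
    obtained by trapping: masses at fixed radii on either side of \<open>R 0\<close> stay on their
    side of x for short times.\<close>
  have R0: "(R \<longlongrightarrow> R 0) (at_right 0)"
  proof (rule order_tendstoI)
    note R00 = R[OF order_refl less_imp_le[OF t1]]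
    note r0 = regD(1)[OF R00(1)] and p0 = reg_supersonic(1)[OF R00(1)]
    have near: "eventually (\<lambda>s. 0 < s \<and> s < t1) (at_right 0)"
      using eventually_at_right_real[OF t1] by (rule eventually_mono) auto
    have mlim: "((\<lambda>s. m a s) \<longlongrightarrow> m a 0) (at_right 0)" if "0 \<le> a" for a
    proof -
      have "continuous_on {0..t1} (\<lambda>s. m a s)"
        using that dom by (intro cont_on_comp[OF mass_cont] continuous_intros) auto
      then show ?thesis by (rule continuous_on_Icc_at_rightD[OF _ t1])
    qed
    fix a assume a: "a < R 0"
    define a1 where "a1 = max a 0"
    have a1: "0 \<le> a1" "a \<le> a1" "a1 < R 0" using a r0 by (auto simp: a1_def)
    have "m a1 0 < x" using mass_strict[OF zero_time a1(1,3), of "R 0"] a1 r0 p0 R00 by simp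
    then have "eventually (\<lambda>s. m a1 s < x) (at_right 0)" by (rule order_tendstoD[OF mlim[OF a1(1)]])
    with near show "eventually (\<lambda>s. a < R s) (at_right 0)"
    proof eventually_elim
      case (elim s)
      then have s: "0 \<le> s" "s \<le> t1" by auto
      show ?case
      proof (rule ccontr)
        assume "\<not> a < R s"
        then have "m (R s) s \<le> m a1 s" using a1 regD(1)[OF R(1)[OF s]] by (intro mass_mono[OF dom[OF s]]) auto
        then show False using elim R(2)[OF s] by simp
      qed
    qed
  next
    note R00 = R[OF order_refl less_imp_le[OF t1]]
    note r0 = regD(1)[OF R00(1)] and p0 = reg_supersonic(1)[OF R00(1)]
    have near: "eventually (\<lambda>s. 0 < s \<and> s < t1) (at_right 0)"
      using eventually_at_right_real[OF t1] by (rule eventually_mono) auto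
    fix a assume a: "R 0 < a"
    have "continuous_on {0..t1} (\<lambda>s. m a s)"
      using a r0 dom by (intro cont_on_comp[OF mass_cont] continuous_intros) auto
    then have mlim: "((\<lambda>s. m a s) \<longlongrightarrow> m a 0) (at_right 0)" by (rule continuous_on_Icc_at_rightD[OF _ t1])
    have "x < m a 0" using mass_strict[OF zero_time less_imp_le[OF r0] a, of "R 0"] a r0 p0 R00 by simp
    then have "eventually (\<lambda>s. x < m a s) (at_right 0)" by (rule order_tendstoD[OF mlim])
    with near show "eventually (\<lambda>s. R s < a) (at_right 0)"
    proof eventually_elim
      case (elim s)
      then have s: "0 \<le> s" "s \<le> t1" by auto
      show ?case
      proof (rule ccontr)
        assume "\<not> R s < a"
        then have "m a s \<le> m (R s) s" using a r0 by (intro mass_mono[OF dom[OF s]]) auto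
        then show False using elim R(2)[OF s] by simp
      qed
    qed
  qed
  have contR: "continuous_on {0..t1} R"
    unfolding continuous_on_eq_continuous_within
  proof
    fix s assume s: "s \<in> {0..t1}"
    show "continuous (at s within {0..t1}) R"
    proof (cases "s = 0")
      case True
      have "at 0 within {0..t1} = at_right 0"
        by (rule at_within_nhd[of _ "{..<t1}"]) (use t1 in auto)
      then show ?thesis using R0 True by (simp add: continuous_within)
    next
      case False
      then show ?thesis using DERIV_isCont[OF dR[of s]] s by (simp add: continuous_at_imp_continuous_at_within)
    qed
  qed
  have contX: "continuous_on {0..t1} X"
    unfolding X_def using regD(1)[OF R(1)] dom
    by (intro continuous_intros contR cont_on_comp[OF cont_\<rho>u(1)]) (auto simp: less_imp_le)
  define V where "V s = (1 / X s) powr e" for s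
  have contV: "continuous_on {0..t1} V"
    unfolding V_def using X by (intro continuous_intros contX) (auto simp: less_le)
  have dV: "(V has_real_derivative e * V s * ur (R s) s) (at s)" if s: "0 < s" "s \<le> t1" for s
  proof -
    have s': "0 \<le> s" using s by simp
    note regs = R(1)[OF s' s(2)]
    note r = regD(1)[OF regs] and p = reg_supersonic(1)[OF regs]
    have pair: "((\<lambda>s. (R s, s)) has_derivative (\<lambda>h. (h * u (R s) s, h))) (at s)"
      using dR[OF s] by (intro has_derivative_Pair has_derivative_ident) (simp add: has_field_derivative_def mult_commute_abs)
    have "((\<lambda>s. \<rho> (fst (R s, s)) (snd (R s, s))) has_derivative
       (\<lambda>h. fst (h * u (R s) s, h) * \<rho>r (R s) s + snd (h * u (R s) s, h) * \<rho>t (R s) s)) (at s)"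
      by (rule has_derivative_compose[OF pair]) (use \<rho>_has_derivative[OF r s(1) dom[OF s' s(2)]] in simp)
    moreover have "(\<lambda>h. fst (h * u (R s) s, h) * \<rho>r (R s) s + snd (h * u (R s) s, h) * \<rho>t (R s) s)
      = (*) (u (R s) s * \<rho>r (R s) s + \<rho>t (R s) s)"
      by (rule ext) (simp add: algebra_simps)
    ultimately have d\<rho>: "((\<lambda>s. \<rho> (R s) s) has_real_derivative u (R s) s * \<rho>r (R s) s + \<rho>t (R s) s) (at s)"
      by (simp only: has_field_derivative_def fst_conv snd_conv)
    have dr: "((\<lambda>r. r^(d-1)) has_real_derivative n * (R s)^(d-1) / R s) (at (R s))"
      unfolding n_def by (rule power_deriv[OF r])
    have dX0: "(X has_real_derivative n * (R s)^(d-1) / R s * u (R s) s * \<rho> (R s) s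
        + (u (R s) s * \<rho>r (R s) s + \<rho>t (R s) s) * (R s)^(d-1)) (at s)"
      unfolding X_def by (rule DERIV_mult[OF DERIV_chain2[OF dr dR[OF s]] d\<rho>])
    have eq: "u (R s) s * \<rho>r (R s) s + \<rho>t (R s) s = - \<rho> (R s) s * (ur (R s) s + n * u (R s) s / R s)"
      using euler_mass[OF r s(1) dom[OF s' s(2)]] by simp
    \<comment> \<open>The growth of r^(d-1) along the path cancels the geometric term of the mass
      equation, so only u_r remains.\<close>
    have dX: "(X has_real_derivative - (X s * ur (R s) s)) (at s)"
      by (rule DERIV_cong[OF dX0], unfold eq X_def) (simp add: algebra_simps)
    have "((\<lambda>x. (1/x) powr e) has_real_derivative - e * (1 / X s) powr e / X s) (at (X s))"
    proof -
      have "((\<lambda>x. x powr (- e)) has_real_derivative (- e) * X s powr (- e - 1)) (at (X s))"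
        by (rule has_real_derivative_powr[OF X[OF s' s(2)]])
      then have "((\<lambda>x. x powr (- e)) has_real_derivative - e * (1 / X s) powr e / X s) (at (X s))"
        using X[OF s' s(2)] by (simp add: powr_diff powr_minus_divide powr_divide)
      then show ?thesis
        by (rule has_field_derivative_transform_within_open[OF _ open_greaterThan[of 0]])
          (use X[OF s' s(2)] in \<open>auto simp: powr_minus_divide powr_divide\<close>)
    qed
    from DERIV_chain2[OF this dX] X[OF s' s(2)] show ?thesis
      unfolding V_def by (simp add: field_simps)
  qed
  have "\<exists>\<xi>>0. \<xi> < t1 \<and> V t1 - V 0 = (t1 - 0) * (e * V \<xi> * ur (R \<xi>) \<xi>)"
  proof -
    obtain \<xi> where "0 < \<xi>" "\<xi> < t1" "V t1 - V 0 = (*) (e * V \<xi> * ur (R \<xi>) \<xi>) (t1 - 0)"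
      by (rule mvt[OF t1 contV, of "\<lambda>s. (*) (e * V s * ur (R s) s)"])
        (use dV in \<open>auto simp: has_field_derivative_def\<close>)
    then show ?thesis by (intro exI[of _ \<xi>]) (simp add: mult.commute)
  qed
  then obtain \<xi> where \<xi>: "0 < \<xi>" "\<xi> < t1" "V t1 - V 0 = t1 * (e * V \<xi> * ur (R \<xi>) \<xi>)" by auto
  have "e * V \<xi> * ur (R \<xi>) \<xi> \<le> e * kap * L"
  proof -
    have \<xi>': "0 \<le> \<xi>" "\<xi> \<le> t1" using \<xi> by auto
    note regx = R(1)[OF \<xi>']
    have "R \<xi> powr b * z (R \<xi>) \<xi> = kap * X \<xi> powr e"
      using eta_eq[OF regD(1)[OF regx], of \<xi>] reg_supersonic(1)[OF regx] by (simp add: X_def)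
    then have "V \<xi> * ur (R \<xi>) \<xi> \<le> V \<xi> * (L * (kap * X \<xi> powr e))"
      using ur[OF regx] by (intro mult_left_mono) (auto simp: V_def)
    also have "\<dots> = kap * L" using X[OF \<xi>'] by (simp add: V_def powr_divide)
    finally show ?thesis using e_pos by simp
  qed
  then have "V t1 - V 0 \<le> t1 * (e * kap * L)" unfolding \<xi>(3) using t1 by simp
  moreover have "vL d \<rho> x s = 1 / X s" for s by (simp add: vL_def AL_def X_def R_def)
  ultimately show ?thesis by (simp add: V_def x_def[symmetric] mult.commute)
qed simp

lemma main_bounds:
  assumes N1: "(SUP x\<in>{x. xbar \<le> x \<and> x \<in> LDom d \<rho> 0}.
                 ereal (max (alpha_t K \<gamma> d \<rho> u x 0) (beta_t K \<gamma> d \<rho> u x 0))) < ereal N"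
    and N2: "N > max (8*(\<gamma>-1) / ((3-\<gamma>) * K_c K \<gamma>)) (4*(\<gamma>-1) / ((3*\<gamma>-5) * K_c K \<gamma>))
                 * K_hat \<gamma> d \<rho> xbar"
  shows "(SUP p\<in>Omega d T \<rho> xp.
             ereal (max (alpha_t K \<gamma> d \<rho> u (fst p) (snd p)) (beta_t K \<gamma> d \<rho> u (fst p) (snd p))))
           < ereal N \<and>
         (\<forall>(x,t)\<in>Omega d T \<rho> xp.
           vL d \<rho> x t powr ((\<gamma>-1)/2)
             \<le> vL d \<rho> x 0 powr ((\<gamma>-1)/2) + sqrt (K*\<gamma>) * (1 / K_tau K \<gamma>) * N * t)"
proof -
  have Kt: "0 < K_tau K \<gamma>" by (rule K_tau_pos)
  define th where "th = max (8*(\<gamma>-1) / ((3-\<gamma>) * K_c K \<gamma>)) (4*(\<gamma>-1) / ((3*\<gamma>-5) * K_c K \<gamma>)) * K_hat \<gamma> d \<rho> xbar"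
  have Kh: "K_hat \<gamma> d \<rho> xbar = e * (3*\<gamma>-5) * n / 4 * rbar powr (- (b + 1))"
  proof -
    have n: "real d - 1 = n" using d2 by (simp add: n_def)
    have ex: "(real d * (1-\<gamma>) + \<gamma> - 3)/2 = - (b + 1)" unfolding b_def n[symmetric] e_def by (simp add: field_simps)
    have "rL d \<rho> xbar 0 = rbar" using rL_mass[OF zero_time rbar ini_pos[OF rbar]] xbar by simp
    then show ?thesis unfolding K_hat_def ex n by (simp add: e_def)
  qed
  have g5: "0 < 3 * \<gamma> - 5" using gam53 by simp
  \<comment> \<open>By K_c = e / K_tau, the second entry of the maximum times K_hat is 2 n e K_tau
    rbar^(-(b+1)), which is twice what the condition n e \<le> \<mu> rbar^(b+1) asks of N'.\<close>
  have thl: "2 * n * e * K_tau K \<gamma> * rbar powr (- (b+1)) \<le> th"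
  proof -
    have "4*(\<gamma>-1) / ((3*\<gamma>-5) * K_c K \<gamma>) * K_hat \<gamma> d \<rho> xbar \<le> th"
      unfolding th_def Kh using g5 e_pos n_pos by (intro mult_right_mono max.cobounded2) simp
    moreover have "4*(\<gamma>-1) / ((3*\<gamma>-5) * K_c K \<gamma>) * K_hat \<gamma> d \<rho> xbar = 2 * n * e * K_tau K \<gamma> * rbar powr (- (b+1))"
    proof -
      have e2: "\<gamma> - 1 = 2 * e" by (simp add: e_def)
      have "4 * (2*e) / (q * (e/k)) * (e*q*n/4*y) = 2*n*e*k*y" if "0 < q" "0 < k" for q k y :: real
        using that e_pos by (simp add: field_simps)
      from this[OF g5 Kt] show ?thesis unfolding Kh K_c_eq e2 .
    qed
    ultimately show ?thesis by simp
  qed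
  obtain N' where N': "max (SUP x\<in>{x. xbar \<le> x \<and> x \<in> LDom d \<rho> 0}.
      ereal (max (alpha_t K \<gamma> d \<rho> u x 0) (beta_t K \<gamma> d \<rho> u x 0))) (ereal th) < ereal N'" "ereal N' < ereal N"
    using ereal_dense2[of "max (SUP x\<in>{x. xbar \<le> x \<and> x \<in> LDom d \<rho> 0}.
      ereal (max (alpha_t K \<gamma> d \<rho> u x 0) (beta_t K \<gamma> d \<rho> u x 0))) (ereal th)" "ereal N"] N1 N2
    by (auto simp: th_def)
  define \<mu> where "\<mu> = N' / K_tau K \<gamma>"
  have th_N': "th < N'" using N'(1) by simp
  \<comment> \<open>The supremum over the data may be negative; N' is positive because of the
    threshold.\<close>
  have "0 < 2 * n * e * K_tau K \<gamma> * rbar powr (- (b+1))" using n_pos e_pos Kt rbar by simp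
  then have N'pos: "0 < N'" using thl th_N' by linarith
  have \<mu>: "0 < \<mu>" "n * e \<le> \<mu> * rbar powr (b + 1)"
  proof -
    show "0 < \<mu>" using N'pos Kt by (simp add: \<mu>_def)
    have "2 * n * e * K_tau K \<gamma> * rbar powr (- (b+1)) * (rbar powr (b+1) / K_tau K \<gamma>) \<le> N' * (rbar powr (b+1) / K_tau K \<gamma>)"
      using thl th_N' Kt by (intro mult_right_mono) auto
    moreover have "rbar powr (- (b+1)) * rbar powr (b+1) = 1" using rbar by (simp add: powr_add[symmetric])
    moreover have "2 * n * e * k * y * (w / k) = 2 * (n * e) * (y * w)" if "0 < k" for k y w :: real using that by simp
    note this[OF Kt]
    ultimately have "2 * (n * e) \<le> N' * (rbar powr (b+1) / K_tau K \<gamma>)" by simp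
    moreover have "0 < n * e" using n_pos e_pos by simp
    ultimately show "n * e \<le> \<mu> * rbar powr (b + 1)" by (simp add: \<mu>_def)
  qed
  have eta: "0 < r powr b * z r t" if "(r,t) \<in> reg" for r t
    using regD(1)[OF that] z_pos[OF reg_supersonic(1)[OF that]] by simp
  have g_split: "g \<mu> s r * z r t = \<mu> * (r powr b * z r t) - s * (n * c r t / r)" for s r t
    by (simp add: g_def c_def algebra_simps)
  have bounds: "alpha_t K \<gamma> d \<rho> u (m r t) t = (Wr 1 r t + n * c r t / r) * K_tau K \<gamma> / (r powr b * z r t)"
     "beta_t K \<gamma> d \<rho> u (m r t) t = (Wr (-1) r t - n * c r t / r) * K_tau K \<gamma> / (r powr b * z r t)"
    if "(r,t) \<in> reg" for r t
    using gradient_variables[OF regD(2,1)[OF that] reg_supersonic(1)[OF that]] by (simp_all add: Wr_def)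
  have init: "Wr s r 0 < g \<mu> s r * z r 0" if s: "s = 1 \<or> s = -1" and r: "rbar \<le> r" for s r
  proof -
    have reg: "(r,0) \<in> reg" using reg_at_0 r by simp
    have "m r 0 \<in> {x. xbar \<le> x \<and> x \<in> LDom d \<rho> 0}"
      using xbar_le_mass[OF reg] regD[OF reg] by (auto simp: LDom_def intro: less_imp_le)
    from SUP_upper[OF this, of "\<lambda>x. ereal (max (alpha_t K \<gamma> d \<rho> u x 0) (beta_t K \<gamma> d \<rho> u x 0))"]
    have "ereal (max (alpha_t K \<gamma> d \<rho> u (m r 0) 0) (beta_t K \<gamma> d \<rho> u (m r 0) 0)) < ereal N'"
      using N'(1) unfolding max_less_iff_conj by (elim conjE) (rule le_less_trans)
    then have "alpha_t K \<gamma> d \<rho> u (m r 0) 0 < N'" "beta_t K \<gamma> d \<rho> u (m r 0) 0 < N'" by auto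
    then have "(Wr 1 r 0 + n * c r 0 / r) * K_tau K \<gamma> < N' * (r powr b * z r 0)"
      "(Wr (-1) r 0 - n * c r 0 / r) * K_tau K \<gamma> < N' * (r powr b * z r 0)"
      unfolding bounds[OF reg] using eta[OF reg] by (simp_all only: pos_divide_less_eq)
    then have "Wr 1 r 0 + n * c r 0 / r < \<mu> * (r powr b * z r 0)" "Wr (-1) r 0 - n * c r 0 / r < \<mu> * (r powr b * z r 0)"
      unfolding pos_less_divide_eq[OF Kt, symmetric] by (simp_all add: \<mu>_def)
    then show ?thesis using s unfolding g_split by auto
  qed
  have main: "Wr s r t \<le> \<mu> * (r powr b * z r t) - s * (n * c r t / r)" if "(r,t) \<in> reg" "s = 1 \<or> s = -1" for s r t
    using gradient_bound[OF \<mu> init that] by (simp add: g_split)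
  have Om: "\<exists>r. (r,t) \<in> reg \<and> m r t = x" if "(x,t) \<in> Omega d T \<rho> xp" for x t
    using that by (auto simp: Omega_def LDom_def reg_def time_dom_def)
  have "(SUP p\<in>Omega d T \<rho> xp.
       ereal (max (alpha_t K \<gamma> d \<rho> u (fst p) (snd p)) (beta_t K \<gamma> d \<rho> u (fst p) (snd p)))) \<le> ereal N'"
  proof (rule SUP_least)
    fix p assume "p \<in> Omega d T \<rho> xp"
    then obtain r where r: "(r, snd p) \<in> reg" "m r (snd p) = fst p" using Om[of "fst p" "snd p"] by auto
    have "(Wr 1 r (snd p) + n * c r (snd p) / r) * K_tau K \<gamma> \<le> N' * (r powr b * z r (snd p))"
      "(Wr (-1) r (snd p) - n * c r (snd p) / r) * K_tau K \<gamma> \<le> N' * (r powr b * z r (snd p))"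
      unfolding pos_le_divide_eq[OF Kt, symmetric]
      using main[OF r(1), of 1] main[OF r(1), of "-1"] by (simp_all add: \<mu>_def)
    then have "alpha_t K \<gamma> d \<rho> u (m r (snd p)) (snd p) \<le> N'" "beta_t K \<gamma> d \<rho> u (m r (snd p)) (snd p) \<le> N'"
      unfolding bounds[OF r(1)] using eta[OF r(1)] by (simp_all only: pos_divide_le_eq)
    then show "ereal (max (alpha_t K \<gamma> d \<rho> u (fst p) (snd p)) (beta_t K \<gamma> d \<rho> u (fst p) (snd p))) \<le> ereal N'"
      by (simp add: r(2))
  qed
  also have "\<dots> < ereal N" by (rule N'(2))
  finally have concl1: "(SUP p\<in>Omega d T \<rho> xp.
       ereal (max (alpha_t K \<gamma> d \<rho> u (fst p) (snd p)) (beta_t K \<gamma> d \<rho> u (fst p) (snd p)))) < ereal N" .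
  \<comment> \<open>Adding the bounds for s = 1 and s = -1 cancels z_r and the geometric
    terms.\<close>
  have ur_le: "ur r t \<le> \<mu> * (r powr b * z r t)" if "(r,t) \<in> reg" for r t
    using main[OF that, of 1] main[OF that, of "-1"] by (simp add: Wr_def)
  have concl2: "vL d \<rho> x t powr ((\<gamma>-1)/2) \<le> vL d \<rho> x 0 powr ((\<gamma>-1)/2) + sqrt (K*\<gamma>) * (1 / K_tau K \<gamma>) * N * t"
    if xt: "(x,t) \<in> Omega d T \<rho> xp" for x t
  proof -
    obtain r where r: "(r,t) \<in> reg" "m r t = x" using Om[OF xt] by auto
    have "vL d \<rho> x t powr e \<le> vL d \<rho> x 0 powr e + e * kap * \<mu> * t"
      using specific_volume_bound[OF r(1) less_imp_le[OF \<mu>(1)] ur_le] by (simp only: r(2))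
    also have "e * kap * \<mu> * t = sqrt (K*\<gamma>) * (1 / K_tau K \<gamma>) * N' * t"
      using gam by (simp add: \<mu>_def kap_def e_def)
    also have "\<dots> \<le> sqrt (K*\<gamma>) * (1 / K_tau K \<gamma>) * N * t"
      using N'(2) Kt K gam regD(4)[OF r(1)] by (intro mult_right_mono mult_left_mono) auto
    finally show ?thesis by (simp add: e_def)
  qed
  show ?thesis using concl1 concl2 by blast
qed

end

section \<open>From the conservative system to the nonconservative equations\<close>

lemma radial_euler_of_classical:
  assumes K: "0 < K" and gam: "1 < \<gamma>" and d: "2 \<le> d" and sol: "classical_solution K \<gamma> d T \<rho> u"
  obtains \<rho>r \<rho>t ur ut where "radial_euler K \<gamma> d T \<rho> u \<rho>r \<rho>t ur ut"
proof -
  from sol obtain f1 f2 where f: "continuous_on (dom_ST T) f1" "continuous_on (dom_ST T) f2"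
    "\<forall>p\<in>dom_ST T. ((\<lambda>(r,t). \<rho> r t) has_derivative (\<lambda>(h,k). h * f1 p + k * f2 p)) (at p within dom_ST T)"
    by (auto simp: classical_solution_def C1_on2_def)
  from sol obtain g1 g2 where g: "continuous_on (dom_ST T) g1" "continuous_on (dom_ST T) g2"
    "\<forall>p\<in>dom_ST T. ((\<lambda>(r,t). u r t) has_derivative (\<lambda>(h,k). h * g1 p + k * g2 p)) (at p within dom_ST T)"
    by (auto simp: classical_solution_def C1_on2_def)
  define \<rho>r where "\<rho>r r t = f1 (r,t)" for r t
  define \<rho>t where "\<rho>t r t = f2 (r,t)" for r t
  define ur where "ur r t = g1 (r,t)" for r t
  define ut where "ut r t = g2 (r,t)" for r t
  have dom: "(r,t) \<in> dom_ST T \<longleftrightarrow> 0 \<le> r \<and> t \<in> time_dom T" for r t by (auto simp: dom_ST_eq)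
  have \<rho>d: "((\<lambda>(r,t). \<rho> r t) has_derivative (\<lambda>(h,k). h * \<rho>r r t + k * \<rho>t r t)) (at (r,t) within dom_ST T)"
    if "0 \<le> r" "t \<in> time_dom T" for r t using f(3) that unfolding \<rho>r_def \<rho>t_def by (simp add: dom)
  have ud: "((\<lambda>(r,t). u r t) has_derivative (\<lambda>(h,k). h * ur r t + k * ut r t)) (at (r,t) within dom_ST T)"
    if "0 \<le> r" "t \<in> time_dom T" for r t using g(3) that unfolding ur_def ut_def by (simp add: dom)
  have eqs: "\<rho>t r t + u r t * \<rho>r r t + \<rho> r t * (ur r t + real (d-1) * u r t / r) = 0 \<and>
      (0 < \<rho> r t \<longrightarrow> ut r t + u r t * ur r t + K * \<gamma> * \<rho> r t powr (\<gamma> - 2) * \<rho>r r t = 0)"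
    if r: "0 < r" and t: "0 < t" "t \<in> time_dom T" for r t
  proof -
    define n where "n = real (d - 1)"
    define A where "A = r^(d-1)"
    have A: "0 < A" using r by (simp add: A_def)
    have r0: "0 \<le> r" using r by simp
    note w = at_within_pos[OF r] at_within_time[OF t]
    have D: "((\<lambda>r. \<rho> r t) has_real_derivative \<rho>r r t) (at r)" "((\<lambda>t. \<rho> r t) has_real_derivative \<rho>t r t) (at t)"
      "((\<lambda>r. u r t) has_real_derivative ur r t) (at r)" "((\<lambda>t. u r t) has_real_derivative ut r t) (at t)"
      using slice_deriv[OF \<rho>d[OF r0 t(2)] r0 t(2)] slice_deriv_t[OF \<rho>d[OF r0 t(2)] r0 t(2)]
        slice_deriv[OF ud[OF r0 t(2)] r0 t(2)] slice_deriv_t[OF ud[OF r0 t(2)] r0 t(2)] by (simp_all add: w)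
    have dr: "((\<lambda>r. r^(d-1)) has_real_derivative n * A / r) (at r)"
      unfolding n_def A_def by (rule power_deriv[OF r])
    have e1: "pdt (\<lambda>r t. r^(d-1) * \<rho> r t) r t = A * \<rho>t r t"
      unfolding pdt_def A_def by (rule DERIV_imp_deriv) (rule DERIV_cmult[OF D(2)])
    have e2: "pdr (\<lambda>r t. r^(d-1) * \<rho> r t * u r t) r t = (n * A / r * \<rho> r t + \<rho>r r t * A) * u r t + ur r t * (A * \<rho> r t)"
      unfolding pdr_def using DERIV_mult[OF DERIV_mult[OF dr D(1)] D(3)] by (intro DERIV_imp_deriv) (simp only: A_def)
    have e3: "pdt (\<lambda>r t. r^(d-1) * \<rho> r t * u r t) r t = A * \<rho>t r t * u r t + ut r t * (A * \<rho> r t)"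
      unfolding pdt_def using DERIV_mult[OF DERIV_cmult[OF D(2)] D(4), of A] by (intro DERIV_imp_deriv) (simp only: A_def)
    have e4: "pdr (\<lambda>r t. r^(d-1) * \<rho> r t * (u r t)\<^sup>2) r t
       = (n * A / r * \<rho> r t + \<rho>r r t * A) * (u r t)\<^sup>2 + 2 * u r t * ur r t * (A * \<rho> r t)"
    proof -
      have "((\<lambda>r. (u r t)\<^sup>2) has_real_derivative 2 * u r t * ur r t) (at r)"
        using D(3) by (auto intro!: derivative_eq_intros)
      from DERIV_mult[OF DERIV_mult[OF dr D(1)] this] show ?thesis
        unfolding pdr_def by (intro DERIV_imp_deriv) (simp only: A_def)
    qed
    have "r > 0 \<and> 0 < t \<and> ereal t < T" using r t by (simp add: time_dom_def)
    then have E: "pdt (\<lambda>r t. r^(d-1) * \<rho> r t) r t + pdr (\<lambda>r t. r^(d-1) * \<rho> r t * u r t) r t = 0"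
      "pdt (\<lambda>r t. r^(d-1) * \<rho> r t * u r t) r t + pdr (\<lambda>r t. r^(d-1) * \<rho> r t * (u r t)\<^sup>2) r t
        + r^(d-1) * pdr (\<lambda>r t. K * \<rho> r t powr \<gamma>) r t = 0"
      using sol unfolding classical_solution_def by blast+
    have "A * (\<rho>t r t + u r t * \<rho>r r t + \<rho> r t * (ur r t + n * u r t / r)) = 0"
      using E(1) unfolding e1 e2 by (simp add: algebra_simps)
    then have mass: "\<rho>t r t + u r t * \<rho>r r t + \<rho> r t * (ur r t + n * u r t / r) = 0" using A by simp
    have "ut r t + u r t * ur r t + K * \<gamma> * \<rho> r t powr (\<gamma> - 2) * \<rho>r r t = 0" if p: "0 < \<rho> r t"
    proof -
      have "((\<lambda>r. \<rho> r t powr \<gamma>) has_real_derivative \<gamma> * \<rho> r t powr (\<gamma> - 1) * \<rho>r r t) (at r)"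
        by (rule DERIV_chain2[OF has_real_derivative_powr[OF p] D(1)])
      from DERIV_cmult[OF this, of K]
      have e5: "pdr (\<lambda>r t. K * \<rho> r t powr \<gamma>) r t = K * (\<gamma> * \<rho> r t powr (\<gamma> - 1) * \<rho>r r t)"
        unfolding pdr_def by (rule DERIV_imp_deriv)
      have pw: "\<rho> r t powr (\<gamma> - 1) = \<rho> r t powr (\<gamma> - 2) * \<rho> r t"
        using powr_add[of "\<rho> r t" "\<gamma> - 2" 1] p by simp
      \<comment> \<open>The momentum equation is A \<rho> times the velocity equation plus u A times
        the mass equation; what is left can be divided by A \<rho>.\<close>
      have "A * \<rho> r t * (ut r t + u r t * ur r t + K * \<gamma> * \<rho> r t powr (\<gamma> - 2) * \<rho>r r t)
        + u r t * A * (\<rho>t r t + u r t * \<rho>r r t + \<rho> r t * (ur r t + n * u r t / r)) = 0"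
        using E(2) unfolding e3 e4 e5 pw A_def[symmetric] by (simp add: algebra_simps power2_eq_square)
      then show ?thesis unfolding mass using A p by simp
    qed
    then show ?thesis using mass by (simp add: n_def)
  qed
  have "radial_euler K \<gamma> d T \<rho> u \<rho>r \<rho>t ur ut"
  proof
    show "continuous_on (dom_ST T) (\<lambda>(r,t). \<rho>r r t)" "continuous_on (dom_ST T) (\<lambda>(r,t). \<rho>t r t)"
      "continuous_on (dom_ST T) (\<lambda>(r,t). ur r t)" "continuous_on (dom_ST T) (\<lambda>(r,t). ut r t)"
      using f(1,2) g(1,2) by (simp_all add: \<rho>r_def \<rho>t_def ur_def ut_def split_def)
    show "0 \<le> \<rho> r t" if "0 \<le> r" "t \<in> time_dom T" for r t
      using sol that dom[of r t] unfolding classical_solution_def by blast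
  qed (use K gam d \<rho>d ud eqs in auto)
  then show ?thesis by (rule that)
qed

theorem theorem5p4:
  fixes K \<gamma> :: real and d :: nat and T :: ereal
    and \<rho> u :: "real \<Rightarrow> real \<Rightarrow> real"
    and xbar N :: real and xp :: "real \<Rightarrow> real"
  assumes K: "K > 0"
    and gam: "5/3 < \<gamma>" "\<gamma> < 3"
    and d: "d \<in> {2,3}"
    and T: "T > 0"
    and sol: "classical_solution K \<gamma> d T \<rho> u"
    and A: "assumption_A K \<gamma> (\<lambda>r. \<rho> r 0) (\<lambda>r. u r 0)"
    and xbar: "xbar > 0" "xbar \<in> LDom d \<rho> 0"
    and xp: "forward_char K \<gamma> d T \<rho> xbar xp"
    and N1: "(SUP x\<in>{x. xbar \<le> x \<and> x \<in> LDom d \<rho> 0}.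
                 ereal (max (alpha_t K \<gamma> d \<rho> u x 0) (beta_t K \<gamma> d \<rho> u x 0))) < ereal N"
    and N2: "N > max (8*(\<gamma>-1) / ((3-\<gamma>) * K_c K \<gamma>)) (4*(\<gamma>-1) / ((3*\<gamma>-5) * K_c K \<gamma>))
                 * K_hat \<gamma> d \<rho> xbar"
  shows "(SUP p\<in>Omega d T \<rho> xp.
             ereal (max (alpha_t K \<gamma> d \<rho> u (fst p) (snd p)) (beta_t K \<gamma> d \<rho> u (fst p) (snd p))))
           < ereal N \<and>
         (\<forall>(x,t)\<in>Omega d T \<rho> xp.
           vL d \<rho> x t powr ((\<gamma>-1)/2)
             \<le> vL d \<rho> x 0 powr ((\<gamma>-1)/2) + sqrt (K*\<gamma>) * (1 / K_tau K \<gamma>) * N * t)"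
proof -
  have gam1: "1 < \<gamma>" and d2: "2 \<le> d" using gam d by auto
  obtain \<rho>r \<rho>t ur ut where RE: "radial_euler K \<gamma> d T \<rho> u \<rho>r \<rho>t ur ut"
    by (rule radial_euler_of_classical[OF K gam1 d2 sol])
  interpret E: radial_euler K \<gamma> d T \<rho> u \<rho>r \<rho>t ur ut by (rule RE)
  have T0: "0 \<in> time_dom T" using T by (simp add: time_dom_def zero_ereal_def[symmetric])
  obtain C0 where C0: "\<And>r. 0 < r \<Longrightarrow> 0 < E.kap * \<rho> r 0 powr E.e \<and> E.kap * \<rho> r 0 powr E.e \<le> u r 0 \<and> u r 0 \<le> C0"
    using A unfolding assumption_A_def E.kap_def E.e_def by blast
  obtain rbar where rbar: "0 \<le> rbar" "mass d \<rho> rbar 0 = xbar" using xbar(2) by (auto simp: LDom_def)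
  have rbar_pos: "0 < rbar" using rbar xbar(1) by (cases "rbar = 0") auto
  have "radial_euler_char K \<gamma> d T \<rho> u \<rho>r \<rho>t ur ut xbar rbar C0 xp"
  proof (unfold_locales)
    show "0 < \<rho> r 0" if "0 < r" for r
    \<comment> \<open>Assumption (A) gives positivity of a power of \<rho>; as 0 \<open>powr\<close>
      e is 0, this excludes \<rho> = 0.\<close>
    proof -
      have "\<rho> r 0 \<noteq> 0" using C0[OF that] by auto
      moreover have "0 \<le> \<rho> r 0" using E.\<rho>_nonneg[OF less_imp_le[OF that] T0] .
      ultimately show ?thesis by simp
    qed
  qed (use gam T rbar rbar_pos xp C0 in \<open>auto simp: forward_char_def time_dom_def E.z_def\<close>)
  from radial_euler_char.main_bounds[OF this N1 N2] show ?thesis .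
qed

end
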